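(* Let $M$ be a Riemannian manifold and let $\mathcal{F}=\{f_i \mid i\in\mathbb{N}\}$ be a set of convex functions $f_i:M\rightarrow\mathbb{R}$. Suppose $f:M\rightarrow\mathbb{R}$ is given by $f(x)=\min\{f_i(x)\mid f_i\in\mathcal{F}\}$ for all $x\in M$. Suppose also that for every $x\in M$ there is a neighbourhood $N_x$ of $x$ and a finite subset $\mathcal{F}_x\subset\mathcal{F}$ such that $f(y)=\min\{f_i(y)\mid f_i\in\mathcal{F}_x\}$ for all $y\in N_x$. Then $f$ is a topological Morse function.
   Context: Convex function: a real-valued function on a Riemannian manifold is called convex if it is smooth and its (Riemannian) Hessian is positive definite at every point (elsewhere this is called a smooth, strictly convex function). Topological Morse function: let $M$ be an $n$-dimensional topological manifold. A continuous function $f:M\rightarrow\mathbb{R}$ is a topological Morse function if every point of $M$ is either regular or critical with respect to $f$, in the following sense. - A point $x\in M$ is regular if there is an open neighbourhood $U$ of $x$ that admits a homeomorphic parametrisation by $n$ parameters, one of which is $f$ (that is, a homeomorphism from $U$ onto an open subset of $\mathbb{R}^n$, one of whose coordinate functions is $f|_U$). - A point $p\in M$ is critical if there exist an integer $j$ with $0\leq j\leq n$ (called the index of $p$), an open neighbourhood $U$ of $p$, and a homeomorphic parametrisation of $U$ by parameters $\{x_1,\ldots,x_n\}$ (that is, a homeomorphism $(x_1,\ldots,x_n)$ from $U$ onto an open neighbourhood of the origin in $\mathbb{R}^n$, sending $p$ to the origin) such that for every $x\in U$, $$f(x)-f(p)=\sum_{i=1}^{n-j}x_i^2-\sum_{i=n-j+1}^{n}x_i^2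 .$$ *)

theory Defs
  imports "HOL-Analysis.Analysis"
begin

text \<open>
  These notions are only applied to sets \<open>S\<close> that are open in the model space defined below.
  For \<open>S\<close> open in \<open>real ^ 'n\<close>, differentiation within \<open>S\<close> at a point of \<open>S\<close> is ordinary
  differentiation, and no values outside \<open>S\<close> matter.
\<close>

fun Ck_on :: "nat \<Rightarrow> 'a::real_normed_vector set \<Rightarrow> ('a \<Rightarrow> 'b::real_normed_vector) \<Rightarrow> bool" where
  "Ck_on 0 S h \<longleftrightarrow> continuous_on S h"
| "Ck_on (Suc k) S h \<longleftrightarrow> h differentiable_on S \<and>
     (\<forall>v. Ck_on k S (\<lambda>x. frechet_derivative h (at x within S) v))"

definition smooth_on :: "'a::real_normed_vector set \<Rightarrow> ('a \<Rightarrow> 'b::real_normed_vector) \<Rightarrow> bool" where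
  "smooth_on S h \<longleftrightarrow> (\<forall>k. Ck_on k S h)"

definition partial_deriv ::
    "(real ^ 'n::finite) set \<Rightarrow> 'n \<Rightarrow> (real ^ 'n \<Rightarrow> real) \<Rightarrow> real ^ 'n \<Rightarrow> real" where
  "partial_deriv S i h x = frechet_derivative h (at x within S) (axis i 1)"

text \<open>
  The library space \<open>Euclidean_space n\<close> consists of the sequences \<open>nat \<Rightarrow> real\<close> that vanish from
  index \<open>n\<close> on; its coordinates are numbered \<open>0, \<dots>, n - 1\<close>.
\<close>

definition parametrisation :: "nat \<Rightarrow> 'a topology \<Rightarrow> 'a set \<Rightarrow> ('a \<Rightarrow> nat \<Rightarrow> real) \<Rightarrow> bool" where
  "parametrisation n M U \<phi> \<longleftrightarrow> openin M U \<and>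
     (\<exists>V. openin (Euclidean_space n) V \<and>
        homeomorphic_map (subtopology M U) (subtopology (Euclidean_space n) V) \<phi>)"

definition topological_manifold :: "nat \<Rightarrow> 'a topology \<Rightarrow> bool" where
  "topological_manifold n M \<longleftrightarrow> Hausdorff_space M \<and> second_countable M \<and>
     (\<forall>x\<in>topspace M. \<exists>U \<phi>. x \<in> U \<and> parametrisation n M U \<phi>)"

text \<open>
  For differential calculus, \<open>n\<close>-dimensional space is modelled on \<open>real ^ 'n\<close> with
  \<open>CARD('n) = n\<close>.  Index types are non-empty, so the case \<open>n = 0\<close> is accommodated by using
  the origin of \<open>real ^ 'n\<close> (for any \<open>'n\<close>) as the model space.  Derivatives within a single
  point then carry no information, so there every function is smooth, and the conditions on
  tangent vectors below only concern the zero vector.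
\<close>

definition model_space :: "nat \<Rightarrow> (real ^ 'n::finite) set" where
  "model_space n = (if n = 0 then {0} else UNIV)"

type_synonym ('a, 'n) chart = "'a set \<times> ('a \<Rightarrow> real ^ 'n)"

definition is_chart :: "nat \<Rightarrow> 'a topology \<Rightarrow> ('a, 'n::finite) chart \<Rightarrow> bool" where
  "is_chart n M = (\<lambda>(U, \<phi>). openin M U \<and>
     openin (top_of_set (model_space n)) (\<phi> ` U) \<and>
     homeomorphic_map (subtopology M U) (top_of_set (\<phi> ` U)) \<phi>)"

definition chart_inv :: "('a, 'n::finite) chart \<Rightarrow> real ^ 'n \<Rightarrow> 'a" where
  "chart_inv = (\<lambda>(U, \<phi>). inv_into U \<phi>)"

definition chart_image :: "('a, 'n::finite) chart \<Rightarrow> (real ^ 'n) set" where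
  "chart_image = (\<lambda>(U, \<phi>). \<phi> ` U)"

definition overlap :: "('a, 'n::finite) chart \<Rightarrow> ('a, 'n) chart \<Rightarrow> (real ^ 'n) set" where
  "overlap c d = snd c ` (fst c \<inter> fst d)"

definition transition :: "('a, 'n::finite) chart \<Rightarrow> ('a, 'n) chart \<Rightarrow> real ^ 'n \<Rightarrow> real ^ 'n" where
  "transition c d = snd d \<circ> chart_inv c"

definition smooth_manifold :: "nat \<Rightarrow> 'a topology \<Rightarrow> ('a, 'n::finite) chart set \<Rightarrow> bool" where
  "smooth_manifold n M A \<longleftrightarrow> topological_manifold n M \<and> (n = CARD('n) \<or> n = 0) \<and>
     (\<forall>c\<in>A. is_chart n M c) \<and> (\<Union>c\<in>A. fst c) = topspace M \<and>
     (\<forall>c\<in>A. \<forall>d\<in>A. smooth_on (overlap c d) (transition c d))"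

definition positive_definite :: "nat \<Rightarrow> real ^ 'n ^ 'n::finite \<Rightarrow> bool" where
  "positive_definite n B \<longleftrightarrow> (\<forall>v\<in>model_space n. v \<noteq> 0 \<longrightarrow> v \<bullet> (B *v v) > 0)"

text \<open>
  A metric \<open>g\<close> is given by its component matrices \<open>g c x\<close> in each chart \<open>c\<close> of the atlas, as
  functions of the coordinates \<open>x\<close> of that chart.  The last condition is the transformation
  law of covariant 2-tensors.
\<close>

type_synonym ('a, 'n) metric = "('a, 'n) chart \<Rightarrow> real ^ 'n \<Rightarrow> real ^ 'n ^ 'n"

definition riemannian_manifold ::
    "nat \<Rightarrow> 'a topology \<Rightarrow> ('a, 'n::finite) chart set \<Rightarrow> ('a, 'n) metric \<Rightarrow> bool" where
  "riemannian_manifold n M A g \<longleftrightarrow> smooth_manifold n M A \<and>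
     (\<forall>c\<in>A. smooth_on (chart_image c) (g c) \<and>
        (\<forall>x\<in>chart_image c. transpose (g c x) = g c x \<and> positive_definite n (g c x))) \<and>
     (\<forall>c\<in>A. \<forall>d\<in>A. \<forall>x\<in>overlap c d.
        let D = frechet_derivative (transition c d) (at x within overlap c d)
        in \<forall>v\<in>model_space n. \<forall>w\<in>model_space n.
             v \<bullet> (g c x *v w) = D v \<bullet> (g d (transition c d x) *v D w))"

text \<open>Christoffel symbols of the Levi-Civita connection: \<open>christoffel g c x k i j\<close> is
  \<open>\<Gamma>\<close> with upper index \<open>k\<close> and lower indices \<open>i\<close>, \<open>j\<close>.\<close>

definition christoffel ::
    "('a, 'n::finite) metric \<Rightarrow> ('a, 'n) chart \<Rightarrow> real ^ 'n \<Rightarrow> 'n \<Rightarrow> 'n \<Rightarrow> 'n \<Rightarrow> real" where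
  "christoffel g c x k i j =
     (let pd = partial_deriv (chart_image c)
      in 1 / 2 * (\<Sum>l\<in>UNIV. matrix_inv (g c x) $ k $ l *
           (pd i (\<lambda>y. g c y $ j $ l) x + pd j (\<lambda>y. g c y $ i $ l) x - pd l (\<lambda>y. g c y $ i $ j) x)))"

text \<open>Components, in the chart \<open>c\<close>, of the Riemannian Hessian (second covariant derivative).\<close>

definition hessian ::
    "('a, 'n::finite) metric \<Rightarrow> ('a, 'n) chart \<Rightarrow> ('a \<Rightarrow> real) \<Rightarrow> real ^ 'n \<Rightarrow> real ^ 'n ^ 'n" where
  "hessian g c f x =
     (let pd = partial_deriv (chart_image c); h = f \<circ> chart_inv c
      in \<chi> i j. pd i (pd j h) x - (\<Sum>k\<in>UNIV. christoffel g c x k i j * pd k h x))"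

definition convex_function ::
    "nat \<Rightarrow> ('a, 'n::finite) chart set \<Rightarrow> ('a, 'n) metric \<Rightarrow> ('a \<Rightarrow> real) \<Rightarrow> bool" where
  "convex_function n A g f \<longleftrightarrow>
     (\<forall>c\<in>A. smooth_on (chart_image c) (f \<circ> chart_inv c) \<and>
        (\<forall>x\<in>chart_image c. positive_definite n (hessian g c f x)))"

definition is_minimum :: "real set \<Rightarrow> real \<Rightarrow> bool" where
  "is_minimum S m \<longleftrightarrow> m \<in> S \<and> (\<forall>s\<in>S. m \<le> s)"

definition regular_point :: "nat \<Rightarrow> 'a topology \<Rightarrow> ('a \<Rightarrow> real) \<Rightarrow> 'a \<Rightarrow> bool" where
  "regular_point n M f x \<longleftrightarrow>
     (\<exists>U \<phi>. x \<in> U \<and> parametrisation n M U \<phi> \<and> (\<exists>i<n. \<forall>y\<in>U. \<phi> y i = f y))"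

definition critical_point :: "nat \<Rightarrow> 'a topology \<Rightarrow> ('a \<Rightarrow> real) \<Rightarrow> 'a \<Rightarrow> bool" where
  "critical_point n M f p \<longleftrightarrow>
     (\<exists>j\<le>n. \<exists>U \<phi>. p \<in> U \<and> parametrisation n M U \<phi> \<and> \<phi> p = (\<lambda>_. 0) \<and>
        (\<forall>x\<in>U. f x - f p = (\<Sum>i<n - j. (\<phi> x i)\<^sup>2) - (\<Sum>i\<in>{n - j..<n}. (\<phi> x i)\<^sup>2)))"

definition topological_Morse_function :: "nat \<Rightarrow> 'a topology \<Rightarrow> ('a \<Rightarrow> real) \<Rightarrow> bool" where
  "topological_Morse_function n M f \<longleftrightarrow> topological_manifold n M \<and>
     continuous_map M euclideanreal f \<and>
     (\<forall>x\<in>topspace M. regular_point n M f x \<or> critical_point n M f x)"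

end

theory Submission
  imports Defs
begin

text \<open>
  After the quadratic change of coordinates that makes the Christoffel symbols vanish at a given
  point \<open>p\<close>, the functions attaining the minimum at \<open>p\<close> become functions \<open>h i\<close> with positive definite
  second derivative at \<open>0\<close>.  By Stiemke's theorem their gradients at \<open>0\<close> split into those that occur in a
  positive linear dependence, with span \<open>W\<close>, and those that are positive on some \<open>v\<close> orthogonal to \<open>W\<close>.
  On \<open>W\<close> the minimum decreases at a linear rate and on the orthogonal complement of \<open>W\<close> it increases at a
  quadratic rate, so it strictly increases along the vector field \<open>u - \<delta> w\<close>, where \<open>x = u + w\<close> with
  \<open>w\<close> in \<open>W\<close> and \<open>\<delta>\<close> is small.  If all gradients belong to \<open>W\<close>, sliding points along its flow lines
  identifies the minimum with \<open>(norm u)\<^sup>2 - (norm w)\<^sup>2\<close>.  Otherwise the flow lines are bent towards \<open>v\<close> to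
  form the leaves of a product foliation along which the minimum still increases, and the minimum together with the leaf is a
  coordinate system.  In both cases the inverse is continuous by invariance of domain.
\<close>

section \<open>Linear algebra\<close>

text \<open>The active gradients may satisfy arbitrary linear relations, so differences of the
  functions cannot serve as coordinates and a smooth normal form is out of reach. What is kept of
  the minimum is strict growth along explicit curves: at each moment only the active functions
  matter, and positivity of their derivatives suffices. The fields are positively homogeneous, which
  yields closed formulas for the flow lines. In the regular case neither of the two obvious fields
  works alone. A shift by \<open>v\<close> raises the functions outside the dependence, but the
  gradients inside it annihilate \<open>v\<close>; the field \<open>u - \<delta> w\<close> raises
  those inside but may lower the others. The space is therefore cut along a hypersurface
  \<open>D = 0\<close>, below which no function of the dependence is active. Above it the admissible
  multiple of \<open>v\<close> is limited, because convexity tolerates only a small perturbation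
  proportional to \<open>norm u\<close>; this is why the hypersurface is lowered by a conical margin
  of matching size.\<close>

lemma linear_projection_exists:
  fixes W :: "'e::euclidean_space set"
  assumes "subspace W"
  obtains P :: "'e \<Rightarrow> 'e" where "linear P" "\<And>x. P x \<in> W" "\<And>x y. y \<in> W \<Longrightarrow> (x - P x) \<bullet> y = 0"
    "\<And>x. norm x ^ 2 = norm (x - P x) ^ 2 + norm (P x) ^ 2"
proof -
  obtain B where B: "B \<subseteq> W" "pairwise orthogonal B" "\<And>x. x \<in> B \<Longrightarrow> norm x = 1"
    "independent B" "card B = dim W" "span B = W"
    using orthonormal_basis_subspace[OF assms] by metis
  have fin: "finite B" using B(4) by (rule independent_imp_finite)
  define P where "P x = (\<Sum>b\<in>B. (x \<bullet> b) *\<^sub>R b)" for x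
  have lin: "linear P"
    unfolding P_def by (rule linearI) (simp_all add: inner_add_left scaleR_add_left sum.distrib scaleR_sum_right)
  have inW: "P x \<in> W" for x
    unfolding P_def using B(1) assms by (intro subspace_sum subspace_scale) auto
  have orthB: "(x - P x) \<bullet> b = 0" if "b \<in> B" for x b
  proof -
    have "P x \<bullet> b = (\<Sum>c\<in>B. (x \<bullet> c) * (c \<bullet> b))"
      unfolding P_def by (simp add: inner_sum_left)
    also have "\<dots> = (\<Sum>c\<in>B. if c = b then x \<bullet> c else 0)"
      using B(2,3) that by (intro sum.cong) (auto simp: pairwise_def orthogonal_def norm_eq_1)
    also have "\<dots> = x \<bullet> b" using fin that by simp
    finally show ?thesis by (simp add: inner_diff_left)
  qed
  have orth: "(x - P x) \<bullet> y = 0" if "y \<in> W" for x y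
  proof -
    have "y \<in> span B" using that B(6) by simp
    then show ?thesis
      by (induction rule: span_induct) (auto simp: subspace_def inner_add_right orthB)
  qed
  have pyth: "norm x ^ 2 = norm (x - P x) ^ 2 + norm (P x) ^ 2" for x
  proof -
    have "norm x ^ 2 = norm ((x - P x) + P x) ^ 2" by simp
    also have "\<dots> = norm (x - P x) ^ 2 + norm (P x) ^ 2 + 2 * ((x - P x) \<bullet> P x)"
      by (simp only: power2_norm_eq_inner inner_add_left inner_add_right inner_commute)
    finally show ?thesis using orth[OF inW[of x], of x] by simp
  qed
  show ?thesis using that lin inW orth pyth by blast
qed

text \<open>Coefficients are indexed by \<open>K\<close> rather than by the image set, because
  \<open>l\<close> need not be injective and the dependence of gradients is a relation between
  indices.\<close>

lemma span_image_finite_sum: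
  fixes l :: "'i \<Rightarrow> 'e::real_vector"
  assumes "finite K" "y \<in> span (l ` K)"
  obtains b where "y = (\<Sum>i\<in>K. b i *\<^sub>R l i)"
proof -
  have "y \<in> {y. \<exists>b. y = (\<Sum>i\<in>K. b i *\<^sub>R l i)}" (is "_ \<in> ?T")
    using assms(2)
  proof (rule subsetD[OF span_minimal, rotated 2])
    show "l ` K \<subseteq> ?T"
    proof clarify
      fix k assume "k \<in> K"
      then have "l k = (\<Sum>i\<in>K. (if i = k then 1 else 0) *\<^sub>R l i)"
        using assms(1) by (simp add: if_distrib[of "\<lambda>c. c *\<^sub>R _"] cong: if_cong)
      then show "\<exists>b. l k = (\<Sum>i\<in>K. b i *\<^sub>R l i)"
        by (intro exI[of _ "\<lambda>i. if i = k then 1 else 0"])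
    qed
    show "subspace ?T"
    proof (rule subspaceI)
      show "0 \<in> ?T" by (auto intro!: exI[of _ "\<lambda>_. 0"])
    next
      fix x y assume "x \<in> ?T" "y \<in> ?T"
      then obtain a b where "x = (\<Sum>i\<in>K. a i *\<^sub>R l i)" "y = (\<Sum>i\<in>K. b i *\<^sub>R l i)" by blast
      then have "x + y = (\<Sum>i\<in>K. (a i + b i) *\<^sub>R l i)"
        by (simp add: scaleR_add_left sum.distrib)
      then show "x + y \<in> ?T" by (intro CollectI exI[of _ "\<lambda>i. a i + b i"])
    next
      fix c x assume "x \<in> ?T"
      then obtain a where "x = (\<Sum>i\<in>K. a i *\<^sub>R l i)" by blast
      then have "c *\<^sub>R x = (\<Sum>i\<in>K. (c * a i) *\<^sub>R l i)"
        by (simp add: scaleR_sum_right)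
      then show "c *\<^sub>R x \<in> ?T" by (intro CollectI exI[of _ "\<lambda>i. c * a i"])
    qed
  qed
  then show ?thesis using that by blast
qed

lemma convex_hull_image_finite_sum:
  fixes q :: "'i \<Rightarrow> 'e::real_vector"
  assumes "finite J" "y \<in> convex hull (q ` J)"
  obtains d where "\<And>j. j \<in> J \<Longrightarrow> d j \<ge> 0" "sum d J = 1" "y = (\<Sum>j\<in>J. d j *\<^sub>R q j)"
proof -
  have "y \<in> {y. \<exists>d. (\<forall>j\<in>J. d j \<ge> 0) \<and> sum d J = 1 \<and> y = (\<Sum>j\<in>J. d j *\<^sub>R q j)}" (is "_ \<in> ?T")
    using assms(2)
  proof (rule subsetD[OF hull_minimal, rotated 2])
    show "q ` J \<subseteq> ?T"
    proof clarify
      fix k assume k: "k \<in> J"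
      let ?d = "\<lambda>i. if i = k then 1 else (0::real)"
      have "q k = (\<Sum>i\<in>J. ?d i *\<^sub>R q i)"
        using assms(1) k by (simp add: if_distrib[of "\<lambda>c. c *\<^sub>R _"] cong: if_cong)
      moreover have "sum ?d J = 1" using assms(1) k by simp
      ultimately show "\<exists>d. (\<forall>j\<in>J. d j \<ge> 0) \<and> sum d J = 1 \<and> q k = (\<Sum>j\<in>J. d j *\<^sub>R q j)"
        by (intro exI[of _ ?d]) auto
    qed
    show "convex ?T"
      unfolding convex_def
    proof (intro ballI allI impI)
      fix x y and u v :: real
      assume x: "x \<in> ?T" and y: "y \<in> ?T" and uv: "0 \<le> u" "0 \<le> v" "u + v = 1"
      obtain a where a: "\<forall>j\<in>J. a j \<ge> 0" "sum a J = 1" "x = (\<Sum>j\<in>J. a j *\<^sub>R q j)" using x by blast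
      obtain b where b: "\<forall>j\<in>J. b j \<ge> 0" "sum b J = 1" "y = (\<Sum>j\<in>J. b j *\<^sub>R q j)" using y by blast
      have "u *\<^sub>R x + v *\<^sub>R y = (\<Sum>j\<in>J. (u * a j + v * b j) *\<^sub>R q j)"
        by (simp add: a b scaleR_sum_right scaleR_add_left sum.distrib)
      moreover have "(\<Sum>j\<in>J. u * a j + v * b j) = 1"
        using a b uv by (simp add: sum.distrib flip: sum_distrib_left)
      ultimately show "u *\<^sub>R x + v *\<^sub>R y \<in> ?T"
        using a(1) b(1) uv by (intro CollectI exI[of _ "\<lambda>j. u * a j + v * b j"]) auto
    qed
  qed
  then show ?thesis using that by blast
qed

text \<open>A form of Stiemke's theorem: the indices that can occur in a non-negative linear dependence
  are separated from the others by a linear functional.\<close>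

lemma positive_dependence_dichotomy:
  fixes l :: "'i \<Rightarrow> 'e::euclidean_space"
  assumes fin: "finite I"
  obtains K c v where "K \<subseteq> I" "\<And>i. i \<in> K \<Longrightarrow> c i > (0::real)" "(\<Sum>i\<in>K. c i *\<^sub>R l i) = 0"
    "\<And>i. i \<in> K \<Longrightarrow> l i \<bullet> v = 0" "\<And>i. i \<in> I - K \<Longrightarrow> l i \<bullet> v > 0"
proof -
  define dep where "dep a \<longleftrightarrow> (\<forall>i\<in>I. a i \<ge> (0::real)) \<and> (\<Sum>i\<in>I. a i *\<^sub>R l i) = 0" for a
  define K where "K = {i \<in> I. \<exists>a. dep a \<and> a i > 0}"
  have KI: "K \<subseteq> I" by (auto simp: K_def)
  have finK: "finite K" using KI fin finite_subset by blast
  have "\<exists>a. \<forall>i\<in>K. dep (a i) \<and> a i i > 0"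
    by (rule bchoice) (auto simp: K_def)
  then obtain a where a: "\<And>i. i \<in> K \<Longrightarrow> dep (a i)" "\<And>i. i \<in> K \<Longrightarrow> a i i > 0" by blast
  \<comment> \<open>Summing one dependence for each index makes all coefficients on \<open>K\<close>
    positive at once.\<close>
  define c where "c j = (\<Sum>i\<in>K. a i j)" for j
  have cdep: "dep c"
    unfolding dep_def
  proof
    show "\<forall>j\<in>I. 0 \<le> c j" using a(1) by (auto simp: c_def dep_def intro!: sum_nonneg)
    have "(\<Sum>j\<in>I. c j *\<^sub>R l j) = (\<Sum>j\<in>I. \<Sum>i\<in>K. a i j *\<^sub>R l j)" by (simp add: c_def scaleR_sum_left)
    also have "\<dots> = (\<Sum>i\<in>K. \<Sum>j\<in>I. a i j *\<^sub>R l j)" by (rule sum.swap)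
    also have "\<dots> = 0" using a(1) by (simp add: dep_def)
    finally show "(\<Sum>j\<in>I. c j *\<^sub>R l j) = 0" .
  qed
  have cpos: "c i > 0" if "i \<in> K" for i
    unfolding c_def using that finK a KI by (intro sum_pos2[of _ i]) (auto simp: dep_def)
  have c0: "c i = 0" if "i \<in> I - K" for i
    using that cdep unfolding K_def dep_def by force
  have csum: "(\<Sum>i\<in>K. c i *\<^sub>R l i) = 0"
  proof -
    have "(\<Sum>i\<in>K. c i *\<^sub>R l i) = (\<Sum>i\<in>I. c i *\<^sub>R l i)"
      using fin KI c0 by (intro sum.mono_neutral_left) auto
    then show ?thesis using cdep by (simp add: dep_def)
  qed
  define W where "W = span (l ` K)"
  have sW: "subspace W" by (simp add: W_def)
  obtain P :: "'e \<Rightarrow> 'e" where P: "linear P" "\<And>x. P x \<in> W" "\<And>x y. y \<in> W \<Longrightarrow> (x - P x) \<bullet> y = 0"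
    using linear_projection_exists[OF sW] by metis
  \<comment> \<open>The functional sought has to vanish on \<open>W\<close>, so the remaining
    vectors are separated from \<open>0\<close> only after removal of their \<open>W\<close>
    components.\<close>
  define q where "q i = l i - P (l i)" for i
  define S where "S = convex hull (q ` (I - K))"
  have "0 \<notin> S"
  proof
    assume "0 \<in> S"
    then obtain d where d: "\<And>j. j \<in> I - K \<Longrightarrow> d j \<ge> 0" "sum d (I - K) = 1"
      "0 = (\<Sum>j\<in>I - K. d j *\<^sub>R q j)"
      unfolding S_def using convex_hull_image_finite_sum[of "I - K" 0 q] fin by (metis finite_Diff)
    have "(\<Sum>j\<in>I - K. d j *\<^sub>R l j) = (\<Sum>j\<in>I - K. d j *\<^sub>R P (l j))"
      using d(3) by (simp add: q_def scaleR_diff_right sum_subtractf)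
    also have "\<dots> \<in> W" using P(2) sW by (intro subspace_sum subspace_scale) auto
    finally obtain b where b: "(\<Sum>j\<in>I - K. d j *\<^sub>R l j) = (\<Sum>i\<in>K. b i *\<^sub>R l i)"
      unfolding W_def using span_image_finite_sum[OF finK] by metis
    \<comment> \<open>Adding a large multiple of the dependence on \<open>K\<close> makes all
      coefficients nonnegative; together with \<open>d\<close> this is a dependence that uses an
      index outside \<open>K\<close>, against the choice of \<open>K\<close>.\<close>
    obtain s :: real where s: "s \<ge> 0" "\<And>i. i \<in> K \<Longrightarrow> s * c i \<ge> b i"
    proof
      show "(\<Sum>i\<in>K. \<bar>b i\<bar> / c i) \<ge> 0" using cpos
        by (intro sum_nonneg divide_nonneg_nonneg) (auto intro: less_imp_le)
      fix i assume i: "i \<in> K"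
      have "b i \<le> \<bar>b i\<bar> / c i * c i" using cpos[OF i] by simp
      also have "\<dots> \<le> (\<Sum>i\<in>K. \<bar>b i\<bar> / c i) * c i"
        using cpos i finK by (intro mult_right_mono member_le_sum) (auto simp: less_imp_le)
      finally show "b i \<le> (\<Sum>i\<in>K. \<bar>b i\<bar> / c i) * c i" .
    qed
    define e where "e j = (if j \<in> K then s * c j - b j else d j)" for j
    have "(\<Sum>j\<in>I. e j *\<^sub>R l j) = (\<Sum>j\<in>I - K. e j *\<^sub>R l j) + (\<Sum>j\<in>K. e j *\<^sub>R l j)"
      using KI fin by (rule sum.subset_diff)
    also have "(\<Sum>j\<in>I - K. e j *\<^sub>R l j) = (\<Sum>j\<in>I - K. d j *\<^sub>R l j)"
      by (intro sum.cong) (auto simp: e_def)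
    also have "(\<Sum>j\<in>K. e j *\<^sub>R l j) = s *\<^sub>R (\<Sum>j\<in>K. c j *\<^sub>R l j) - (\<Sum>j\<in>K. b j *\<^sub>R l j)"
      by (simp add: e_def scaleR_sum_right sum_subtractf scaleR_diff_left)
    finally have "dep e" using s d(1) by (auto simp: dep_def csum b e_def)
    moreover obtain j where j: "j \<in> I - K" "d j > 0"
      using d(1,2) by (metis less_eq_real_def sum.neutral zero_neq_one)
    moreover have "e j > 0" using j by (simp add: e_def)
    ultimately have "j \<in> K" unfolding K_def by blast
    then show False using j by blast
  qed
  moreover have "convex S" "closed S"
    using fin by (simp_all add: S_def compact_imp_closed finite_imp_compact_convex_hull)
  ultimately obtain a b where ab: "b > 0" "\<And>x. x \<in> S \<Longrightarrow> a \<bullet> x > b"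
    using separating_hyperplane_closed_0 by metis
  \<comment> \<open>Removing the \<open>W\<close> component of \<open>a\<close> makes it vanish on
    \<open>W\<close> without changing its product with any \<open>q i\<close>.\<close>
  define v where "v = a - P a"
  have "l i \<bullet> v = 0" if "i \<in> K" for i
    using that P(3)[of "l i" a] by (simp add: v_def W_def inner_commute span_base)
  moreover have "l i \<bullet> v > 0" if "i \<in> I - K" for i
  proof -
    have "l i \<bullet> v = q i \<bullet> v" using P(3)[OF P(2), of a "l i"]
      by (simp add: q_def v_def inner_diff_left inner_diff_right inner_commute)
    also have "\<dots> = a \<bullet> q i" using P(3)[OF P(2), of "l i" a]
      by (simp add: q_def v_def inner_diff_left inner_diff_right inner_commute)
    also have "\<dots> > 0" using ab(1) ab(2)[of "q i"] that by (force simp: S_def intro: hull_inc)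
    finally show ?thesis .
  qed
  ultimately show ?thesis using that KI cpos csum by blast
qed

text \<open>The hypothesis says that \<open>0\<close> lies in the relative interior of the convex hull of the
  vectors \<open>l i\<close>.\<close>

lemma min_inner_decay:
  fixes l :: "'i \<Rightarrow> 'e::euclidean_space"
  assumes fin: "finite K" and "K \<noteq> {}" and c: "\<And>i. i \<in> K \<Longrightarrow> c i > (0::real)"
    and sum0: "(\<Sum>i\<in>K. c i *\<^sub>R l i) = 0"
  obtains b where "b > 0" "\<And>w. w \<in> span (l ` K) \<Longrightarrow> \<exists>i\<in>K. l i \<bullet> w \<le> - b * norm w"
proof -
  define S where "S = sphere 0 1 \<inter> span (l ` K)"
  have cS: "compact S" unfolding S_def by (intro compact_Int_closed) (auto intro: closed_span)
  \<comment> \<open>If all \<open>l i \<bullet> w\<close> are nonnegative, the positive weights of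
    the dependence force them to be zero; then \<open>w\<close> is orthogonal to the span that
    contains it.\<close>
  have neg: "\<exists>i\<in>K. l i \<bullet> w < 0" if "w \<in> S" for w
  proof (rule ccontr)
    assume "\<not> ?thesis"
    then have nn: "l i \<bullet> w \<ge> 0" if "i \<in> K" for i using that by force
    have "(\<Sum>i\<in>K. c i * (l i \<bullet> w)) = 0" using arg_cong[OF sum0, of "\<lambda>x. x \<bullet> w"]
      by (simp add: inner_sum_left)
    then have lz: "l i \<bullet> w = 0" if "i \<in> K" for i
      using fin c nn that by (subst (asm) sum_nonneg_eq_0_iff) (force intro: mult_nonneg_nonneg)+
    have "w \<in> span (l ` K)" using that by (simp add: S_def)
    then obtain d where d: "w = (\<Sum>i\<in>K. d i *\<^sub>R l i)"
      by (rule span_image_finite_sum[OF fin])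
    have "w \<bullet> w = (\<Sum>i\<in>K. d i *\<^sub>R l i) \<bullet> w" using d by simp
    also have "\<dots> = (\<Sum>i\<in>K. d i * (l i \<bullet> w))" by (simp add: inner_sum_left)
    also have "\<dots> = 0" using lz by simp
    finally have "w = 0" by simp
    then show False using that by (simp add: S_def)
  qed
  \<comment> \<open>By compactness the minimum of the \<open>l i \<bullet> w\<close> has a negative
    largest value on the unit sphere of the span, and \<open>b\<close> is its opposite. If the span
    is zero there is no unit vector and any rate works.\<close>
  have unif: "\<exists>b>0. \<forall>w\<in>S. \<exists>i\<in>K. l i \<bullet> w \<le> - b"
  proof (cases "S = {}")
    case True
    then show ?thesis by (auto intro: exI[of _ 1])
  next
    case False
    define m where "m w = Min ((\<lambda>i. l i \<bullet> w) ` K)" for w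
    have "continuous_on S m"
      unfolding m_def using fin \<open>K \<noteq> {}\<close>
    proof (induction rule: finite_ne_induct)
      case (singleton x)
      then show ?case by (simp add: continuous_intros)
    next
      case (insert x F)
      then show ?case by (simp add: continuous_on_min continuous_intros)
    qed
    then obtain w0 where w0: "w0 \<in> S" "\<And>w. w \<in> S \<Longrightarrow> m w \<le> m w0"
      using continuous_attains_sup[OF cS False] by blast
    have m: "\<exists>i\<in>K. l i \<bullet> w = m w" for w
    proof -
      have "m w \<in> (\<lambda>i. l i \<bullet> w) ` K"
        unfolding m_def using fin \<open>K \<noteq> {}\<close> by (intro Min_in) auto
      then obtain i where "m w = l i \<bullet> w" "i \<in> K" by (rule imageE)
      then show ?thesis by (intro bexI[of _ i]) simp_all
    qed
    have "m w0 < 0" using neg[OF w0(1)] fin by (auto simp: m_def intro: le_less_trans[OF Min_le])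
    moreover have "\<exists>i\<in>K. l i \<bullet> w \<le> - (- m w0)" if "w \<in> S" for w
      using m[of w] w0(2)[OF that] by force
    ultimately show ?thesis by (intro exI[of _ "- m w0"]) auto
  qed
  then obtain b where b: "b > 0" "\<And>w. w \<in> S \<Longrightarrow> \<exists>i\<in>K. l i \<bullet> w \<le> - b" by blast
  show ?thesis
  proof
    show "b > 0" by fact
    fix w assume w: "w \<in> span (l ` K)"
    show "\<exists>i\<in>K. l i \<bullet> w \<le> - b * norm w"
    proof (cases "w = 0")
      case True
      then show ?thesis using \<open>K \<noteq> {}\<close> by auto
    next
      case False
      then have "w /\<^sub>R norm w \<in> S" using w by (auto simp: S_def span_scale)
      then obtain i where "i \<in> K" "l i \<bullet> (w /\<^sub>R norm w) \<le> - b" using b(2) by blast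
      then show ?thesis using False by (intro bexI[of _ i]) (auto simp: field_simps)
    qed
  qed
qed

section \<open>Minima of finitely many strictly convex germs\<close>

text \<open>The minimum has no derivative, so the argument runs through a maximiser. Right after a
  time \<open>t < b\<close> the functions active at \<open>t\<close> have increased, and the others
  still exceed \<open>f (\<gamma> t)\<close> by continuity; hence no \<open>t < b\<close> maximises
  \<open>f\<close> along the curve. The maximum is attained at \<open>b\<close> and is strictly
  larger than the value at \<open>a\<close>.\<close>

lemma increase_along_curve:
  fixes h :: "'i \<Rightarrow> 'e::real_inner \<Rightarrow> real" and \<gamma> :: "real \<Rightarrow> 'e"
  assumes "a < b" and fin: "finite I"
    and cont: "continuous_on {a..b} \<gamma>"
    and vd: "\<And>t. a \<le> t \<Longrightarrow> t < b \<Longrightarrow> (\<gamma> has_vector_derivative V t) (at t)"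
    and hd: "\<And>i t. i \<in> I \<Longrightarrow> a \<le> t \<Longrightarrow> t \<le> b \<Longrightarrow> (h i has_derivative (\<lambda>v. G i (\<gamma> t) \<bullet> v)) (at (\<gamma> t))"
    and le: "\<And>i t. i \<in> I \<Longrightarrow> a \<le> t \<Longrightarrow> t \<le> b \<Longrightarrow> f (\<gamma> t) \<le> h i (\<gamma> t)"
    and att: "\<And>t. a \<le> t \<Longrightarrow> t \<le> b \<Longrightarrow> \<exists>i\<in>I. f (\<gamma> t) = h i (\<gamma> t)"
    and pos: "\<And>i t. i \<in> I \<Longrightarrow> a \<le> t \<Longrightarrow> t < b \<Longrightarrow> h i (\<gamma> t) = f (\<gamma> t) \<Longrightarrow> G i (\<gamma> t) \<bullet> V t > 0"
  shows "f (\<gamma> a) < f (\<gamma> b)"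
proof -
  have "I \<noteq> {}" using att[of a] \<open>a < b\<close> by auto
  have feq: "f (\<gamma> t) = Min ((\<lambda>i. h i (\<gamma> t)) ` I)" if "t \<in> {a..b}" for t
    using that le[of _ t] att[of t] fin by (intro Min_eqI[symmetric]) auto
  have conth: "continuous_on {a..b} (\<lambda>t. h i (\<gamma> t))" if "i \<in> I" for i
  proof -
    have "continuous_on (\<gamma> ` {a..b}) (h i)"
      by (intro continuous_at_imp_continuous_on ballI) (auto intro!: has_derivative_continuous[OF hd[OF that]])
    then show ?thesis using cont continuous_on_compose2 by blast
  qed
  have "continuous_on {a..b} (\<lambda>t. Min ((\<lambda>i. h i (\<gamma> t)) ` I))"
    using fin \<open>I \<noteq> {}\<close> conth
  proof (induction rule: finite_ne_induct)
    case (insert x F)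
    then show ?case by (simp add: continuous_on_min)
  qed simp
  then have "continuous_on {a..b} (\<lambda>t. f (\<gamma> t))" by (rule continuous_on_eq) (simp add: feq)
  then obtain m where m: "m \<in> {a..b}" "\<And>t. t \<in> {a..b} \<Longrightarrow> f (\<gamma> t) \<le> f (\<gamma> m)"
    using continuous_attains_sup[of "{a..b}" "\<lambda>t. f (\<gamma> t)"] \<open>a < b\<close> by auto
  have inc: "\<exists>s\<in>{a..b}. f (\<gamma> s) > f (\<gamma> t)" if t: "a \<le> t" "t < b" for t
  proof -
    have "\<forall>\<^sub>F s in at_right t. h i (\<gamma> s) > f (\<gamma> t)" if i: "i \<in> I" for i
    proof (cases "h i (\<gamma> t) = f (\<gamma> t)")
      case True
      have "((\<lambda>s. h i (\<gamma> s)) has_derivative (\<lambda>s. G i (\<gamma> t) \<bullet> (s *\<^sub>R V t))) (at t)"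
        using has_derivative_compose[OF vd[OF t, unfolded has_vector_derivative_def] hd[OF i, of t]] t by simp
      then have "((\<lambda>s. h i (\<gamma> s)) has_real_derivative (G i (\<gamma> t) \<bullet> V t)) (at t)"
        by (simp add: has_field_derivative_def mult_commute_abs)
      from has_real_derivative_pos_inc_right[OF this pos[OF i t True]]
      obtain d where d: "d > 0" "\<And>k. 0 < k \<Longrightarrow> k < d \<Longrightarrow> h i (\<gamma> t) < h i (\<gamma> (t + k))" by auto
      have "h i (\<gamma> s) > h i (\<gamma> t)" if "t < s" "s < t + d" for s
        using d(2)[of "s - t"] that by simp
      then show ?thesis unfolding eventually_at_right_field True[symmetric] using d(1)
        by (intro exI[of _ "t + d"]) auto
    next
      case False
      then have "f (\<gamma> t) < h i (\<gamma> t)" using le[OF i, of t] t by simp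
      moreover have "isCont (\<lambda>s. h i (\<gamma> s)) t"
        using vd[OF t] has_vector_derivative_continuous hd[OF i, of t] t has_derivative_continuous
        by (intro isCont_o2[of t \<gamma> "h i"]) auto
      ultimately show ?thesis
        by (metis continuous_within eventually_at_split order_tendstoD(1))
    qed
    then have "\<forall>\<^sub>F s in at_right t. \<forall>i\<in>I. h i (\<gamma> s) > f (\<gamma> t)"
      using fin by (intro eventually_ball_finite) auto
    moreover have "\<forall>\<^sub>F s in at_right t. s < b" using t by (simp add: eventually_at_right_field) blast
    moreover have "\<forall>\<^sub>F s in at_right t. s > t" by (simp add: eventually_at_right_less)
    ultimately have "\<forall>\<^sub>F s in at_right t. (\<forall>i\<in>I. h i (\<gamma> s) > f (\<gamma> t)) \<and> s < b \<and> s > t"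
      by eventually_elim auto
    then obtain s where "\<forall>i\<in>I. h i (\<gamma> s) > f (\<gamma> t)" "s < b" "s > t"
      using eventually_happens[of _ "at_right t"] by auto
    then show ?thesis using att[of s] t by (intro bexI[of _ s]) auto
  qed
  have "m = b"
    using inc[of m] m by force
  obtain s where "s \<in> {a..b}" "f (\<gamma> s) > f (\<gamma> a)" using inc[of a] \<open>a < b\<close> by auto
  then show ?thesis using m(2)[of s] \<open>m = b\<close> by simp
qed

text \<open>\<open>G i\<close> is the gradient of \<open>h i\<close> and \<open>Q i\<close> the
  derivative of that gradient at \<open>0\<close>. All estimates are expansions at \<open>0\<close>,
  so second derivatives enter at this point only. The \<open>h i\<close> share the value
  \<open>0\<close> there: functions inactive at the point have already been dropped.\<close>

locale convex_min_germ =
  fixes I :: "'i set" and h :: "'i \<Rightarrow> 'e::euclidean_space \<Rightarrow> real" and G Q :: "'i \<Rightarrow> 'e \<Rightarrow> 'e"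
    and f :: "'e \<Rightarrow> real" and R :: real
  assumes fin: "finite I" and R: "R > 0"
    and h_deriv: "i \<in> I \<Longrightarrow> norm x < R \<Longrightarrow> (h i has_derivative (\<lambda>v. G i x \<bullet> v)) (at x)"
    and G_deriv: "i \<in> I \<Longrightarrow> (G i has_derivative Q i) (at 0)"
    and Q_pos: "i \<in> I \<Longrightarrow> v \<noteq> 0 \<Longrightarrow> Q i v \<bullet> v > 0"
    and h_zero: "i \<in> I \<Longrightarrow> h i 0 = 0"
    and f_le: "i \<in> I \<Longrightarrow> norm x < R \<Longrightarrow> f x \<le> h i x"
    and f_attained: "norm x < R \<Longrightarrow> \<exists>i\<in>I. f x = h i x"
begin

lemma I_nonempty: "I \<noteq> {}"
  using f_attained[of 0] R by auto

lemma f_zero: "f 0 = 0"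
  using f_attained[of 0] R h_zero by auto

lemma Q_linear: "i \<in> I \<Longrightarrow> linear (Q i)"
  using G_deriv has_derivative_linear by blast

lemma f_continuous: "continuous_on (ball 0 R) f"
proof -
  have "continuous_on (ball 0 R) (h i)" if "i \<in> I" for i
    by (intro continuous_at_imp_continuous_on ballI) (auto intro!: has_derivative_continuous[OF h_deriv[OF that]])
  then have "continuous_on (ball 0 R) (\<lambda>x. Min ((\<lambda>i. h i x) ` I))"
    using fin I_nonempty
  proof (induction rule: finite_ne_induct[OF fin I_nonempty])
    case (2 x F)
    then show ?case by (simp add: continuous_on_min)
  qed simp
  moreover have "Min ((\<lambda>i. h i x) ` I) = f x" if "x \<in> ball 0 R" for x
    using that f_le[of _ x] f_attained[of x] fin by (intro Min_eqI) auto
  ultimately show ?thesis by (rule continuous_on_eq)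
qed

lemma Q_bound:
  obtains \<kappa> where "\<kappa> > 0" "\<And>i x. i \<in> I \<Longrightarrow> norm (Q i x) \<le> \<kappa> * norm x"
proof -
  have "\<exists>k>0. \<forall>x. norm (Q i x) \<le> k * norm x" if "i \<in> I" for i
    using linear_bounded_pos[OF Q_linear[OF that]] by (metis)
  then obtain k where k: "\<And>i. i \<in> I \<Longrightarrow> k i > 0" "\<And>i x. i \<in> I \<Longrightarrow> norm (Q i x) \<le> k i * norm x" by metis
  show ?thesis
  proof (rule that[of "\<Sum>i\<in>I. k i"])
    show "0 < sum k I" using fin I_nonempty k(1) by (intro sum_pos) auto
    fix i x assume i: "i \<in> I"
    have "norm (Q i x) \<le> k i * norm x" using i k(2) by blast
    also have "\<dots> \<le> sum k I * norm x"
      using i fin k(1) by (intro mult_right_mono member_le_sum) (auto simp: less_imp_le)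
    finally show "norm (Q i x) \<le> sum k I * norm x" .
  qed
qed

lemma Q_coercive:
  obtains \<mu> where "\<mu> > 0" "\<And>i x. i \<in> I \<Longrightarrow> Q i x \<bullet> x \<ge> \<mu> * (norm x)\<^sup>2"
proof -
  have "\<exists>m>0. \<forall>x. Q i x \<bullet> x \<ge> m * (norm x)\<^sup>2" if i: "i \<in> I" for i
  proof -
    have "continuous_on (sphere 0 1) (\<lambda>x. Q i x \<bullet> x)"
      using linear_continuous_on[OF Q_linear[OF i, unfolded linear_conv_bounded_linear]]
      by (intro continuous_intros)
    moreover have "sphere 0 (1::real) \<noteq> ({} :: 'e set)" by simp
    ultimately have "\<exists>s\<in>sphere 0 1. \<forall>x\<in>sphere 0 1. Q i s \<bullet> s \<le> Q i x \<bullet> x"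
      by (intro continuous_attains_inf compact_sphere)
    then obtain s where s: "s \<in> sphere 0 1" "\<And>x. x \<in> sphere 0 1 \<Longrightarrow> Q i s \<bullet> s \<le> Q i x \<bullet> x"
      by blast
    have "Q i s \<bullet> s * (norm x)\<^sup>2 \<le> Q i x \<bullet> x" for x
    proof (cases "x = 0")
      case False
      have "Q i x \<bullet> x = (norm x)\<^sup>2 * (Q i (x /\<^sub>R norm x) \<bullet> (x /\<^sub>R norm x))"
        using False by (simp add: linear_scale[OF Q_linear[OF i]] power2_eq_square field_simps)
      then show ?thesis using s(2)[of "x /\<^sub>R norm x"] False by (simp add: mult.commute mult_left_mono)
    qed (simp add: linear_0[OF Q_linear[OF i]])
    moreover have "Q i s \<bullet> s > 0" using s(1) by (intro Q_pos[OF i]) auto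
    ultimately show ?thesis by blast
  qed
  then obtain m where m: "\<And>i. i \<in> I \<Longrightarrow> m i > 0" "\<And>i x. i \<in> I \<Longrightarrow> Q i x \<bullet> x \<ge> m i * (norm x)\<^sup>2" by metis
  show ?thesis
  proof (rule that[of "Min (m ` I)"])
    show "0 < Min (m ` I)" using fin I_nonempty m(1) by simp
    fix i and x :: 'e assume i: "i \<in> I"
    have "Min (m ` I) * (norm x)\<^sup>2 \<le> m i * (norm x)\<^sup>2"
      using i fin by (intro mult_right_mono) auto
    then show "Min (m ` I) * (norm x)\<^sup>2 \<le> Q i x \<bullet> x" using m(2)[OF i, of x] by simp
  qed
qed

lemma gradient_expansion:
  assumes "\<theta> > 0"
  shows "\<forall>\<^sub>F x in nhds 0. \<forall>i\<in>I. norm (G i x - G i 0 - Q i x) \<le> \<theta> * norm x"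
proof (intro eventually_ball_finite fin ballI)
  fix i assume "i \<in> I"
  from G_deriv[OF this, unfolded has_derivative_at_alt] assms
  obtain d where "d > 0" "\<And>y. norm y < d \<Longrightarrow> norm (G i y - G i 0 - Q i y) \<le> \<theta> * norm y" by force
  then show "\<forall>\<^sub>F x in nhds 0. norm (G i x - G i 0 - Q i x) \<le> \<theta> * norm x"
    by (auto simp: eventually_nhds_metric dist_norm)
qed

text \<open>Since \<open>G i\<close> is differentiable at \<open>0\<close> only, the quadratic error
  of \<open>h i\<close> is obtained from the linear growth of \<open>G i x - G i 0\<close> by the
  mean value inequality on the ball of radius \<open>norm x\<close>.\<close>

lemma first_order_expansion:
  obtains C where "C > 0"
    "\<forall>\<^sub>F x in nhds 0. \<forall>i\<in>I. \<bar>h i x - G i 0 \<bullet> x\<bar> \<le> C * (norm x)\<^sup>2 \<and> norm (G i x - G i 0) \<le> C * norm x"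
proof -
  obtain \<kappa> where \<kappa>: "\<kappa> > 0" "\<And>i x. i \<in> I \<Longrightarrow> norm (Q i x) \<le> \<kappa> * norm x" using Q_bound by metis
  define C where "C = \<kappa> + 1"
  obtain d where d: "d > 0" "\<And>x i. norm x < d \<Longrightarrow> i \<in> I \<Longrightarrow> norm (G i x - G i 0 - Q i x) \<le> norm x"
    using gradient_expansion[of 1] by (auto simp: eventually_nhds_metric dist_norm)
  have Gb: "norm (G i x - G i 0) \<le> C * norm x" if "norm x < d" "i \<in> I" for x i
    using d(2)[OF that] \<kappa>(2)[OF that(2), of x] norm_triangle_sub[of "G i x - G i 0" "Q i x"]
    by (simp add: C_def algebra_simps)
  have hb: "\<bar>h i x - G i 0 \<bullet> x\<bar> \<le> C * (norm x)\<^sup>2" if x: "norm x < min d R" and i: "i \<in> I" for x i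
  proof -
    have "norm ((h i x - G i 0 \<bullet> x) - (h i 0 - G i 0 \<bullet> 0)) \<le> (C * norm x) * norm (x - 0)"
    proof (rule differentiable_bound)
      fix y :: 'e assume y: "y \<in> cball 0 (norm x)"
      show "((\<lambda>x. h i x - G i 0 \<bullet> x) has_derivative (\<lambda>v. (G i y - G i 0) \<bullet> v)) (at y within cball 0 (norm x))"
        using x y by (auto intro!: derivative_eq_intros has_derivative_at_withinI[OF h_deriv[OF i]] simp: inner_diff_left)
      have "norm (G i y - G i 0) \<le> C * norm x"
        using Gb[of y i] x y i \<kappa>(1) by (force simp: C_def intro: order_trans mult_left_mono)
      then have "norm ((G i y - G i 0) \<bullet> v) \<le> C * norm x * norm v" for v
        using Cauchy_Schwarz_ineq2[of "G i y - G i 0" v]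
          mult_right_mono[of "norm (G i y - G i 0)" "C * norm x" "norm v"] by simp
      then show "onorm (\<lambda>v. (G i y - G i 0) \<bullet> v) \<le> C * norm x" by (rule onorm_le)
    qed auto
    then show ?thesis using h_zero[OF i] by (simp add: power2_eq_square)
  qed
  show ?thesis
  proof (rule that)
    show "C > 0" using \<kappa> by (simp add: C_def)
    show "\<forall>\<^sub>F x in nhds 0. \<forall>i\<in>I. \<bar>h i x - G i 0 \<bullet> x\<bar> \<le> C * (norm x)\<^sup>2 \<and> norm (G i x - G i 0) \<le> C * norm x"
      unfolding eventually_nhds_metric dist_norm using hb Gb d(1) R
      by (intro exI[of _ "min d R"]) auto
  qed
qed

lemma increase_along_curve_germ:
  assumes "a < b" "\<And>t. a \<le> t \<Longrightarrow> t \<le> b \<Longrightarrow> norm (\<gamma> t) < R"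
    and vd: "\<And>t. (\<gamma> has_vector_derivative V t) (at t)"
    and pos: "\<And>i t. i \<in> I \<Longrightarrow> a \<le> t \<Longrightarrow> t < b \<Longrightarrow> h i (\<gamma> t) = f (\<gamma> t) \<Longrightarrow> G i (\<gamma> t) \<bullet> V t > 0"
  shows "f (\<gamma> a) < f (\<gamma> b)"
proof (rule increase_along_curve[where V = V and h = h and G = G, OF \<open>a < b\<close> fin])
  show "continuous_on {a..b} \<gamma>"
    using vd has_vector_derivative_continuous by (blast intro: continuous_at_imp_continuous_on)
  fix t assume t: "a \<le> t" "t \<le> b"
  note R = assms(2)[OF t]
  show "\<exists>i\<in>I. f (\<gamma> t) = h i (\<gamma> t)" using R by (rule f_attained)
  fix i assume i: "i \<in> I"
  show "(h i has_derivative (\<lambda>v. G i (\<gamma> t) \<bullet> v)) (at (\<gamma> t))" "f (\<gamma> t) \<le> h i (\<gamma> t)"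
    using i R by (rule h_deriv f_le)+
next
  fix i t assume "i \<in> I" "a \<le> t" "t < b" "h i (\<gamma> t) = f (\<gamma> t)"
  then show "0 < G i (\<gamma> t) \<bullet> V t" by (rule pos)
qed (rule vd)

text \<open>The vector \<open>x - P x + e - \<delta> *\<^sub>R P x\<close> points into the superlevel sets of \<open>h i\<close>: along \<open>P x\<close>
  the first-order terms win since an active \<open>h i\<close> satisfies \<open>G i 0 \<bullet> P x \<le> - b * norm (P x) + O((norm x)\<^sup>2)\<close>,
  along \<open>x - P x\<close> the second-order terms do, by convexity.\<close>

lemma active_gradient_positive:
  assumes K: "K \<subseteq> I" and P: "\<And>x. (norm x)\<^sup>2 = (norm (x - P x))\<^sup>2 + (norm (P x))\<^sup>2"
    and orth: "\<And>i x. i \<in> K \<Longrightarrow> G i 0 \<bullet> (x - P x) = 0"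
    and b: "b > 0" and decay: "\<And>x. K \<noteq> {} \<Longrightarrow> \<exists>i\<in>K. G i 0 \<bullet> P x \<le> - b * norm (P x)"
  obtains \<epsilon> \<delta>0 where "\<epsilon> > 0" "\<delta>0 > 0" "\<delta>0 \<le> 1"
    "\<And>B \<delta>. B \<ge> 0 \<Longrightarrow> 0 < \<delta> \<Longrightarrow> \<delta> \<le> \<delta>0 \<Longrightarrow>
       \<forall>\<^sub>F x in nhds 0. \<forall>i\<in>K. x \<noteq> 0 \<longrightarrow> h i x = f x \<longrightarrow>
         (\<forall>e. norm e \<le> \<epsilon> * norm (x - P x) + B * norm (P x) \<longrightarrow> G i 0 \<bullet> e = 0 \<longrightarrow>
           G i x \<bullet> (x - P x + e - \<delta> *\<^sub>R P x) > 0)"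
proof -
  obtain \<kappa> where \<kappa>: "\<kappa> > 0" "\<And>i x. i \<in> I \<Longrightarrow> norm (Q i x) \<le> \<kappa> * norm x" using Q_bound by metis
  obtain \<mu> where \<mu>: "\<mu> > 0" "\<And>i x. i \<in> I \<Longrightarrow> Q i x \<bullet> x \<ge> \<mu> * (norm x)\<^sup>2" using Q_coercive by metis
  obtain C where C: "C > 0"
    "\<forall>\<^sub>F x in nhds 0. \<forall>i\<in>I. \<bar>h i x - G i 0 \<bullet> x\<bar> \<le> C * (norm x)\<^sup>2 \<and> norm (G i x - G i 0) \<le> C * norm x"
    using first_order_expansion by blast
  \<comment> \<open>\<open>\<mu>\<close> is the convexity available. The choice of
    \<open>\<epsilon>\<close> lets the perturbation \<open>e\<close> consume a quarter of it, and
    the choice of \<open>\<delta>0\<close> does the same for the error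
    \<open>2 * \<delta> * C\<close> that comes from comparing active functions.\<close>
  define \<epsilon> where "\<epsilon> = \<mu> / (4 * \<kappa>)"
  define \<delta>0 where "\<delta>0 = min 1 (\<mu> / (8 * C))"
  have \<epsilon>: "\<epsilon> > 0" "\<kappa> * \<epsilon> = \<mu> / 4" using \<kappa> \<mu> by (simp_all add: \<epsilon>_def)
  have \<delta>0: "\<delta>0 > 0" "\<delta>0 \<le> 1" "2 * \<delta>0 * C \<le> \<mu> / 4" using C(1) \<mu> by (simp_all add: \<delta>0_def min_def field_simps)
  have main: "\<forall>\<^sub>F x in nhds 0. \<forall>i\<in>K. x \<noteq> 0 \<longrightarrow> h i x = f x \<longrightarrow>
         (\<forall>e. norm e \<le> \<epsilon> * norm (x - P x) + B * norm (P x) \<longrightarrow> G i 0 \<bullet> e = 0 \<longrightarrow>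
           G i x \<bullet> (x - P x + e - \<delta> *\<^sub>R P x) > 0)" if B: "B \<ge> 0" and \<delta>: "0 < \<delta>" "\<delta> \<le> \<delta>0" for B \<delta>
  proof -
    \<comment> \<open>\<open>M\<close> bounds the vector in terms of \<open>norm x\<close>.
      \<open>N\<close> collects the coefficients of all mixed terms, which carry a factor
      \<open>norm (P x)\<close> and are beaten by the linear decay
      \<open>\<delta> * b * norm (P x)\<close> near \<open>0\<close>.\<close>
    define M where "M = 2 + \<epsilon> + B"
    define N where "N = \<kappa> * (1 + B + M)"
    have M: "M > 0" and N: "N > 0" using \<epsilon>(1) B \<kappa>(1) by (simp_all add: M_def N_def add_pos_nonneg)
    have "\<forall>\<^sub>F x in nhds 0. \<forall>i\<in>I. norm (G i x - G i 0 - Q i x) \<le> \<mu> / (8 * M) * norm x"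
      using \<mu>(1) M by (intro gradient_expansion) simp
    moreover have "\<forall>\<^sub>F x::'e in nhds 0. norm x < R \<and> (N + \<mu>) * norm x < \<delta> * b"
      unfolding eventually_nhds_metric dist_norm using R \<delta> b N \<mu>(1)
      by (intro exI[of _ "min R (\<delta> * b / (N + \<mu>))"]) (auto simp: field_simps)
    ultimately show ?thesis using C(2)
    proof eventually_elim
      case (elim x)
      show ?case
      proof (intro ballI impI allI)
        fix i e assume i: "i \<in> K" and "x \<noteq> 0" and act: "h i x = f x"
          and e: "norm e \<le> \<epsilon> * norm (x - P x) + B * norm (P x)" and l_e: "G i 0 \<bullet> e = 0"
        have iI: "i \<in> I" using i K by auto
        define n u w U V where "n = norm x" and "u = norm (x - P x)" and "w = norm (P x)"
          and "U = x - P x" and "V = x - P x + e - \<delta> *\<^sub>R P x"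
        have nn: "n\<^sup>2 = u\<^sup>2 + w\<^sup>2" "u \<ge> 0" "w \<ge> 0" "n \<ge> 0" using P[of x] by (simp_all add: n_def u_def w_def)
        have un: "u \<le> n" "w \<le> n" using nn by (auto intro: power2_le_imp_le)
        have xn: "n < R" "(N + \<mu>) * n < \<delta> * b" using elim by (simp_all add: n_def)
        obtain k where k: "k \<in> K" "G k 0 \<bullet> P x \<le> - b * w" using decay[of x] i by (auto simp: w_def)
        have lP: "G j 0 \<bullet> x = G j 0 \<bullet> P x" if "j \<in> K" for j using orth[OF that, of x] by (simp add: inner_diff_right)
        \<comment> \<open>Activity of \<open>h i\<close> transfers the decay from \<open>k\<close>
          to \<open>i\<close>: \<open>h i x\<close> is at most \<open>h k x\<close>, so the linear
          part of \<open>h i\<close> inherits the bound up to two quadratic errors.\<close>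
        have "f x \<le> h k x" using k K elim by (intro f_le) auto
        moreover have "h k x \<le> G k 0 \<bullet> x + C * n\<^sup>2" "G i 0 \<bullet> x \<le> h i x + C * n\<^sup>2"
          using elim(3) k(1) K iI by (force simp: n_def abs_le_iff)+
        ultimately have lw: "G i 0 \<bullet> P x \<le> - b * w + 2 * C * n\<^sup>2" using act k lP[OF k(1)] lP[OF i] by linarith
        have l1: "G i 0 \<bullet> V = - \<delta> * (G i 0 \<bullet> P x)"
          using orth[OF i] l_e by (simp add: V_def inner_add_right inner_diff_right)
        have T1: "G i 0 \<bullet> V \<ge> \<delta> * b * w - \<mu> / 4 * n\<^sup>2"
        proof -
          have "2 * \<delta> * C \<le> 2 * \<delta>0 * C" using \<delta> C(1) by simp
          then have "2 * \<delta> * C * n\<^sup>2 \<le> \<mu> / 4 * n\<^sup>2" using \<delta>0(3) by (intro mult_right_mono) auto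
          moreover have "\<delta> * (G i 0 \<bullet> P x) \<le> \<delta> * (- b * w + 2 * C * n\<^sup>2)" using lw \<delta> by (intro mult_left_mono) auto
          ultimately show ?thesis unfolding l1 by (simp add: algebra_simps)
        qed
        have Vn: "norm V \<le> M * n"
        proof -
          have "norm V \<le> u + norm e + norm (\<delta> *\<^sub>R P x)"
            using norm_triangle_ineq4[of "x - P x + e" "\<delta> *\<^sub>R P x"] norm_triangle_ineq[of "x - P x" e]
            unfolding V_def u_def by linarith
          also have "norm (\<delta> *\<^sub>R P x) \<le> n"
          proof -
            have "\<delta> * w \<le> 1 * n" using \<delta> \<delta>0 un nn by (intro mult_mono) auto
            then show ?thesis using \<delta> by (simp add: w_def)
          qed
          also have "norm e \<le> \<epsilon> * n + B * n"
          proof -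
            have "\<epsilon> * u + B * w \<le> \<epsilon> * n + B * n" using un \<epsilon>(1) B by (intro add_mono mult_left_mono) auto
            then show ?thesis using e by (simp add: u_def w_def)
          qed
          finally show ?thesis using un by (simp add: M_def algebra_simps)
        qed
        have T3: "(G i x - G i 0 - Q i x) \<bullet> V \<ge> - (\<mu> / 8 * n\<^sup>2)"
        proof -
          have "\<bar>(G i x - G i 0 - Q i x) \<bullet> V\<bar> \<le> norm (G i x - G i 0 - Q i x) * norm V" by (rule Cauchy_Schwarz_ineq2)
          also have "\<dots> \<le> (\<mu> / (8 * M) * n) * (M * n)"
            using elim(1) iI Vn \<mu>(1) M nn(4) by (intro mult_mono) (auto simp: n_def)
          also have "\<dots> = \<mu> / 8 * n\<^sup>2" using M by (simp add: power2_eq_square)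
          finally show ?thesis by linarith
        qed
        have bil: "\<bar>Q i y \<bullet> z\<bar> \<le> \<kappa> * norm y * norm z" for y z
          using Cauchy_Schwarz_ineq2[of "Q i y" z] mult_right_mono[OF \<kappa>(2)[OF iI, of y], of "norm z"] by simp
        have T2: "Q i x \<bullet> V \<ge> \<mu> * u\<^sup>2 - \<mu> / 4 * u\<^sup>2 - N * n * w"
        proof -
          have "x = U + P x" by (simp add: U_def)
          then have "Q i x = Q i U + Q i (P x)" by (metis linear_add[OF Q_linear[OF iI]])
          then have eq: "Q i x \<bullet> V = Q i U \<bullet> U + Q i U \<bullet> e - \<delta> * (Q i U \<bullet> P x) + Q i (P x) \<bullet> V"
            by (simp add: V_def U_def inner_add_left inner_add_right inner_diff_right distrib_left)
          have "Q i U \<bullet> U \<ge> \<mu> * u\<^sup>2" using \<mu>(2)[OF iI, of U] by (simp add: u_def U_def)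
          moreover have "\<bar>Q i U \<bullet> e\<bar> \<le> \<mu> / 4 * u\<^sup>2 + \<kappa> * B * n * w"
          proof -
            have "\<bar>Q i U \<bullet> e\<bar> \<le> \<kappa> * u * norm e" using bil[of U e] by (simp add: u_def U_def)
            also have "\<dots> \<le> \<kappa> * u * (\<epsilon> * u + B * w)"
              using e \<kappa>(1) nn by (intro mult_left_mono) (auto simp: u_def w_def)
            also have "\<dots> = (\<kappa> * \<epsilon>) * u\<^sup>2 + \<kappa> * B * (u * w)" by (simp add: algebra_simps power2_eq_square)
            also have "\<dots> \<le> (\<kappa> * \<epsilon>) * u\<^sup>2 + \<kappa> * B * (n * w)"
              using \<kappa>(1) B un nn by (intro add_left_mono mult_left_mono mult_right_mono) auto
            finally show ?thesis by (simp add: \<epsilon>(2) mult.assoc)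
          qed
          moreover have "\<delta> * (Q i U \<bullet> P x) \<le> \<kappa> * n * w"
          proof -
            have "\<bar>\<delta>\<bar> * \<bar>Q i U \<bullet> P x\<bar> \<le> 1 * (\<kappa> * u * w)"
              using bil[of U "P x"] \<delta> \<delta>0 by (intro mult_mono) (auto simp: u_def U_def w_def)
            then have "\<delta> * (Q i U \<bullet> P x) \<le> \<kappa> * u * w" by (simp flip: abs_mult)
            also have "\<dots> \<le> \<kappa> * n * w" using \<kappa>(1) un nn by (auto intro: mult_mono)
            finally show ?thesis .
          qed
          moreover have "\<bar>Q i (P x) \<bullet> V\<bar> \<le> \<kappa> * M * n * w"
          proof -
            have "\<bar>Q i (P x) \<bullet> V\<bar> \<le> \<kappa> * w * norm V" using bil[of "P x" V] by (simp add: w_def)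
            also have "\<dots> \<le> \<kappa> * w * (M * n)" using Vn \<kappa>(1) nn by (intro mult_left_mono) auto
            finally show ?thesis by (simp add: algebra_simps)
          qed
          moreover have "N * n * w = \<kappa> * n * w + \<kappa> * B * n * w + \<kappa> * M * n * w" by (simp add: N_def algebra_simps)
          ultimately show ?thesis unfolding eq by linarith
        qed
        have "G i x \<bullet> V = G i 0 \<bullet> V + Q i x \<bullet> V + (G i x - G i 0 - Q i x) \<bullet> V"
          by (simp add: inner_add_left inner_diff_left)
        then have tot: "G i x \<bullet> V \<ge> \<delta> * b * w - \<mu> / 4 * n\<^sup>2 + (\<mu> * u\<^sup>2 - \<mu> / 4 * u\<^sup>2 - N * n * w) - \<mu> / 8 * n\<^sup>2"
          using T1 T2 T3 by linarith
        \<comment> \<open>Splitting \<open>n\<^sup>2\<close> into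
          \<open>u\<^sup>2 + w\<^sup>2\<close> leaves \<open>1 - 1/4 - 1/4 - 1/8 = 3/8\<close> of
          the convexity for \<open>u\<close>; the quadratic loss in \<open>w\<close> is put together
          with the linear gain in \<open>w\<close>.\<close>
        have eq2: "\<delta> * b * w - \<mu> / 4 * n\<^sup>2 + (\<mu> * u\<^sup>2 - \<mu> / 4 * u\<^sup>2 - N * n * w) - \<mu> / 8 * n\<^sup>2
          = 3 / 8 * \<mu> * u\<^sup>2 + w * (\<delta> * b - N * n - 3 / 8 * \<mu> * w)"
          unfolding nn(1) by (simp add: field_simps power2_eq_square)
        have "3 / 8 * \<mu> * w \<le> \<mu> * n" using un nn \<mu>(1) by (intro mult_mono) auto
        then have pos: "\<delta> * b - N * n - 3 / 8 * \<mu> * w > 0" using xn(2) by (simp add: algebra_simps)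
        have "u \<noteq> 0 \<or> w \<noteq> 0" using nn(1) \<open>x \<noteq> 0\<close> by (auto simp: n_def)
        then have "3 / 8 * \<mu> * u\<^sup>2 + w * (\<delta> * b - N * n - 3 / 8 * \<mu> * w) > 0"
        proof
          assume "u \<noteq> 0"
          then show ?thesis using \<mu>(1) pos nn by (intro add_pos_nonneg) auto
        next
          assume "w \<noteq> 0"
          then show ?thesis using \<mu>(1) pos nn by (intro add_nonneg_pos) auto
        qed
        then show "G i x \<bullet> (x - P x + e - \<delta> *\<^sub>R P x) > 0" using tot eq2 unfolding V_def by linarith
      qed
    qed
  qed
  show ?thesis using that \<epsilon>(1) \<delta>0(1,2) main by blast
qed

end

section \<open>The critical case\<close>

text \<open>\<open>sgn\<close> jumps at \<open>0\<close> but has norm at most one, so an amplitude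
  that vanishes together with \<open>u\<close> restores continuity.\<close>

lemma continuous_on_scaleR_sgn:
  fixes u :: "'a::topological_space \<Rightarrow> 'b::real_normed_vector"
  assumes a: "continuous_on S a" and u: "continuous_on S u"
    and z: "\<And>x. x \<in> S \<Longrightarrow> u x = 0 \<Longrightarrow> a x = (0::real)"
  shows "continuous_on S (\<lambda>x. a x *\<^sub>R sgn (u x))"
  unfolding continuous_on_def
proof
  fix x assume x: "x \<in> S"
  have at: "(a \<longlongrightarrow> a x) (at x within S)" and ut: "(u \<longlongrightarrow> u x) (at x within S)"
    using a u x by (simp_all add: continuous_on_def)
  show "((\<lambda>x. a x *\<^sub>R sgn (u x)) \<longlongrightarrow> a x *\<^sub>R sgn (u x)) (at x within S)"
  proof (cases "u x = 0")
    case False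
    then show ?thesis using at ut by (intro tendsto_intros)
  next
    case True
    have "((\<lambda>x. \<bar>a x\<bar>) \<longlongrightarrow> 0) (at x within S)"
      using tendsto_rabs[OF at] z[OF x True] by simp
    moreover have "\<forall>\<^sub>F y in at x within S. norm (a y *\<^sub>R sgn (u y)) \<le> \<bar>a y\<bar>"
      by (intro always_eventually) (simp add: norm_sgn)
    ultimately have "((\<lambda>x. a x *\<^sub>R sgn (u x)) \<longlongrightarrow> 0) (at x within S)"
      by (rule Lim_null_comparison[rotated])
    then show ?thesis using True by simp
  qed
qed

text \<open>The flow \<open>u + w \<mapsto> exp t *\<^sub>R u + exp (- \<delta> * t) *\<^sub>R w\<close> preserves the directions of \<open>u\<close> and \<open>w\<close> and the
  product \<open>p = norm u powr \<delta> * norm w\<close>.  Keeping the directions and replacing the norms by \<open>a\<close> and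
  \<open>b\<close> with \<open>a * b = p\<close> and \<open>a\<^sup>2 - b\<^sup>2 = f\<close> moves each flow line injectively, as \<open>f\<close> increases along it.\<close>

lemma hyperbolic_normal_form:
  fixes f :: "'e::euclidean_space \<Rightarrow> real"
  assumes P: "linear P" "\<And>x. P (P x) = P x"
    and \<delta>: "\<delta> > 0" and r: "r > 0" and cont: "continuous_on (ball 0 r) f" and f0: "f 0 = 0"
    and incr: "\<And>x t. norm x < r \<Longrightarrow> norm (exp t *\<^sub>R (x - P x) + exp (- \<delta> * t) *\<^sub>R P x) < r \<Longrightarrow> x \<noteq> 0 \<Longrightarrow> t > 0 \<Longrightarrow>
                f x < f (exp t *\<^sub>R (x - P x) + exp (- \<delta> * t) *\<^sub>R P x)"
  obtains \<Theta> where "continuous_on (ball 0 r) \<Theta>" "inj_on \<Theta> (ball 0 r)" "\<Theta> 0 = 0"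
    "\<And>x. norm x < r \<Longrightarrow> f x = (norm (\<Theta> x - P (\<Theta> x)))\<^sup>2 - (norm (P (\<Theta> x)))\<^sup>2"
proof -
  define u where "u x = x - P x" for x
  define p where "p x = norm (u x) powr \<delta> * norm (P x)" for x
  \<comment> \<open>The conditions \<open>a * b = p\<close> and
    \<open>a\<^sup>2 - b\<^sup>2 = f\<close> give
    \<open>(a\<^sup>2 + b\<^sup>2)\<^sup>2 = f\<^sup>2 + 4 * p\<^sup>2\<close>, so \<open>D\<close>
    is \<open>a\<^sup>2 + b\<^sup>2\<close>, and the squares of \<open>a\<close> and
    \<open>b\<close> follow by adding and subtracting \<open>f\<close>.\<close>
  define D where "D x = sqrt ((f x)\<^sup>2 + 4 * (p x)\<^sup>2)" for x
  define a where "a x = sqrt ((D x + f x) / 2)" for x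
  define b where "b x = sqrt ((D x - f x) / 2)" for x
  define \<Theta> where "\<Theta> x = a x *\<^sub>R sgn (u x) + b x *\<^sub>R sgn (P x)" for x
  note Plin = linear_0[OF P(1)] linear_scale[OF P(1)] linear_add[OF P(1)] linear_diff[OF P(1)]
  have xu: "u x + P x = x" "P (u x) = 0" for x by (simp_all add: u_def Plin P)
  have Dabs: "D x \<ge> \<bar>f x\<bar>" for x unfolding D_def by (rule real_le_rsqrt) simp
  have D2: "(D x)\<^sup>2 = (f x)\<^sup>2 + 4 * (p x)\<^sup>2" for x by (simp add: D_def)
  have Df: "D x + f x \<ge> 0" "D x - f x \<ge> 0" for x using Dabs[of x] by linarith+
  have ab0: "a x \<ge> 0" "b x \<ge> 0" for x using Df[of x] by (simp_all add: a_def b_def)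
  have p0: "p x \<ge> 0" for x by (simp add: p_def)
  have a2: "(a x)\<^sup>2 = (D x + f x) / 2" and b2: "(b x)\<^sup>2 = (D x - f x) / 2" for x
    using Df[of x] by (simp_all add: a_def b_def)
  have ab_diff: "(a x)\<^sup>2 - (b x)\<^sup>2 = f x" for x unfolding a2 b2 by (simp add: field_simps)
  have ab_prod: "a x * b x = p x" for x
  proof -
    have "(a x * b x)\<^sup>2 = ((D x)\<^sup>2 - (f x)\<^sup>2) / 4"
      unfolding power_mult_distrib a2 b2 by (simp add: field_simps power2_eq_square)
    also have "\<dots> = (p x)\<^sup>2" unfolding D2 by simp
    finally show ?thesis using ab0[of x] p0[of x] by (simp add: power2_eq_iff_nonneg)
  qed
  have lim: "((\<lambda>n. f (exp (- c * real n) *\<^sub>R x)) \<longlonglongrightarrow> 0)" if "c > 0" for c and x :: 'e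
  proof -
    have "(\<lambda>n. exp (- c) ^ n) \<longlonglongrightarrow> 0" using that by (intro LIMSEQ_realpow_zero) auto
    then have "(\<lambda>n. exp (- c * real n)) \<longlonglongrightarrow> 0" by (simp add: exp_of_nat_mult[symmetric] mult.commute)
    then have "(\<lambda>n. exp (- c * real n) *\<^sub>R x) \<longlonglongrightarrow> 0 *\<^sub>R x" by (intro tendsto_intros)
    moreover have "isCont f 0" using cont r by (simp add: continuous_on_eq_continuous_at)
    ultimately show ?thesis using isCont_tendsto_compose f0 by fastforce
  qed
  have shrink: "norm (exp s *\<^sub>R x) < r" if "s \<le> 0" "norm x < r" for s and x :: 'e
  proof -
    have "exp s * norm x \<le> 1 * norm x" using that by (intro mult_right_mono) auto
    then show ?thesis using that by simp
  qed
  \<comment> \<open>On the kernel of \<open>P\<close> the flow contracts to \<open>0\<close>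
    backwards in time, so \<open>f\<close> is at least \<open>f 0 = 0\<close> at an intermediate
    point and strictly larger at \<open>x\<close>. This and its mirror image on the range of
    \<open>P\<close> show that \<open>a\<close> and \<open>b\<close> vanish exactly where
    \<open>u\<close> and \<open>P\<close> do, which makes \<open>\<Theta>\<close>
    continuous.\<close>
  have fpos: "f x > 0" if x: "norm x < r" "P x = 0" "x \<noteq> 0" for x
  proof -
    have inc: "f (exp s *\<^sub>R x) < f (exp t *\<^sub>R x)" if "s < t" "t \<le> 0" for s t
      using incr[of "exp s *\<^sub>R x" "t - s"] shrink[of s x] shrink[of t x] that x
      by (simp add: Plin flip: exp_add)
    have "0 \<le> f (exp (-1) *\<^sub>R x)"
    proof (rule LIMSEQ_le_const2[OF lim[of 1 x]])
      show "\<exists>N. \<forall>n\<ge>N. f (exp (- 1 * real n) *\<^sub>R x) \<le> f (exp (- 1) *\<^sub>R x)"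
        using inc by (intro exI[of _ 2]) (auto intro: less_imp_le)
    qed simp
    also have "\<dots> < f x" using inc[of "-1" 0] by simp
    finally show ?thesis .
  qed
  have fneg: "f x < 0" if x: "norm x < r" "u x = 0" "x \<noteq> 0" for x
  proof -
    have Px: "P x = x" using xu(1)[of x] x by simp
    have inc: "f (exp (- \<delta> * s) *\<^sub>R x) < f (exp (- \<delta> * t) *\<^sub>R x)" if "s < t" "0 \<le> s" for s t
    proof -
      have "- \<delta> * s + - \<delta> * (t - s) = - \<delta> * t" by (simp add: algebra_simps)
      then have "exp (- \<delta> * (t - s)) * exp (- \<delta> * s) = exp (- \<delta> * t)" by (metis add.commute exp_add)
      then show ?thesis
        using incr[of "exp (- \<delta> * s) *\<^sub>R x" "t - s"] shrink[of "- \<delta> * s" x] shrink[of "- \<delta> * t" x] that x \<delta>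
        by (simp add: Plin Px mult_nonneg_nonneg)
    qed
    have "f x < f (exp (- \<delta> * 1) *\<^sub>R x)" using inc[of 0 1] by simp
    also have "\<dots> \<le> 0"
    proof (rule LIMSEQ_le_const[OF lim[OF \<delta>, of x]])
      show "\<exists>N. \<forall>n\<ge>N. f (exp (- \<delta> * 1) *\<^sub>R x) \<le> f (exp (- \<delta> * real n) *\<^sub>R x)"
        using inc[of 1] by (intro exI[of _ 2]) (auto intro!: less_imp_le)
    qed
    finally show ?thesis .
  qed
  have a0: "a x = 0 \<longleftrightarrow> u x = 0" if x: "norm x < r" for x
  proof
    assume "u x = 0"
    then have "p x = 0" by (simp add: p_def)
    moreover have "f x \<le> 0" using fneg[OF x \<open>u x = 0\<close>] f0 by (cases "x = 0") auto
    ultimately show "a x = 0" by (simp add: a_def D_def)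
  next
    assume "a x = 0"
    then have "p x = 0" "f x \<le> 0" unfolding ab_prod[of x, symmetric] ab_diff[of x, symmetric] by simp_all
    then have "u x = 0 \<or> P x = 0" "P x = 0 \<longrightarrow> x = 0" using fpos[OF x] by (force simp: p_def)+
    then show "u x = 0" by (auto simp: u_def Plin)
  qed
  have b0: "b x = 0 \<longleftrightarrow> P x = 0" if x: "norm x < r" for x
  proof
    assume "P x = 0"
    then have "p x = 0" by (simp add: p_def)
    moreover have "f x \<ge> 0" using fpos[OF x \<open>P x = 0\<close>] f0 by (cases "x = 0") auto
    ultimately show "b x = 0" by (simp add: b_def D_def)
  next
    assume "b x = 0"
    then have "p x = 0" "f x \<ge> 0" unfolding ab_prod[of x, symmetric] ab_diff[of x, symmetric] by simp_all
    then have "u x = 0 \<or> P x = 0" "u x = 0 \<longrightarrow> x = 0" using fneg[OF x] by (force simp: p_def)+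
    then show "P x = 0" by (auto simp: Plin)
  qed
  have cP: "continuous_on S P" for S using P(1) linear_continuous_on linear_conv_bounded_linear by blast
  have cu: "continuous_on S u" for S unfolding u_def by (intro continuous_intros cP)
  have cp: "continuous_on S p" for S
    unfolding p_def using \<delta> by (intro continuous_intros cP cu continuous_on_powr') auto
  have cD: "continuous_on (ball 0 r) D" unfolding D_def by (intro continuous_intros cont cp)
  have "continuous_on (ball 0 r) a" "continuous_on (ball 0 r) b"
    unfolding a_def b_def by (intro continuous_intros cont cD; simp)+
  then have "continuous_on (ball 0 r) \<Theta>"
    unfolding \<Theta>_def using a0 b0 by (intro continuous_on_add continuous_on_scaleR_sgn cu cP) auto
  moreover have "\<Theta> 0 = 0" by (simp add: \<Theta>_def u_def Plin)
  moreover have P\<Theta>: "P (\<Theta> x) = b x *\<^sub>R sgn (P x)" and u\<Theta>: "\<Theta> x - P (\<Theta> x) = a x *\<^sub>R sgn (u x)" for x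
    by (simp_all add: \<Theta>_def Plin sgn_div_norm P xu)
  have nP: "norm (P (\<Theta> x)) = b x" if "norm x < r" for x
    unfolding P\<Theta> using ab0[of x] b0[OF that] by (auto simp: norm_sgn)
  have nu: "norm (\<Theta> x - P (\<Theta> x)) = a x" if "norm x < r" for x
    unfolding u\<Theta> using ab0[of x] a0[OF that] by (auto simp: norm_sgn)
  have "f x = (norm (\<Theta> x - P (\<Theta> x)))\<^sup>2 - (norm (P (\<Theta> x)))\<^sup>2" if "norm x < r" for x
    using nP[OF that] nu[OF that] ab_diff[of x] by simp
  moreover have "inj_on \<Theta> (ball 0 r)"
  proof (rule inj_onI)
    fix x y assume "x \<in> ball 0 r" "y \<in> ball 0 r" and eq: "\<Theta> x = \<Theta> y"
    then have x: "norm x < r" and y: "norm y < r" by auto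
    have b_eq: "b x = b y" and a_eq: "a x = a y" using nP[OF x] nP[OF y] nu[OF x] nu[OF y] eq by auto
    then have f_eq: "f x = f y" and p_eq: "p x = p y" using ab_diff[of x] ab_diff[of y] ab_prod[of x] ab_prod[of y] by auto
    have su: "sgn (u x) = sgn (u y)"
    proof (cases "u x = 0")
      case False
      then show ?thesis using u\<Theta>[of x] u\<Theta>[of y] eq a_eq a0[OF x] by auto
    qed (use a0[OF x] a0[OF y] a_eq in auto)
    have sw: "sgn (P x) = sgn (P y)"
    proof (cases "P x = 0")
      case False
      then show ?thesis using P\<Theta>[of x] P\<Theta>[of y] eq b_eq b0[OF x] by auto
    qed (use b0[OF x] b0[OF y] b_eq in auto)
    have sc: "z' = exp t *\<^sub>R z" if "sgn z = sgn z'" "norm z' = exp t * norm z" for z z' :: 'e and t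
    proof -
      have polar: "norm v *\<^sub>R sgn v = v" for v :: 'e by (cases "v = 0") (auto simp: sgn_div_norm)
      have "z' = norm z' *\<^sub>R sgn z'" by (simp only: polar)
      also have "\<dots> = exp t *\<^sub>R (norm z *\<^sub>R sgn z)" by (simp add: that)
      also have "norm z *\<^sub>R sgn z = z" by (rule polar)
      finally show ?thesis .
    qed
    \<comment> \<open>Equal directions and equal products \<open>p\<close> put \<open>x\<close> and
      \<open>y\<close> on one flow line; the time is read off from the norms of \<open>u\<close>, or
      from those of \<open>P\<close> if \<open>u\<close> vanishes.\<close>
    have "\<exists>t. u y = exp t *\<^sub>R u x \<and> P y = exp (- \<delta> * t) *\<^sub>R P x"
    proof (cases "u x = 0")
      case False
      then have uy: "u y \<noteq> 0" using su by (metis sgn_zero_iff)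
      define t where "t = ln (norm (u y) / norm (u x))"
      have nt: "norm (u y) = exp t * norm (u x)" using False uy by (simp add: t_def)
      have "norm (u x) powr \<delta> * norm (P x) = (exp t * norm (u x)) powr \<delta> * norm (P y)"
        using p_eq by (simp add: p_def nt)
      also have "\<dots> = norm (u x) powr \<delta> * (exp (\<delta> * t) * norm (P y))"
        by (simp add: powr_mult powr_def[of "exp t"] mult_ac)
      finally have "norm (P x) = exp (\<delta> * t) * norm (P y)" using False by simp
      then have "norm (P y) = exp (- \<delta> * t) * norm (P x)" by (simp add: exp_minus field_simps)
      then show ?thesis using sc[OF su nt] sc[OF sw] by blast
    next
      case True
      then have uy: "u y = 0" using su by (metis sgn_zero_iff)
      show ?thesis
      proof (cases "P x = 0")
        case False
        then have Py: "P y \<noteq> 0" using sw by (metis sgn_zero_iff)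
        define t where "t = - ln (norm (P y) / norm (P x)) / \<delta>"
        have "- \<delta> * t = ln (norm (P y) / norm (P x))" using \<delta> by (simp add: t_def)
        then have "norm (P y) = exp (- \<delta> * t) * norm (P x)" using False Py by simp
        then show ?thesis using sc[OF sw] True uy by auto
      next
        case True
        then have "P y = 0" using sw by (metis sgn_zero_iff)
        then show ?thesis using True \<open>u x = 0\<close> uy by auto
      qed
    qed
    then obtain t where t: "u y = exp t *\<^sub>R u x" "P y = exp (- \<delta> * t) *\<^sub>R P x" by blast
    have y_eq: "y = exp t *\<^sub>R (x - P x) + exp (- \<delta> * t) *\<^sub>R P x" using t xu(1)[of y] by (simp add: u_def)
    have "x - P x = exp (- t) *\<^sub>R (y - P y)" "P x = exp (- \<delta> * (- t)) *\<^sub>R P y"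
      using t by (simp_all add: u_def flip: exp_add)
    then have x_eq: "x = exp (- t) *\<^sub>R (y - P y) + exp (- \<delta> * (- t)) *\<^sub>R P y"
      by (metis diff_add_cancel)
    show "x = y"
    proof (cases "x = 0 \<or> y = 0")
      case True
      moreover have "y = 0" if "x = 0" using y_eq unfolding that by (simp add: Plin)
      moreover have "x = 0" if "y = 0" using x_eq unfolding that by (simp add: Plin)
      ultimately show ?thesis by auto
    next
      case False
      have "\<not> t > 0" using incr[of x t, folded y_eq] x y f_eq False by auto
      moreover have "\<not> - t > 0" using incr[of y "- t", folded x_eq] x y f_eq False by auto
      ultimately have "t = 0" by simp
      then show ?thesis using y_eq by simp
    qed
  qed
  ultimately show ?thesis using that by blast
qed

section \<open>The hyperbolic flow for a germ whose gradients all take part in the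
  dependence\<close>

context convex_min_germ
begin

lemma critical_normal_form:
  assumes lin: "linear P" and P: "\<And>x. (norm x)\<^sup>2 = (norm (x - P x))\<^sup>2 + (norm (P x))\<^sup>2" "\<And>x. P (P x) = P x"
    and orth: "\<And>i x. i \<in> I \<Longrightarrow> G i 0 \<bullet> (x - P x) = 0"
    and b: "b > 0" and decay: "\<And>x. \<exists>i\<in>I. G i 0 \<bullet> P x \<le> - b * norm (P x)"
  obtains r \<Theta> where "r > 0" "r \<le> R" "continuous_on (ball 0 r) \<Theta>" "inj_on \<Theta> (ball 0 r)" "\<Theta> 0 = 0"
    "\<And>x. norm x < r \<Longrightarrow> f x = (norm (\<Theta> x - P (\<Theta> x)))\<^sup>2 - (norm (P (\<Theta> x)))\<^sup>2"
proof -
  note Plin = linear_0[OF lin] linear_scale[OF lin] linear_add[OF lin] linear_diff[OF lin]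
  \<comment> \<open>The estimate is used with \<open>B = 0\<close> and \<open>e = 0\<close>: the
    generator of the hyperbolic flow is the unperturbed field.\<close>
  obtain \<delta> where \<delta>: "\<delta> > 0" "\<forall>\<^sub>F x in nhds 0. \<forall>i\<in>I. x \<noteq> 0 \<longrightarrow> h i x = f x \<longrightarrow> G i x \<bullet> (x - P x - \<delta> *\<^sub>R P x) > 0"
  proof (rule active_gradient_positive[of I P b])
    fix \<epsilon> \<delta>0 :: real
    assume \<epsilon>: "\<epsilon> > 0" and \<delta>0: "\<delta>0 > 0" and *: "\<And>B \<delta>. B \<ge> 0 \<Longrightarrow> 0 < \<delta> \<Longrightarrow> \<delta> \<le> \<delta>0 \<Longrightarrow>
       \<forall>\<^sub>F x in nhds 0. \<forall>i\<in>I. x \<noteq> 0 \<longrightarrow> h i x = f x \<longrightarrow>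
         (\<forall>e. norm e \<le> \<epsilon> * norm (x - P x) + B * norm (P x) \<longrightarrow> G i 0 \<bullet> e = 0 \<longrightarrow>
           G i x \<bullet> (x - P x + e - \<delta> *\<^sub>R P x) > 0)"
    have "\<forall>\<^sub>F x in nhds 0. \<forall>i\<in>I. x \<noteq> 0 \<longrightarrow> h i x = f x \<longrightarrow> G i x \<bullet> (x - P x - \<delta>0 *\<^sub>R P x) > 0"
      using *[OF order_refl \<delta>0 order_refl]
    proof eventually_elim
      case (elim x)
      then show ?case using \<epsilon> by (force dest: spec[of _ 0])
    qed
    then show ?thesis using that \<delta>0 by blast
  qed (rule subset_refl P(1) orth b decay; assumption?)+
  then obtain r where r: "r > 0" "\<And>x i. norm x < r \<Longrightarrow> i \<in> I \<Longrightarrow> x \<noteq> 0 \<Longrightarrow> h i x = f x \<Longrightarrow> G i x \<bullet> (x - P x - \<delta> *\<^sub>R P x) > 0"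
    by (auto simp: eventually_nhds_metric dist_norm)
  \<comment> \<open>Between two points of a flow line the norm stays below the sum of their norms,
    so half the radius keeps the whole arc inside the region of the estimate.\<close>
  define r' where "r' = min r R / 2"
  have r': "r' > 0" "2 * r' \<le> r" "2 * r' \<le> R" using r R by (auto simp: r'_def)
  have Ple: "norm (x - P x) \<le> norm x" "norm (P x) \<le> norm x" for x
    using P(1)[of x] by (auto intro: power2_le_imp_le)
  have incr: "f x < f (exp t *\<^sub>R (x - P x) + exp (- \<delta> * t) *\<^sub>R P x)"
    if x: "norm x < r'" and y: "norm (exp t *\<^sub>R (x - P x) + exp (- \<delta> * t) *\<^sub>R P x) < r'"
      and "x \<noteq> 0" "t > 0" for x t
  proof -
    define \<gamma> where "\<gamma> s = exp s *\<^sub>R (x - P x) + exp (- \<delta> * s) *\<^sub>R P x" for s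
    define V where "V s = exp s *\<^sub>R (x - P x) - (\<delta> * exp (- \<delta> * s)) *\<^sub>R P x" for s
    have P\<gamma>: "P (\<gamma> s) = exp (- \<delta> * s) *\<^sub>R P x" for s by (simp add: \<gamma>_def Plin P)
    have vd: "(\<gamma> has_vector_derivative V s) (at s)" for s
      unfolding \<gamma>_def V_def by (auto intro!: derivative_eq_intros)
    have bound: "norm (\<gamma> s) < 2 * r'" if s: "0 \<le> s" "s \<le> t" for s
    proof -
      have "norm (\<gamma> s) \<le> exp s * norm (x - P x) + exp (- \<delta> * s) * norm (P x)"
        unfolding \<gamma>_def by (rule norm_triangle_le) simp
      also have "\<dots> \<le> exp t * norm (x - P x) + 1 * norm (P x)"
        using s \<delta>(1) by (intro add_mono mult_right_mono) auto
      also have "exp t * norm (x - P x) = norm (\<gamma> t - P (\<gamma> t))" by (simp add: P\<gamma>) (simp add: \<gamma>_def)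
      also have "\<dots> + 1 * norm (P x) \<le> norm (\<gamma> t) + norm x" using Ple by (intro add_mono) auto
      finally show ?thesis using x y by (simp add: \<gamma>_def)
    qed
    have "\<gamma> s \<noteq> 0" for s
    proof
      assume "\<gamma> s = 0"
      then have "P (\<gamma> s) = 0" "\<gamma> s - P (\<gamma> s) = 0" by (simp_all add: Plin)
      then show False using \<open>x \<noteq> 0\<close> by (simp add: P\<gamma>) (simp add: \<gamma>_def)
    qed
    then have pos: "G i (\<gamma> s) \<bullet> V s > 0" if "i \<in> I" "0 \<le> s" "s \<le> t" "h i (\<gamma> s) = f (\<gamma> s)" for i s
      using r(2)[of "\<gamma> s" i] bound[of s] that r' by (simp add: P\<gamma>) (simp add: \<gamma>_def V_def)
    have "f (\<gamma> 0) < f (\<gamma> t)"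
    proof (rule increase_along_curve_germ[OF \<open>t > 0\<close> _ vd])
      show "norm (\<gamma> s) < R" if "0 \<le> s" "s \<le> t" for s
        using bound[OF that] r'(3) by simp
      fix i s assume "i \<in> I" "0 \<le> s" "s < t" "h i (\<gamma> s) = f (\<gamma> s)"
      then show "0 < G i (\<gamma> s) \<bullet> V s" by (intro pos) auto
    qed
    then show ?thesis by (simp add: \<gamma>_def)
  qed
  have cont: "continuous_on (ball 0 r') f"
    using r' by (intro continuous_on_subset[OF f_continuous]) auto
  have "r' \<le> R" using r' by simp
  show ?thesis
    by (rule hyperbolic_normal_form[OF lin P(2) \<delta>(1) r'(1) cont f_zero incr])
      (assumption | rule that[OF r'(1) \<open>r' \<le> R\<close>])+
qed

end

section \<open>The regular case\<close>

text \<open>A one-dimensional foliation of the whole space whose leaves are transversal to the hyperplane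
  orthogonal to \<open>v\<close>.  Where \<open>D \<le> 0\<close> the leaves are straight lines in direction \<open>v\<close>; where \<open>D > 0\<close> they
  follow the vector field \<open>x - P x + \<rho> x *\<^sub>R v - \<delta> *\<^sub>R P x\<close>.  The point \<open>\<pi> x\<close> labels the leaf through \<open>x\<close>, and
  \<open>T x\<close> is the time spent in the region \<open>D > 0\<close>.\<close>

locale leaf_system =
  fixes P :: "'e::euclidean_space \<Rightarrow> 'e" and v :: 'e and N :: "'e \<Rightarrow> real" and \<epsilon> \<delta> B C :: real
  assumes P_linear: "linear P" and P_idem: "P (P x) = P x" and P_orth: "(x - P x) \<bullet> P y = 0"
    and v: "norm v = 1" "P v = 0"
    and N_cont: "continuous_on UNIV N" and N_scale: "c \<ge> 0 \<Longrightarrow> N (c *\<^sub>R x) = c * N x"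
    and params: "\<epsilon> > 0" "B > 0" "C \<ge> 0" "\<delta> > 0" "\<delta> \<le> 1"
begin

text \<open>The component orthogonal both to \<open>v\<close> and to the range of
  \<open>P\<close>.\<close>

definition z :: "'e \<Rightarrow> 'e" where "z x = x - P x - (x \<bullet> v) *\<^sub>R v"

text \<open>In the application the cone \<open>x \<bullet> v = N (z x)\<close> is, for
  \<open>P x = 0\<close>, the boundary of the set where all linear parts outside the dependence are
  nonnegative. The last two summands push the surface \<open>D = 0\<close> below it by a
  margin.\<close>

definition D :: "'e \<Rightarrow> real" where "D x = x \<bullet> v - N (z x) + \<epsilon> / 2 * norm (z x) + C * norm (P x)"

text \<open>The value that \<open>D\<close> has at \<open>x\<close> if the leaf through
  \<open>x\<close> crossed \<open>D = 0\<close> a time \<open>t\<close> earlier. Along leaves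
  \<open>D\<close> has the derivative \<open>D + \<epsilon> * norm (z x) + (1 + \<delta>) * B * norm
  (P x)\<close>, while the \<open>z\<close> and \<open>P\<close> components scale by
  \<open>exp t\<close> and \<open>exp (- \<delta> * t)\<close>.\<close>

definition E :: "'e \<Rightarrow> real \<Rightarrow> real" where
  "E x t = \<epsilon> * norm (z x) * t + B * norm (P x) * (exp ((1 + \<delta>) * t) - 1)"

text \<open>\<open>max 0\<close> yields the time \<open>0\<close> where \<open>D x \<le> 0\<close>.
  On the axis spanned by \<open>v\<close> the function \<open>E x\<close> vanishes identically; the
  default is harmless since \<open>\<pi> x = 0\<close> there for every time.\<close>

definition T :: "'e \<Rightarrow> real" where
  "T x = (if z x + P x = 0 then 0 else THE t. 0 \<le> t \<and> E x t = max 0 (D x))"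

text \<open>Undoes the flow for the time \<open>T x\<close>, back to the crossing point. The
  coordinate along \<open>v\<close> is dropped, as \<open>D = 0\<close> determines it.\<close>

definition \<pi> :: "'e \<Rightarrow> 'e" where "\<pi> x = exp (- T x) *\<^sub>R z x + exp (\<delta> * T x) *\<^sub>R P x"

text \<open>The part \<open>(1 + \<delta>) * C\<close> cancels what the summand
  \<open>C * norm (P x)\<close> of \<open>D\<close> contributes to the growth of \<open>D\<close>,
  so that \<open>D\<close> obeys an equation solvable in closed form.\<close>

definition \<rho> :: "'e \<Rightarrow> real" where "\<rho> x = \<epsilon> * norm (z x) + (1 + \<delta>) * (B + C) * norm (P x)"

text \<open>The integral curve that has \<open>D = 0\<close> and the \<open>z\<close> and
  \<open>P\<close> components of \<open>p\<close> at time \<open>0\<close>. The term with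
  \<open>t * exp t\<close> is a resonance: \<open>x \<bullet> v\<close> and the forcing
  \<open>norm (z x)\<close> grow at the same rate.\<close>

definition leaf :: "'e \<Rightarrow> real \<Rightarrow> 'e" where
  "leaf p t = (exp t * (N (z p) - \<epsilon> / 2 * norm (z p) + B * norm (P p)) + \<epsilon> * t * exp t * norm (z p)
      - (B + C) * exp (- \<delta> * t) * norm (P p)) *\<^sub>R v + exp t *\<^sub>R z p + exp (- \<delta> * t) *\<^sub>R P p"

section \<open>Splitting of a vector into its components along \<open>v\<close>, in the range of
  \<open>P\<close> and orthogonal to both\<close>

lemmas P_simps = linear_0[OF P_linear] linear_scale[OF P_linear] linear_add[OF P_linear]
  linear_diff[OF P_linear] P_idem v(2)

lemma N_zero [simp]: "N 0 = 0"
  using N_scale[of 0 0] by simp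

lemma v_inner_v [simp]: "v \<bullet> v = 1"
  using v(1) by (simp add: norm_eq_1)

lemma inner_v_P [simp]: "P x \<bullet> v = 0"
  using P_orth[of v x] by (simp add: v inner_commute)

lemma inner_v_z [simp]: "z x \<bullet> v = 0"
  by (simp add: z_def inner_diff_left)

lemma P_z [simp]: "P (z x) = 0"
  by (simp add: z_def P_simps)

lemma z_P [simp]: "z (P x) = 0"
  by (simp add: z_def P_simps)

lemma z_z [simp]: "z (z x) = z x"
  by (simp add: z_def[of "z x"])

lemma z_v [simp]: "z v = 0"
  by (simp add: z_def v)

lemma z_linear: "linear z"
  by (rule linearI) (simp_all add: z_def P_simps algebra_simps inner_add_left)

lemmas z_simps = linear_0[OF z_linear] linear_scale[OF z_linear] linear_add[OF z_linear] linear_diff[OF z_linear]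

lemma decomposition: "x = (x \<bullet> v) *\<^sub>R v + z x + P x"
  by (simp add: z_def)

lemma z_inner_P [simp]: "z x \<bullet> P y = 0"
  using P_orth[of x y] by (simp add: z_def inner_diff_left inner_commute[of v])

lemma pythagoras: "(norm x)\<^sup>2 = (x \<bullet> v)\<^sup>2 + (norm (z x))\<^sup>2 + (norm (P x))\<^sup>2"
proof -
  have "(norm x)\<^sup>2 = (norm ((x \<bullet> v) *\<^sub>R v + z x + P x))\<^sup>2"
    by (rule arg_cong[OF decomposition])
  also have "\<dots> = (x \<bullet> v)\<^sup>2 + (norm (z x))\<^sup>2 + (norm (P x))\<^sup>2"
    unfolding power2_norm_eq_inner inner_add_left inner_add_right
    using z_inner_P[of x x] inner_v_z[of x] inner_v_P[of x] by (simp add: power2_eq_square inner_commute)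
  finally show ?thesis .
qed

lemma component_bounds: "\<bar>x \<bullet> v\<bar> \<le> norm x" "norm (z x) \<le> norm x" "norm (P x) \<le> norm x"
  by (rule power2_le_imp_le; simp add: pythagoras[of x])+

lemma norm_le_components: "norm x \<le> \<bar>x \<bullet> v\<bar> + norm (z x) + norm (P x)"
proof -
  have "norm x = norm ((x \<bullet> v) *\<^sub>R v + z x + P x)" by (rule arg_cong[OF decomposition])
  also have "\<dots> \<le> norm ((x \<bullet> v) *\<^sub>R v) + norm (z x) + norm (P x)"
    by (intro norm_triangle_le add_mono) auto
  finally show ?thesis by (simp add: v)
qed

lemma z_P_eq_0_iff: "z x + P x = 0 \<longleftrightarrow> z x = 0 \<and> P x = 0"
proof
  assume eq: "z x + P x = 0"
  then have "P (z x + P x) = 0" by (simp add: P_simps)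
  then have "P x = 0" by (simp add: P_simps)
  then show "z x = 0 \<and> P x = 0" using eq by simp
qed simp

section \<open>Existence and uniqueness of the passage time\<close>

lemma E_0 [simp]: "E x 0 = 0"
  by (simp add: E_def)

lemma E_strict_mono:
  assumes "z x + P x \<noteq> 0" "s < t"
  shows "E x s < E x t"
proof (cases "z x = 0")
  case False
  have "\<epsilon> * norm (z x) * s < \<epsilon> * norm (z x) * t" using False assms params by simp
  moreover have "B * norm (P x) * (exp ((1 + \<delta>) * s) - 1) \<le> B * norm (P x) * (exp ((1 + \<delta>) * t) - 1)"
    using assms params by (intro mult_left_mono) auto
  ultimately show ?thesis by (simp add: E_def)
next
  case True
  then have "P x \<noteq> 0" using assms by auto
  then show ?thesis using True assms params by (simp add: E_def)
qed

lemma E_continuous: "continuous_on UNIV (E x)"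
  unfolding E_def by (intro continuous_intros)

lemma E_solution_exists:
  assumes "z x + P x \<noteq> 0" "d \<ge> 0"
  shows "\<exists>t\<ge>0. E x t = d"
proof -
  \<comment> \<open>By \<open>exp s - 1 \<ge> s\<close>, \<open>E x\<close> grows at least at the
    rate \<open>c\<close> and has reached \<open>d\<close> at time \<open>d / c\<close>; the
    intermediate value theorem then gives the solution.\<close>
  define c where "c = \<epsilon> * norm (z x) + B * norm (P x)"
  have c: "c > 0"
    using assms(1) params by (cases "z x = 0") (auto simp: c_def intro: add_pos_nonneg)
  have le: "d \<le> E x (d / c)"
  proof -
    have t: "d / c \<ge> 0" using c assms by simp
    have "d / c \<le> (1 + \<delta>) * (d / c)" using mult_right_mono[OF _ t, of 1 "1 + \<delta>"] params by simp
    also have "\<dots> \<le> exp ((1 + \<delta>) * (d / c)) - 1" using exp_ge_add_one_self[of "(1 + \<delta>) * (d / c)"] by linarith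
    finally have "B * norm (P x) * (d / c) \<le> B * norm (P x) * (exp ((1 + \<delta>) * (d / c)) - 1)"
      using params by (intro mult_left_mono) auto
    moreover have "\<epsilon> * norm (z x) * (d / c) + B * norm (P x) * (d / c) = c * (d / c)"
      unfolding c_def by (rule distrib_right[symmetric])
    moreover have "c * (d / c) = d" using c by simp
    ultimately show ?thesis by (simp add: E_def)
  qed
  have "\<exists>t\<ge>0. t \<le> d / c \<and> E x t = d"
    using le assms c by (intro IVT') (auto intro: continuous_on_subset[OF E_continuous])
  then show ?thesis by auto
qed

lemma T_unique:
  assumes "z x + P x \<noteq> 0" "t \<ge> 0" "E x t = max 0 (D x)"
  shows "T x = t"
proof -
  have "(THE t. 0 \<le> t \<and> E x t = max 0 (D x)) = t"
    using assms E_strict_mono[OF assms(1)] by (intro the_equality) (auto, metis less_irrefl linorder_neqE)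
  then show ?thesis using assms(1) by (simp add: T_def)
qed

lemma T_nonneg: "T x \<ge> 0"
  and E_T: "z x + P x \<noteq> 0 \<Longrightarrow> E x (T x) = max 0 (D x)"
proof -
  have "T x \<ge> 0 \<and> (z x + P x \<noteq> 0 \<longrightarrow> E x (T x) = max 0 (D x))"
  proof (cases "z x + P x = 0")
    case False
    then obtain t where "t \<ge> 0" "E x t = max 0 (D x)" using E_solution_exists[of x "max 0 (D x)"] by auto
    then show ?thesis using T_unique[OF False] by auto
  qed (simp add: T_def)
  then show "T x \<ge> 0" "z x + P x \<noteq> 0 \<Longrightarrow> E x (T x) = max 0 (D x)" by auto
qed

lemma T_eq_0: "D x \<le> 0 \<Longrightarrow> T x = 0"
  using T_unique[of x 0] by (cases "z x + P x = 0") (simp add: T_def, simp add: max_def)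

section \<open>Leaves in closed form and continuity of the leaf label\<close>

lemma z_\<pi>: "z (\<pi> x) = exp (- T x) *\<^sub>R z x" and P_\<pi>: "P (\<pi> x) = exp (\<delta> * T x) *\<^sub>R P x"
  by (simp_all add: \<pi>_def z_simps P_simps)

lemma \<pi>_inner_v [simp]: "\<pi> x \<bullet> v = 0"
  by (simp add: \<pi>_def inner_add_left)

lemma z_leaf: "z (leaf p t) = exp t *\<^sub>R z p" and P_leaf: "P (leaf p t) = exp (- \<delta> * t) *\<^sub>R P p"
  by (simp_all add: leaf_def z_simps P_simps)

lemma leaf_inner_v: "leaf p t \<bullet> v = exp t * (N (z p) - \<epsilon> / 2 * norm (z p) + B * norm (P p))
    + \<epsilon> * t * exp t * norm (z p) - (B + C) * exp (- \<delta> * t) * norm (P p)"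
  by (simp add: leaf_def inner_add_left)

lemma D_leaf: "D (leaf p t) = \<epsilon> * t * exp t * norm (z p) + B * norm (P p) * (exp t - exp (- \<delta> * t))"
  unfolding D_def z_leaf P_leaf leaf_inner_v by (simp add: N_scale algebra_simps)

text \<open>A point is determined by its \<open>z\<close> and \<open>P\<close> components and its
  value of \<open>D\<close>, and \<open>T\<close> is defined so as to match the latter.\<close>

lemma leaf_\<pi>:
  assumes "z x + P x \<noteq> 0" "D x \<ge> 0"
  shows "leaf (\<pi> x) (T x) = x"
proof -
  have z: "z (leaf (\<pi> x) (T x)) = z x" and P: "P (leaf (\<pi> x) (T x)) = P x"
    by (simp_all add: z_leaf P_leaf z_\<pi> P_\<pi> flip: exp_add)
  have e: "exp ((1 + \<delta>) * T x) = exp (T x) * exp (\<delta> * T x)" by (simp add: algebra_simps exp_add)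
  have "D (leaf (\<pi> x) (T x)) = E x (T x)"
    unfolding D_leaf E_def z_\<pi> P_\<pi> e by (simp add: algebra_simps flip: exp_add)
  also have "\<dots> = D x" using E_T[OF assms(1)] assms(2) by simp
  finally have "leaf (\<pi> x) (T x) \<bullet> v = x \<bullet> v" unfolding D_def z P by simp
  then show ?thesis using z P decomposition[of x] decomposition[of "leaf (\<pi> x) (T x)"] by simp
qed

lemma leaf_0: "D x \<le> 0 \<Longrightarrow> x = leaf (\<pi> x) 0 + D x *\<^sub>R v"
proof -
  assume "D x \<le> 0"
  then have T: "T x = 0" by (rule T_eq_0)
  have "leaf (\<pi> x) 0 + D x *\<^sub>R v = (x \<bullet> v) *\<^sub>R v + z x + P x"
    by (simp add: leaf_def z_\<pi> P_\<pi> T D_def algebra_simps)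
  then show ?thesis using decomposition[of x] by simp
qed

lemma leaf_has_vector_derivative:
  "(leaf p has_vector_derivative (leaf p t - P (leaf p t) + \<rho> (leaf p t) *\<^sub>R v - \<delta> *\<^sub>R P (leaf p t))) (at t)"
proof -
  define a where "a t = exp t * (N (z p) - \<epsilon> / 2 * norm (z p) + B * norm (P p))
    + \<epsilon> * t * exp t * norm (z p) - (B + C) * exp (- \<delta> * t) * norm (P p)" for t
  have a: "(a has_real_derivative a t + \<rho> (leaf p t)) (at t)"
    unfolding \<rho>_def z_leaf P_leaf a_def by (auto intro!: derivative_eq_intros simp: algebra_simps)
  have eq: "leaf p = (\<lambda>t. a t *\<^sub>R v + exp t *\<^sub>R z p + exp (- \<delta> * t) *\<^sub>R P p)"
    by (auto simp: leaf_def a_def)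
  have d: "((\<lambda>t. a t *\<^sub>R v + exp t *\<^sub>R z p + exp (- \<delta> * t) *\<^sub>R P p) has_vector_derivative
      (a t + \<rho> (leaf p t)) *\<^sub>R v + exp t *\<^sub>R z p - (\<delta> * exp (- \<delta> * t)) *\<^sub>R P p) (at t)"
    by (auto intro!: derivative_eq_intros a simp: mult.commute[of _ \<delta>])
  have "leaf p t = a t *\<^sub>R v + exp t *\<^sub>R z p + exp (- \<delta> * t) *\<^sub>R P p"
    by (simp add: eq)
  then have e: "(a t + \<rho> (leaf p t)) *\<^sub>R v + exp t *\<^sub>R z p - (\<delta> * exp (- \<delta> * t)) *\<^sub>R P p
      = leaf p t - P (leaf p t) + \<rho> (leaf p t) *\<^sub>R v - \<delta> *\<^sub>R P (leaf p t)"
    unfolding P_leaf by (simp add: algebra_simps)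
  show ?thesis using d unfolding e eq[symmetric] .
qed

lemma P_continuous: "continuous_on S P" and z_continuous: "continuous_on S z"
  using P_linear z_linear linear_continuous_on linear_conv_bounded_linear by blast+

lemma D_continuous: "continuous_on S D"
  unfolding D_def
  by (intro continuous_intros P_continuous z_continuous continuous_on_compose2[OF N_cont]) auto

lemma isCont_PzD: "isCont P x" "isCont z x" "isCont D x"
  using P_continuous[of UNIV] z_continuous[of UNIV] D_continuous[of UNIV]
  by (simp_all add: continuous_on_eq_continuous_at)

text \<open>For fixed \<open>s\<close> the sign of \<open>E y s - max 0 (D y)\<close> tells on which
  side of \<open>s\<close> the time \<open>T y\<close> lies, by strict monotonicity in
  \<open>s\<close>; this expression is continuous in \<open>y\<close>.\<close>

lemma isCont_T:
  assumes nz: "z x + P x \<noteq> 0"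
  shows "isCont T x"
  unfolding isCont_def
proof (rule order_tendstoI)
  have ev: "\<forall>\<^sub>F y in at x. z y + P y \<noteq> 0"
  proof -
    have "isCont (\<lambda>y. z y + P y) x" by (intro continuous_intros isCont_PzD)
    then show ?thesis using nz by (simp add: isCont_def tendsto_imp_eventually_ne)
  qed
  have cE: "isCont (\<lambda>y. E y s - max 0 (D y)) x" for s
    unfolding E_def by (intro continuous_intros isCont_PzD)
  {
    fix s assume s: "s < T x"
    show "\<forall>\<^sub>F y in at x. s < T y"
    proof (cases "s < 0")
      case True
      then show ?thesis using T_nonneg by (intro always_eventually) (auto intro: less_le_trans)
    next
      case False
      have "E x s - max 0 (D x) < 0" using E_strict_mono[OF nz s] E_T[OF nz] by simp
      then have "\<forall>\<^sub>F y in at x. E y s - max 0 (D y) < 0" by (rule order_tendstoD(2)[OF cE[of s, unfolded isCont_def]])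
      then show ?thesis using ev
      proof eventually_elim
        case (elim y)
        then show ?case using E_strict_mono[of y "T y" s] E_T[of y] by (cases "T y" s rule: linorder_cases) auto
      qed
    qed
  next
    fix s assume s: "T x < s"
    have "E x s - max 0 (D x) > 0" using E_strict_mono[OF nz s] E_T[OF nz] by simp
    then have "\<forall>\<^sub>F y in at x. E y s - max 0 (D y) > 0" by (rule order_tendstoD(1)[OF cE[of s, unfolded isCont_def]])
    then show "\<forall>\<^sub>F y in at x. T y < s" using ev
    proof eventually_elim
      case (elim y)
      then show ?case using E_strict_mono[of y s "T y"] E_T[of y] by (cases "T y" s rule: linorder_cases) auto
    qed
  }
qed

text \<open>Near the half axis \<open>D > 0\<close> the time \<open>T\<close> is unbounded, and the
  growth of \<open>exp (\<delta> * T x)\<close> has to be weighed against \<open>norm (P x)\<close>.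
  As \<open>\<delta> \<le> 1\<close>, its square is at most
  \<open>exp ((1 + \<delta>) * T x)\<close>, which the equation for \<open>T\<close> controls by the
  inverse of \<open>norm (P x)\<close>; a square root of \<open>norm (P x)\<close> survives. This
  gives continuity of \<open>\<pi>\<close> on the axis, where \<open>T\<close> may jump.\<close>

lemma norm_\<pi>_le: "norm (\<pi> x) \<le> norm (z x) + sqrt (norm (P x) * (max 0 (D x) / B + norm (P x)))"
proof (cases "z x + P x = 0")
  case True
  then show ?thesis by (simp add: z_P_eq_0_iff \<pi>_def)
next
  case False
  let ?w = "norm (P x)"
  have "0 \<le> \<epsilon> * norm (z x) * T x" using T_nonneg[of x] params by simp
  then have "B * ?w * (exp ((1 + \<delta>) * T x) - 1) \<le> max 0 (D x)"
    using E_T[OF False] unfolding E_def by linarith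
  then have 1: "?w * exp ((1 + \<delta>) * T x) \<le> max 0 (D x) / B + ?w"
    using params(2) by (simp add: field_simps)
  have "2 * \<delta> * T x \<le> (1 + \<delta>) * T x" using T_nonneg[of x] params by (intro mult_right_mono) auto
  then have "(exp (\<delta> * T x))\<^sup>2 \<le> exp ((1 + \<delta>) * T x)" by (simp add: power2_eq_square mult.assoc flip: exp_add)
  then have "?w * (exp (\<delta> * T x))\<^sup>2 \<le> max 0 (D x) / B + ?w"
    using 1 by (meson mult_left_mono norm_ge_zero order_trans)
  then have "?w * (?w * (exp (\<delta> * T x))\<^sup>2) \<le> ?w * (max 0 (D x) / B + ?w)" by (intro mult_left_mono) auto
  then have "(exp (\<delta> * T x) * ?w)\<^sup>2 \<le> ?w * (max 0 (D x) / B + ?w)" by (simp add: power2_eq_square mult_ac)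
  then have 2: "exp (\<delta> * T x) * ?w \<le> sqrt (?w * (max 0 (D x) / B + ?w))" by (rule real_le_rsqrt)
  have "exp (- T x) * norm (z x) \<le> 1 * norm (z x)" using T_nonneg[of x] by (intro mult_right_mono) auto
  then show ?thesis using 2 norm_triangle_ineq[of "exp (- T x) *\<^sub>R z x" "exp (\<delta> * T x) *\<^sub>R P x"]
    by (simp add: \<pi>_def)
qed

lemma \<pi>_continuous: "continuous_on S \<pi>"
proof (rule continuous_at_imp_continuous_on, rule ballI)
  fix x
  show "isCont \<pi> x"
  proof (cases "z x + P x = 0")
    case False
    then show ?thesis unfolding \<pi>_def by (intro continuous_intros isCont_PzD isCont_T)
  next
    case True
    then have z: "z x = 0" "P x = 0" by (simp_all add: z_P_eq_0_iff)
    have "isCont (\<lambda>x. norm (z x) + sqrt (norm (P x) * (max 0 (D x) / B + norm (P x)))) x"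
      using params(2) by (intro continuous_intros isCont_PzD) auto
    then have "((\<lambda>x. norm (z x) + sqrt (norm (P x) * (max 0 (D x) / B + norm (P x)))) \<longlongrightarrow> 0) (at x)"
      by (simp add: isCont_def z)
    then have "(\<pi> \<longlongrightarrow> 0) (at x)"
      by (rule Lim_null_comparison[rotated]) (intro always_eventually allI norm_\<pi>_le)
    then show ?thesis by (simp add: isCont_def \<pi>_def z)
  qed
qed

lemma D_leaf_nonneg:
  assumes "0 \<le> t"
  shows "0 \<le> D (leaf p t)"
proof -
  have "exp (- \<delta> * t) \<le> exp t" using assms params by (auto intro: order_trans[of _ 0])
  then show ?thesis unfolding D_leaf using assms params by (intro add_nonneg_nonneg mult_nonneg_nonneg) auto
qed

text \<open>The region \<open>\<Omega>\<close> is convex along leaves, as \<open>norm (z x)\<close>, \<open>norm (P x)\<close> and \<open>D x\<close> are monotone there.\<close>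

definition \<Omega> :: "real \<Rightarrow> 'e set" where
  "\<Omega> r = {x. \<bar>D x\<bar> < r \<and> norm (z x) < r \<and> norm (P x) < r}"

lemma leaf_in_\<Omega>:
  assumes "leaf p s \<in> \<Omega> r" "leaf p t \<in> \<Omega> r" "0 \<le> s" "s \<le> q" "q \<le> t"
  shows "leaf p q \<in> \<Omega> r"
proof -
  have "norm (z (leaf p q)) \<le> norm (z (leaf p t))"
    unfolding z_leaf using assms by (simp add: mult_right_mono)
  moreover have "norm (P (leaf p q)) \<le> norm (P (leaf p s))"
    unfolding P_leaf using assms params by (simp add: mult_right_mono)
  moreover have "0 \<le> D (leaf p q)" using assms by (intro D_leaf_nonneg) simp
  moreover have "D (leaf p q) \<le> D (leaf p t)"
  proof -
    have "exp (- \<delta> * q) \<le> exp q" using assms params by (auto intro: order_trans[of _ 0])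
    moreover have "exp (- \<delta> * t) \<le> exp (- \<delta> * q)" using assms params by simp
    moreover have "exp q \<le> exp t" using assms by simp
    ultimately have "0 \<le> exp q - exp (- \<delta> * q)" "exp q - exp (- \<delta> * q) \<le> exp t - exp (- \<delta> * t)"
      by linarith+
    then show ?thesis
      unfolding D_leaf using assms params by (intro add_mono mult_mono mult_left_mono) (auto simp: mult_nonneg_nonneg)
  qed
  ultimately show ?thesis using assms(1,2) by (auto simp: \<Omega>_def)
qed

lemma D_add_v: "D (x + s *\<^sub>R v) = D x + s"
  by (simp add: D_def z_simps P_simps inner_add_left)

lemma line_in_\<Omega>:
  assumes "x \<in> \<Omega> r" "x + t *\<^sub>R v \<in> \<Omega> r" "0 \<le> s" "s \<le> t"
  shows "x + s *\<^sub>R v \<in> \<Omega> r"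
  using assms by (auto simp: \<Omega>_def D_add_v z_simps P_simps)

text \<open>As \<open>\<pi> x\<close> is orthogonal to \<open>v\<close>, the map determines both the
  value of \<open>f\<close> and the leaf, and \<open>f\<close> separates the points of a leaf. The
  positive half axis needs a hypothesis of its own, because \<open>leaf 0\<close> rests at
  \<open>0\<close> and no curve \<open>leaf p\<close> runs along it.\<close>

lemma leaf_coordinates_inj:
  assumes line: "\<And>x s. x \<in> \<Omega> r \<Longrightarrow> x + s *\<^sub>R v \<in> \<Omega> r \<Longrightarrow> s > 0 \<Longrightarrow> D (x + s *\<^sub>R v) \<le> 0 \<Longrightarrow> f x < f (x + s *\<^sub>R v)"
    and curve: "\<And>p s t. z p + P p \<noteq> 0 \<Longrightarrow> leaf p s \<in> \<Omega> r \<Longrightarrow> leaf p t \<in> \<Omega> r \<Longrightarrow> 0 \<le> s \<Longrightarrow> s < t \<Longrightarrow>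
      f (leaf p s) < f (leaf p t)"
    and axis: "\<And>s t. t *\<^sub>R v \<in> \<Omega> r \<Longrightarrow> 0 \<le> s \<Longrightarrow> s < t \<Longrightarrow> f (s *\<^sub>R v) < f (t *\<^sub>R v)"
  shows "inj_on (\<lambda>x. f x *\<^sub>R v + \<pi> x) (\<Omega> r)"
proof -
  \<comment> \<open>The position on the leaf: \<open>D\<close> on straight parts and on the axis,
    the time on curved parts. The two fit together, since off the axis the former is nonpositive and
    the latter positive.\<close>
  define \<tau> where "\<tau> x = (if D x \<le> 0 \<or> z x + P x = 0 then D x else T x)" for x
  have T_pos: "T x > 0" if "D x > 0" "z x + P x \<noteq> 0" for x
  proof -
    have "E x (T x) > E x 0" using E_T[OF that(2)] that by simp
    then show ?thesis using T_nonneg[of x] by (cases "T x = 0") auto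
  qed
  have \<pi>_0: "\<pi> x = 0 \<longleftrightarrow> z x + P x = 0" for x
  proof
    assume "\<pi> x = 0"
    then have "z (\<pi> x) = 0" "P (\<pi> x) = 0" by (simp_all add: z_simps P_simps)
    then show "z x + P x = 0" unfolding z_\<pi> P_\<pi> by simp
  qed (simp add: z_P_eq_0_iff \<pi>_def)
  have ax: "x = D x *\<^sub>R v" if "z x + P x = 0" for x
    using that decomposition[of x] by (simp add: z_P_eq_0_iff D_def)
  have mono: "f x < f y" if xy: "x \<in> \<Omega> r" "y \<in> \<Omega> r" "\<pi> x = \<pi> y" "\<tau> x < \<tau> y" for x y
  proof (cases "\<pi> x = 0")
    case True
    then have z: "z x + P x = 0" "z y + P y = 0" using \<pi>_0[of x] \<pi>_0[of y] xy by simp_all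
    then have lt: "D x < D y" using xy by (simp add: \<tau>_def)
    note x = ax[OF z(1)] and y = ax[OF z(2)]
    have 1: "f x < f y" if "D y \<le> 0"
    proof -
      have "x + (D y - D x) *\<^sub>R v = D x *\<^sub>R v + (D y - D x) *\<^sub>R v" by (rule arg_cong[OF x])
      also have "\<dots> = D y *\<^sub>R v" by (simp add: algebra_simps)
      also have "\<dots> = y" by (rule y[symmetric])
      finally show ?thesis using line[of x "D y - D x"] xy(1,2) lt that by simp
    qed
    have 2: "f x < f y" if "D x \<ge> 0"
      using axis[OF subst[OF y, of "\<lambda>y. y \<in> \<Omega> r", OF xy(2)] that lt] by (simp flip: x y)
    have 3: "f x < f y" if "D x < 0" "D y > 0"
    proof -
      have z0: "0 \<in> \<Omega> r" using xy by (auto simp: \<Omega>_def z_simps P_simps D_def)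
      have "x + (- D x) *\<^sub>R v = D x *\<^sub>R v + (- D x) *\<^sub>R v" by (rule arg_cong[OF x])
      then have x0: "x + (- D x) *\<^sub>R v = 0" by simp
      have "f x < f 0" using line[of x "- D x"] xy z0 that unfolding x0 by (simp add: D_def z_simps P_simps)
      also have "f 0 < f y"
        using axis[OF subst[OF y, of "\<lambda>y. y \<in> \<Omega> r", OF xy(2)] order_refl that(2)] by (simp flip: y)
      finally show ?thesis .
    qed
    show ?thesis using 1 2 3 by linarith
  next
    case False
    then have z: "z x + P x \<noteq> 0" "z y + P y \<noteq> 0" using \<pi>_0[of x] \<pi>_0[of y] xy by simp_all
    define p where "p = \<pi> x"
    have p: "\<pi> x = p" "\<pi> y = p" using xy by (simp_all add: p_def)
    have zp: "z p + P p \<noteq> 0" using False unfolding p_def z_\<pi> P_\<pi> by (simp add: \<pi>_def)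
    \<comment> \<open>Going up a straight part to the crossing point keeps the \<open>z\<close> and
      \<open>P\<close> components and decreases the absolute value of \<open>D\<close>, so it does
      not leave \<open>\<Omega> r\<close>.\<close>
    have base: "leaf p 0 \<in> \<Omega> r" if "u \<in> \<Omega> r" "D u \<le> 0" "\<pi> u = p" for u
    proof -
      have "T u = 0" using that T_eq_0 by blast
      then have "z (leaf p 0) = z u" "P (leaf p 0) = P u" "D (leaf p 0) = 0"
        using z_\<pi>[of u] P_\<pi>[of u] that(3) by (simp_all add: z_leaf P_leaf D_leaf)
      then show ?thesis using that(1) by (auto simp: \<Omega>_def)
    qed
    have line': "f x < f y" if "D x < D y" "D y \<le> 0" "x \<in> \<Omega> r" "y \<in> \<Omega> r" "x = leaf p 0 + D x *\<^sub>R v" "y = leaf p 0 + D y *\<^sub>R v" for x y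
    proof -
      have "y = x + (D y - D x) *\<^sub>R v" by (subst that(5), subst that(6)) (simp add: algebra_simps)
      then show ?thesis using line[of x "D y - D x"] that(1-4) by simp
    qed
    have nonpos: "u = leaf p 0 + D u *\<^sub>R v" if "D u \<le> 0" "\<pi> u = p" for u using leaf_0[OF that(1)] that(2) by simp
    have pos: "u = leaf p (T u)" if "D u > 0" "\<pi> u = p" "z u + P u \<noteq> 0" for u
      using leaf_\<pi>[OF that(3)] that(1,2) by simp
    consider "D y \<le> 0" | "D x \<le> 0" "D y > 0" | "D x > 0" "D y > 0" by linarith
    then show ?thesis
    proof cases
      case 1
      then have "D x \<le> 0" using xy(4) z T_nonneg[of x] by (auto simp: \<tau>_def split: if_splits)
      then have "D x < D y" using 1 xy(4) by (simp add: \<tau>_def)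
      then show ?thesis using line'[of x y] nonpos[of x] nonpos[of y] p 1 \<open>D x \<le> 0\<close> xy by blast
    next
      case 2
      have 0: "leaf p 0 \<in> \<Omega> r" using base[of x] 2 p xy by blast
      have "f (leaf p 0) < f y" using curve[OF zp 0, of "T y"] T_pos[OF 2(2) z(2)] pos[OF 2(2) p(2) z(2)] xy by auto
      moreover have "f x \<le> f (leaf p 0)"
      proof (cases "D x = 0")
        case True
        then show ?thesis using nonpos[of x] p by simp
      next
        case False
        then show ?thesis using line'[of x "leaf p 0"] nonpos[of x] 2 p xy 0 by (simp add: D_leaf)
      qed
      ultimately show ?thesis by simp
    next
      case 3
      then have "T x < T y" using xy(4) z by (simp add: \<tau>_def)
      then show ?thesis
        using curve[OF zp, of "T x" "T y"] pos[OF 3(1) p(1) z(1)] pos[OF 3(2) p(2) z(2)] xy T_nonneg[of x] by auto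
    qed
  qed
  have same: "x = y" if xy: "\<pi> x = \<pi> y" "\<tau> x = \<tau> y" for x y
  proof (cases "\<pi> x = 0")
    case True
    then have z: "z x + P x = 0" "z y + P y = 0" using \<pi>_0[of x] \<pi>_0[of y] xy by simp_all
    then show ?thesis using ax[of x] ax[of y] xy(2) by (simp add: \<tau>_def)
  next
    case False
    then have z: "z x + P x \<noteq> 0" "z y + P y \<noteq> 0" using \<pi>_0[of x] \<pi>_0[of y] xy by simp_all
    have iff: "D x \<le> 0 \<longleftrightarrow> D y \<le> 0"
      using xy(2) z T_pos[of x] T_pos[of y] by (auto simp: \<tau>_def split: if_splits)
    show ?thesis
    proof (cases "D x \<le> 0")
      case True
      have "x = leaf (\<pi> x) 0 + D x *\<^sub>R v" using True by (rule leaf_0)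
      also have "\<dots> = leaf (\<pi> y) 0 + D y *\<^sub>R v" using True iff xy by (simp add: \<tau>_def)
      also have "\<dots> = y" using True iff by (intro leaf_0[symmetric]) simp
      finally show ?thesis .
    next
      case False
      have "x = leaf (\<pi> x) (T x)" using False z by (intro leaf_\<pi>[symmetric]) auto
      also have "\<dots> = leaf (\<pi> y) (T y)" using False iff xy z by (simp add: \<tau>_def)
      also have "\<dots> = y" using False iff z by (intro leaf_\<pi>) auto
      finally show ?thesis .
    qed
  qed
  show ?thesis
  proof (rule inj_onI)
    fix x y assume x: "x \<in> \<Omega> r" and y: "y \<in> \<Omega> r" and eq: "f x *\<^sub>R v + \<pi> x = f y *\<^sub>R v + \<pi> y"
    have f: "f x = f y" using arg_cong[OF eq, of "\<lambda>u. u \<bullet> v"] by (simp add: inner_add_left)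
    then have \<pi>: "\<pi> x = \<pi> y" using eq by simp
    show "x = y"
      using mono[OF x y \<pi>] mono[OF y x \<pi>[symmetric]] f same[OF \<pi>] by (cases "\<tau> x" "\<tau> y" rule: linorder_cases) auto
  qed
qed

end

section \<open>Estimates for a germ with a gradient outside the dependence\<close>

context convex_min_germ
begin

text \<open>Where \<open>D x \<le> 0\<close>, some linear part outside \<open>K\<close> is so
  negative that no function of \<open>K\<close> is active, and \<open>v\<close> raises all the
  others. Where \<open>D x \<ge> 0\<close>, the summand \<open>\<rho> x *\<^sub>R v\<close> is
  invisible to the functions of \<open>K\<close> at first order and compensates any decrease of the
  others.\<close>

lemma regular_normal_form:
  assumes lin: "linear P" and P: "\<And>x. P (P x) = P x" "\<And>x y. (x - P x) \<bullet> P y = 0"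
    "\<And>x. (norm x)\<^sup>2 = (norm (x - P x))\<^sup>2 + (norm (P x))\<^sup>2"
    and K: "K \<subseteq> I" "K \<noteq> I" and orth: "\<And>i x. i \<in> K \<Longrightarrow> G i 0 \<bullet> (x - P x) = 0"
    and b: "b > 0" and decay: "\<And>x. K \<noteq> {} \<Longrightarrow> \<exists>i\<in>K. G i 0 \<bullet> P x \<le> - b * norm (P x)"
    and v: "norm v = 1" "P v = 0" and G_v: "\<And>j. j \<in> I - K \<Longrightarrow> G j 0 \<bullet> v > 0"
  obtains r \<Theta> where "r > 0" "r \<le> R" "continuous_on (ball 0 r) \<Theta>" "inj_on \<Theta> (ball 0 r)"
    "\<And>x. norm x < r \<Longrightarrow> \<Theta> x \<bullet> v = f x"
proof -
  define J where "J = I - K"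
  define \<kappa> where "\<kappa> j = G j 0 \<bullet> v" for j
  \<comment> \<open>At \<open>s *\<^sub>R v + y\<close> all linear parts outside \<open>K\<close>
    are nonnegative exactly when \<open>s \<ge> N y\<close>.\<close>
  define N where "N y = Max ((\<lambda>j. - (G j 0 \<bullet> y) / \<kappa> j) ` J)" for y
  have J: "finite J" "J \<noteq> {}" using K fin by (auto simp: J_def)
  have \<kappa>: "\<kappa> j > 0" if "j \<in> J" for j using G_v that by (simp add: \<kappa>_def J_def)
  have N_ge: "- (G j 0 \<bullet> y) / \<kappa> j \<le> N y" if "j \<in> J" for j y
    using that J by (auto simp: N_def)
  have N_att: "\<exists>j\<in>J. N y = - (G j 0 \<bullet> y) / \<kappa> j" for y
  proof -
    have "N y \<in> (\<lambda>j. - (G j 0 \<bullet> y) / \<kappa> j) ` J" unfolding N_def using J by (intro Max_in) auto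
    then show ?thesis by (rule imageE) blast
  qed
  have N_cont: "continuous_on UNIV N"
    unfolding N_def using J
  proof (induction rule: finite_ne_induct)
    case (singleton j)
    then show ?case by (simp add: divide_inverse continuous_intros)
  next
    case (insert j F)
    then show ?case by (simp add: continuous_on_max continuous_intros divide_inverse)
  qed
  have N_scale: "N (c *\<^sub>R y) = c * N y" if "c \<ge> 0" for c y
  proof (rule antisym)
    obtain j where j: "j \<in> J" "N (c *\<^sub>R y) = - (G j 0 \<bullet> (c *\<^sub>R y)) / \<kappa> j" using N_att by blast
    then have "N (c *\<^sub>R y) = c * (- (G j 0 \<bullet> y) / \<kappa> j)" by simp
    then show "N (c *\<^sub>R y) \<le> c * N y" using mult_left_mono[OF N_ge[OF j(1), of y] that] by simp
    obtain i where i: "i \<in> J" "N y = - (G i 0 \<bullet> y) / \<kappa> i" using N_att by blast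
    then show "c * N y \<le> N (c *\<^sub>R y)" using N_ge[OF i(1), of "c *\<^sub>R y"] by simp
  qed
  define \<kappa>0 where "\<kappa>0 = Min (\<kappa> ` J)"
  have \<kappa>0: "\<kappa>0 > 0" "\<And>j. j \<in> J \<Longrightarrow> \<kappa>0 \<le> \<kappa> j" using J \<kappa> by (auto simp: \<kappa>0_def)
  define L1 where "L1 = (\<Sum>i\<in>I. norm (G i 0))"
  have L1: "L1 \<ge> 0" "\<And>i y. i \<in> I \<Longrightarrow> \<bar>G i 0 \<bullet> y\<bar> \<le> L1 * norm y"
  proof -
    show "L1 \<ge> 0" unfolding L1_def by (rule sum_nonneg) simp
    fix i and y :: 'e assume i: "i \<in> I"
    have "norm (G i 0) \<le> L1" unfolding L1_def using fin i by (intro member_le_sum) auto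
    then show "\<bar>G i 0 \<bullet> y\<bar> \<le> L1 * norm y"
      using Cauchy_Schwarz_ineq2[of "G i 0" y] mult_right_mono[of "norm (G i 0)" L1 "norm y"] by simp
  qed
  \<comment> \<open>The second summand pays for division by \<open>\<kappa> j\<close>, so one
    constant serves the linear parts and their normalised versions.\<close>
  define L where "L = L1 + L1 / \<kappa>0"
  have L: "L \<ge> 0" "L1 \<le> L" using L1 \<kappa>0 by (simp_all add: L_def)
  have LJ: "\<bar>G j 0 \<bullet> y\<bar> \<le> \<kappa> j * (L * norm y)" if "j \<in> J" for j y
  proof -
    have "L1 * norm y \<le> \<kappa>0 * (L * norm y)" using L1(1) \<kappa>0(1) by (simp add: L_def field_simps)
    also have "\<dots> \<le> \<kappa> j * (L * norm y)" using \<kappa>0(2)[OF that] L by (intro mult_right_mono) auto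
    finally show ?thesis using L1(2)[of j y] that by (simp add: J_def)
  qed
  have N_abs: "\<bar>N y\<bar> \<le> L * norm y" for y
  proof -
    obtain j where j: "j \<in> J" "N y = - (G j 0 \<bullet> y) / \<kappa> j" using N_att by blast
    then show ?thesis
      using LJ[OF j(1), of y] \<kappa>[OF j(1)] by (simp add: abs_divide pos_divide_le_eq mult_ac)
  qed
  obtain C1 where C1: "C1 > 0"
    "\<forall>\<^sub>F x in nhds 0. \<forall>i\<in>I. \<bar>h i x - G i 0 \<bullet> x\<bar> \<le> C1 * (norm x)\<^sup>2 \<and> norm (G i x - G i 0) \<le> C1 * norm x"
    using first_order_expansion by blast
  \<comment> \<open>In \<open>C\<close>, the first \<open>L\<close> covers a linear part outside
    \<open>K\<close> acting on \<open>P x\<close>, the term \<open>L / \<kappa>0\<close> covers one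
    of \<open>K\<close>, and \<open>1\<close> remains as a margin for \<open>D \<le> 0\<close>. With
    \<open>B = L + 1\<close> the same margin survives for \<open>D \<ge> 0\<close> against the loss
    \<open>\<delta> * L * norm (P x)\<close>.\<close>
  define B where "B = L + 1"
  define C where "C = L + L / \<kappa>0 + 1"
  have BC: "B > 0" "C \<ge> 0" using L \<kappa>0 by (simp_all add: B_def C_def)
  \<comment> \<open>As \<open>\<delta> \<le> 1\<close>, the coefficient of \<open>norm (P x)\<close>
    in \<open>\<rho>\<close> is at most \<open>2 * (B + C)\<close>, so
    \<open>\<rho> x *\<^sub>R v\<close> is an admissible perturbation \<open>e\<close>.\<close>
  obtain \<epsilon> \<delta> where \<epsilon>: "\<epsilon> > 0" and \<delta>: "\<delta> > 0" "\<delta> \<le> 1" and K_pos: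
    "\<forall>\<^sub>F x in nhds 0. \<forall>i\<in>K. x \<noteq> 0 \<longrightarrow> h i x = f x \<longrightarrow>
         (\<forall>e. norm e \<le> \<epsilon> * norm (x - P x) + (2 * (B + C)) * norm (P x) \<longrightarrow> G i 0 \<bullet> e = 0 \<longrightarrow>
           G i x \<bullet> (x - P x + e - \<delta> *\<^sub>R P x) > 0)"
  proof (rule active_gradient_positive[OF K(1) P(3) orth b decay])
    fix \<epsilon> \<delta>0 :: real
    assume "\<epsilon> > 0" and \<delta>0: "\<delta>0 > 0" "\<delta>0 \<le> 1" and *: "\<And>B \<delta>. B \<ge> 0 \<Longrightarrow> 0 < \<delta> \<Longrightarrow> \<delta> \<le> \<delta>0 \<Longrightarrow>
       \<forall>\<^sub>F x in nhds 0. \<forall>i\<in>K. x \<noteq> 0 \<longrightarrow> h i x = f x \<longrightarrow>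
         (\<forall>e. norm e \<le> \<epsilon> * norm (x - P x) + B * norm (P x) \<longrightarrow> G i 0 \<bullet> e = 0 \<longrightarrow>
           G i x \<bullet> (x - P x + e - \<delta> *\<^sub>R P x) > 0)"
    have "2 * (B + C) \<ge> 0" using BC by simp
    show thesis by (rule that[OF \<open>\<epsilon> > 0\<close> \<delta>0 *[OF \<open>2 * (B + C) \<ge> 0\<close> \<delta>0(1) order_refl]])
  qed
  interpret L: leaf_system P v N \<epsilon> \<delta> B C
    by (rule leaf_system.intro) (rule lin P(1,2) v N_cont N_scale \<epsilon> BC \<delta>; assumption?)+
  define A where "A = 2 + \<epsilon> + L + C"
  have A: "A \<ge> 1" using \<epsilon> L BC by (simp add: A_def)
  have xv: "x \<bullet> v = L.D x + N (L.z x) - \<epsilon> / 2 * norm (L.z x) - C * norm (P x)" for x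
    by (simp add: L.D_def)
  have norm_le: "norm x \<le> A * (\<bar>L.D x\<bar> + norm (L.z x) + norm (P x))" for x
  proof -
    have "\<bar>x \<bullet> v\<bar> \<le> \<bar>L.D x\<bar> + \<bar>N (L.z x)\<bar> + \<epsilon> / 2 * norm (L.z x) + C * norm (P x)"
      unfolding xv using \<epsilon> BC(2) by (smt (verit, best) divide_nonneg_nonneg mult_nonneg_nonneg norm_ge_zero)
    then have "norm x \<le> \<bar>L.D x\<bar> + (L + \<epsilon> / 2 + 1) * norm (L.z x) + (C + 1) * norm (P x)"
      using L.norm_le_components[of x] N_abs[of "L.z x"] by (simp add: algebra_simps)
    also have "\<dots> \<le> A * \<bar>L.D x\<bar> + A * norm (L.z x) + A * norm (P x)"
      using mult_right_mono[OF A, of "\<bar>L.D x\<bar>"] \<epsilon> L BC by (intro add_mono mult_right_mono) (auto simp: A_def)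
    finally show ?thesis by (simp add: algebra_simps)
  qed
  have D_abs: "\<bar>L.D x\<bar> \<le> A * norm x" for x
  proof -
    have "\<bar>L.D x\<bar> \<le> \<bar>x \<bullet> v\<bar> + \<bar>N (L.z x)\<bar> + \<epsilon> / 2 * norm (L.z x) + C * norm (P x)"
      unfolding L.D_def using \<epsilon> BC(2) by (smt (verit, best) divide_nonneg_nonneg mult_nonneg_nonneg norm_ge_zero)
    also have "\<dots> \<le> norm x + L * norm x + \<epsilon> / 2 * norm x + C * norm x"
      using L.component_bounds[of x] N_abs[of "L.z x"] \<epsilon> BC(2) L(1)
      by (intro add_mono mult_left_mono order_trans[OF N_abs]) auto
    also have "\<dots> \<le> A * norm x" using \<epsilon> by (simp add: A_def algebra_simps)
    finally show ?thesis .
  qed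
  \<comment> \<open>The first-order gains below contain \<open>norm (z x)\<close> only with the
    factor \<open>\<epsilon> / 2\<close>; \<open>1 + 2 / \<epsilon>\<close> makes them comparable
    with \<open>norm x\<close> nevertheless.\<close>
  define A' where "A' = A * (1 + 2 / \<epsilon>)"
  have A': "A' > 0" using A \<epsilon> by (simp add: A'_def add_pos_nonneg)
  have norm_le': "norm x \<le> A' * (\<bar>L.D x\<bar> + \<epsilon> / 2 * norm (L.z x) + norm (P x))" for x
  proof -
    have "\<bar>L.D x\<bar> + norm (L.z x) + norm (P x) \<le> (1 + 2 / \<epsilon>) * (\<bar>L.D x\<bar> + \<epsilon> / 2 * norm (L.z x) + norm (P x))"
      using \<epsilon> by (simp add: field_simps)
    then have "A * (\<bar>L.D x\<bar> + norm (L.z x) + norm (P x)) \<le> A * ((1 + 2 / \<epsilon>) * (\<bar>L.D x\<bar> + \<epsilon> / 2 * norm (L.z x) + norm (P x)))"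
      using A by (intro mult_left_mono) auto
    then show ?thesis using norm_le[of x] by (simp add: A'_def mult.assoc)
  qed
  define M where "M = 2 + \<epsilon> + 2 * (B + C)"
  have M: "M > 0" using \<epsilon> BC by (simp add: M_def)
  \<comment> \<open>One constant that dominates \<open>C1 * M * A'\<close>,
    \<open>2 * C1 * A'\<close> and \<open>C1\<close>, so that the radius
    \<open>\<kappa>0 / S\<close> controls the quadratic errors in both regions.\<close>
  define S where "S = C1 * (M + 3) * (A' + 1)"
  have S: "S > 0" using C1 M A' by (simp add: S_def)
  obtain d1 where d1: "d1 > 0" "\<And>x i e. norm x < d1 \<Longrightarrow> i \<in> K \<Longrightarrow> x \<noteq> 0 \<Longrightarrow> h i x = f x \<Longrightarrow>
      norm e \<le> \<epsilon> * norm (x - P x) + (2 * (B + C)) * norm (P x) \<Longrightarrow> G i 0 \<bullet> e = 0 \<Longrightarrow> G i x \<bullet> (x - P x + e - \<delta> *\<^sub>R P x) > 0"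
    using K_pos unfolding eventually_nhds_metric dist_norm diff_zero by blast
  obtain d2 where d2: "d2 > 0" "\<And>x i. norm x < d2 \<Longrightarrow> i \<in> I \<Longrightarrow> \<bar>h i x - G i 0 \<bullet> x\<bar> \<le> C1 * (norm x)\<^sup>2"
    "\<And>x i. norm x < d2 \<Longrightarrow> i \<in> I \<Longrightarrow> norm (G i x - G i 0) \<le> C1 * norm x"
    using C1(2) unfolding eventually_nhds_metric dist_norm diff_zero by blast
  define r1 where "r1 = Min {R, \<kappa>0 / S, d1, d2}"
  have r1: "r1 > 0" "r1 \<le> R" "r1 \<le> \<kappa>0 / S" "r1 \<le> d1" "r1 \<le> d2"
    using R S \<kappa>0(1) d1(1) d2(1) by (simp_all add: r1_def)
  have small: "norm x < R" "S * norm x < \<kappa>0" if "norm x < r1" for x :: 'e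
  proof -
    show "norm x < R" using that r1 by simp
    have "norm x < \<kappa>0 / S" using that r1 by linarith
    then show "S * norm x < \<kappa>0" using S by (simp add: pos_less_divide_eq mult.commute)
  qed
  note K_act = d1(2)[OF less_le_trans[OF _ r1(4)]]
  note exp1 = d2(2)[OF less_le_trans[OF _ r1(5)]]
  note exp2 = d2(3)[OF less_le_trans[OF _ r1(5)]]
  have small1: "C1 * M * norm x * A' < \<kappa>0" "2 * C1 * norm x * A' < \<kappa>0" "C1 * norm x < \<kappa>0" if "norm x < r1" for x :: 'e
  proof -
    have "S = C1 * M * A' + 3 * C1 * A' + C1 * M + 3 * C1" by (simp add: S_def algebra_simps)
    moreover have "C1 * M * A' > 0" "C1 * A' > 0" "C1 * M > 0" using C1 M A' by simp_all
    ultimately have "C1 * M * A' \<le> S" "2 * C1 * A' \<le> S" "C1 \<le> S" using C1(1) by linarith+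
    from this[THEN mult_right_mono, OF norm_ge_zero[of x]]
    show "C1 * M * norm x * A' < \<kappa>0" "2 * C1 * norm x * A' < \<kappa>0" "C1 * norm x < \<kappa>0"
      using small(2)[OF that] by (simp_all add: algebra_simps)
  qed
  have G_err: "\<bar>(G i x - G i 0) \<bullet> y\<bar> \<le> C1 * norm x * norm y" if "norm x < r1" "i \<in> I" for x y i
    using Cauchy_Schwarz_ineq2[of "G i x - G i 0" y] mult_right_mono[OF exp2[OF that] norm_ge_zero[of y]] by linarith
  have zK: "G i 0 \<bullet> v = 0" if "i \<in> K" for i using orth[OF that, of v] by (simp add: v)
  have curve_pos: "G i x \<bullet> (x - P x + L.\<rho> x *\<^sub>R v - \<delta> *\<^sub>R P x) > 0"
    if x: "norm x < r1" "x \<noteq> 0" "L.D x \<ge> 0" and i: "i \<in> I" "h i x = f x" for x i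
  proof -
    have "(1 + \<delta>) * (B + C) * norm (P x) \<le> 2 * (B + C) * norm (P x)"
      using \<delta> BC by (intro mult_right_mono) auto
    then have \<rho>_le: "L.\<rho> x \<le> \<epsilon> * norm (L.z x) + 2 * (B + C) * norm (P x)"
      unfolding L.\<rho>_def by linarith
    have "0 \<le> L.\<rho> x" using \<epsilon> \<delta> BC by (simp add: L.\<rho>_def)
    note \<rho> = this \<rho>_le
    have Ple: "norm (x - P x) \<le> norm x" using P(3)[of x] by (auto intro: power2_le_imp_le)
    show ?thesis
    proof (cases "i \<in> K")
      case True
      have "norm (L.z x) \<le> norm (x - P x)"
        using L.component_bounds(2)[of "x - P x"] by (simp add: L.z_simps)
      then have "\<epsilon> * norm (L.z x) \<le> \<epsilon> * norm (x - P x)" using \<epsilon> by simp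
      then have "norm (L.\<rho> x *\<^sub>R v) \<le> \<epsilon> * norm (x - P x) + (2 * (B + C)) * norm (P x)"
        using \<rho> by (simp add: v)
      then show ?thesis using K_act[OF x(1) True x(2) i(2)] zK[OF True] by simp
    next
      case False
      then have iJ: "i \<in> J" using i by (simp add: J_def)
      define V where "V = x - P x + L.\<rho> x *\<^sub>R v - \<delta> *\<^sub>R P x"
      have Vn: "norm V \<le> M * norm x"
      proof -
        have "norm V \<le> norm (x - P x) + norm (L.\<rho> x *\<^sub>R v) + norm (\<delta> *\<^sub>R P x)"
          using norm_triangle_ineq4[of "x - P x + L.\<rho> x *\<^sub>R v" "\<delta> *\<^sub>R P x"]
            norm_triangle_ineq[of "x - P x" "L.\<rho> x *\<^sub>R v"] unfolding V_def by linarith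
        also have "norm (L.\<rho> x *\<^sub>R v) \<le> \<epsilon> * norm x + 2 * (B + C) * norm x"
        proof -
          have "\<epsilon> * norm (L.z x) + 2 * (B + C) * norm (P x) \<le> \<epsilon> * norm x + 2 * (B + C) * norm x"
            using L.component_bounds[of x] \<epsilon> BC by (intro add_mono mult_left_mono) auto
          then show ?thesis using \<rho> by (simp add: v)
        qed
        also have "norm (\<delta> *\<^sub>R P x) \<le> 1 * norm x"
        proof -
          have "\<delta> * norm (P x) \<le> 1 * norm x" using \<delta> L.component_bounds[of x] by (intro mult_mono) auto
          then show ?thesis using \<delta> by simp
        qed
        finally show ?thesis using Ple by (simp add: M_def algebra_simps)
      qed
      \<comment> \<open>A lower bound for the first-order growth after division by
        \<open>\<kappa> i\<close>. It is comparable with \<open>norm x\<close> and therefore beats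
        the quadratic error.\<close>
      define q where "q = L.D x + \<epsilon> / 2 * norm (L.z x) + norm (P x)"
      have "norm x \<le> A' * q" using norm_le'[of x] x(3) by (simp add: q_def)
      moreover have "norm x > 0" using x by simp
      ultimately have "0 < A' * q" by linarith
      then have q: "q > 0" using A' by (simp add: zero_less_mult_iff)
      have "G i 0 \<bullet> x = \<kappa> i * (x \<bullet> v) + G i 0 \<bullet> L.z x + G i 0 \<bullet> P x"
        using arg_cong[OF L.decomposition[of x], of "\<lambda>y. G i 0 \<bullet> y"]
        by (simp add: inner_add_right \<kappa>_def mult.commute)
      then have "G i 0 \<bullet> V = \<kappa> i * (x \<bullet> v) + G i 0 \<bullet> L.z x + L.\<rho> x * \<kappa> i - \<delta> * (G i 0 \<bullet> P x)"
        by (simp add: V_def inner_add_right inner_diff_right \<kappa>_def)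
      moreover have "G i 0 \<bullet> L.z x \<ge> - (\<kappa> i * N (L.z x))"
        using N_ge[OF iJ, of "L.z x"] \<kappa>[OF iJ] by (simp add: field_simps)
      moreover have "\<delta> * (G i 0 \<bullet> P x) \<le> \<kappa> i * (\<delta> * L * norm (P x))"
        using LJ[OF iJ, of "P x"] mult_left_mono[of "G i 0 \<bullet> P x" "\<kappa> i * (L * norm (P x))" \<delta>] \<delta>
        by (simp add: mult_ac)
      ultimately have "G i 0 \<bullet> V \<ge> \<kappa> i * (x \<bullet> v - N (L.z x) + L.\<rho> x - \<delta> * L * norm (P x))"
        by (simp add: algebra_simps)
      moreover have "x \<bullet> v - N (L.z x) + L.\<rho> x - \<delta> * L * norm (P x) \<ge> q"
      proof -
        have "(1 + \<delta>) * (B + C) - C - \<delta> * L - 1 = L + \<delta> + \<delta> * C" by (simp add: B_def algebra_simps)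
        then have "0 \<le> ((1 + \<delta>) * (B + C) - C - \<delta> * L - 1) * norm (P x)" using L \<delta> BC by simp
        also have "\<dots> = x \<bullet> v - N (L.z x) + L.\<rho> x - \<delta> * L * norm (P x) - q"
          unfolding q_def xv L.\<rho>_def by (simp add: algebra_simps)
        finally show ?thesis by simp
      qed
      then have "\<kappa> i * (x \<bullet> v - N (L.z x) + L.\<rho> x - \<delta> * L * norm (P x)) \<ge> \<kappa>0 * q"
        using \<kappa>0(1) \<kappa>0(2)[OF iJ] q by (intro mult_mono) auto
      moreover have "C1 * norm x * norm V < \<kappa>0 * q"
      proof -
        have "C1 * norm x * norm V \<le> C1 * norm x * (M * norm x)"
          using Vn C1(1) by (intro mult_left_mono) auto
        also have "\<dots> \<le> C1 * norm x * (M * (A' * q))"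
          using \<open>norm x \<le> A' * q\<close> C1(1) M by (intro mult_left_mono) auto
        also have "\<dots> = (C1 * M * norm x * A') * q" by simp
        also have "\<dots> < \<kappa>0 * q" using small1(1)[OF x(1)] q by (intro mult_strict_right_mono)
        finally show ?thesis .
      qed
      moreover have "G i x \<bullet> V = G i 0 \<bullet> V + (G i x - G i 0) \<bullet> V" by (simp add: inner_diff_left)
      ultimately have "G i x \<bullet> V > 0" using G_err[OF x(1) i(1), of V] by linarith
      then show ?thesis by (simp add: V_def)
    qed
  qed
  have line_pos: "G i x \<bullet> v > 0"
    if x: "norm x < r1" "x \<noteq> 0" "L.D x \<le> 0" and i: "i \<in> I" "h i x = f x" for x i
  proof -
    \<comment> \<open>For \<open>j\<close> realising \<open>N\<close>, the linear part of
      \<open>h j\<close> lies below that of any \<open>h i\<close> from \<open>K\<close> by at least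
      \<open>\<kappa>0 * q\<close>, more than both quadratic errors; then
      \<open>h j x < h i x\<close> and \<open>h i\<close> is not active.\<close>
    have "i \<notin> K"
    proof
      assume iK: "i \<in> K"
      obtain j where j: "j \<in> J" "N (L.z x) = - (G j 0 \<bullet> L.z x) / \<kappa> j" using N_att by blast
      then have jI: "j \<in> I" by (simp add: J_def)
      define q where "q = - L.D x + \<epsilon> / 2 * norm (L.z x) + norm (P x)"
      have nx: "norm x \<le> A' * q" using norm_le'[of x] x(3) by (simp add: q_def)
      moreover have "norm x > 0" using x by simp
      ultimately have "0 < A' * q" by linarith
      then have q: "q > 0" using A' by (simp add: zero_less_mult_iff)
      have "G j 0 \<bullet> x = \<kappa> j * (x \<bullet> v) + G j 0 \<bullet> L.z x + G j 0 \<bullet> P x"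
        using arg_cong[OF L.decomposition[of x], of "\<lambda>y. G j 0 \<bullet> y"]
        by (simp add: inner_add_right \<kappa>_def mult.commute)
      moreover have "G j 0 \<bullet> L.z x = - (\<kappa> j * N (L.z x))" using j(2) \<kappa>[OF j(1)] by simp
      moreover have "G j 0 \<bullet> P x \<le> \<kappa> j * (L * norm (P x))" using LJ[OF j(1), of "P x"] by linarith
      ultimately have "G j 0 \<bullet> x \<le> \<kappa> j * (x \<bullet> v - N (L.z x) + L * norm (P x))" by (simp add: algebra_simps)
      also have "x \<bullet> v - N (L.z x) + L * norm (P x) = - (q + L / \<kappa>0 * norm (P x))"
      proof -
        have "C * norm (P x) = L * norm (P x) + L / \<kappa>0 * norm (P x) + norm (P x)"
          by (simp add: C_def algebra_simps)
        then show ?thesis unfolding xv q_def by linarith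
      qed
      also have "\<kappa> j * - (q + L / \<kappa>0 * norm (P x)) \<le> - (\<kappa>0 * (q + L / \<kappa>0 * norm (P x)))"
        unfolding mult_minus_right neg_le_iff_le
        using \<kappa>0(2)[OF j(1)] q L \<kappa>0(1) by (intro mult_right_mono) auto
      also have "\<dots> = - (\<kappa>0 * q + L * norm (P x))" using \<kappa>0(1) by (simp add: field_simps)
      finally have 1: "G j 0 \<bullet> x \<le> - (\<kappa>0 * q + L * norm (P x))" .
      have "h j x \<le> G j 0 \<bullet> x + C1 * (norm x)\<^sup>2" using exp1[OF x(1) jI] by linarith
      moreover have "h i x \<ge> G i 0 \<bullet> x - C1 * (norm x)\<^sup>2" using exp1[OF x(1) i(1)] by linarith
      moreover have "G i 0 \<bullet> x = G i 0 \<bullet> P x" using orth[OF iK, of x] by (simp add: inner_diff_right)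
      moreover have "G i 0 \<bullet> P x \<ge> - (L * norm (P x))"
        using L1(2)[OF i(1), of "P x"] mult_right_mono[OF L(2) norm_ge_zero[of "P x"]] by linarith
      moreover have "h i x \<le> h j x" using i(2) f_le[OF jI small(1)[OF x(1)]] by simp
      ultimately have "\<kappa>0 * q \<le> 2 * C1 * (norm x)\<^sup>2" using 1 by linarith
      also have "\<dots> = 2 * C1 * norm x * norm x" by (simp add: power2_eq_square)
      also have "\<dots> \<le> 2 * C1 * norm x * (A' * q)" using nx C1(1) by (intro mult_left_mono) auto
      also have "\<dots> = (2 * C1 * norm x * A') * q" by simp
      also have "\<dots> < \<kappa>0 * q" using small1(2)[OF x(1)] q by (intro mult_strict_right_mono)
      finally show False by simp
    qed
    then have "i \<in> J" using i by (simp add: J_def)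
    then have "\<kappa>0 \<le> G i 0 \<bullet> v" using \<kappa>0(2) by (simp add: \<kappa>_def)
    moreover have "\<bar>(G i x - G i 0) \<bullet> v\<bar> \<le> C1 * norm x" using G_err[OF x(1) i(1), of v] by (simp add: v)
    ultimately show ?thesis using small1(3)[OF x(1)] by (simp add: inner_diff_left)
  qed
  \<comment> \<open>\<open>\<Omega> r2\<close> bounds three quantities by \<open>r2\<close>, and
    \<open>norm x\<close> is at most \<open>A\<close> times their sum.\<close>
  define r2 where "r2 = r1 / (3 * A)"
  have r2: "r2 > 0" using r1 A by (simp add: r2_def)
  have \<Omega>_ball: "norm x < r1" if "x \<in> L.\<Omega> r2" for x
  proof -
    have "\<bar>L.D x\<bar> + norm (L.z x) + norm (P x) < 3 * r2" using that by (simp add: L.\<Omega>_def)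
    then have "A * (\<bar>L.D x\<bar> + norm (L.z x) + norm (P x)) < A * (3 * r2)" using A by simp
    then show ?thesis using norm_le[of x] A by (simp add: r2_def)
  qed
  have inj: "inj_on (\<lambda>x. f x *\<^sub>R v + L.\<pi> x) (L.\<Omega> r2)"
  proof (rule L.leaf_coordinates_inj)
    fix x s assume xs: "x \<in> L.\<Omega> r2" "x + s *\<^sub>R v \<in> L.\<Omega> r2" "s > 0" "L.D (x + s *\<^sub>R v) \<le> 0"
    have "f (x + 0 *\<^sub>R v) < f (x + s *\<^sub>R v)"
    proof (rule increase_along_curve_germ[where V = "\<lambda>_. v", OF \<open>s > 0\<close>])
      show "((\<lambda>t. x + t *\<^sub>R v) has_vector_derivative v) (at t)" for t
        by (auto intro!: derivative_eq_intros)
      show "norm (x + t *\<^sub>R v) < R" if "0 \<le> t" "t \<le> s" for t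
        using L.line_in_\<Omega>[OF xs(1,2) that] \<Omega>_ball small(1) by blast
      fix i t assume i: "i \<in> I" and t: "0 \<le> t" "t < s" and act: "h i (x + t *\<^sub>R v) = f (x + t *\<^sub>R v)"
      have D: "L.D (x + t *\<^sub>R v) < 0" using t xs(4) by (simp add: L.D_add_v)
      have "L.D 0 = 0" by (simp add: L.D_def L.z_simps L.P_simps)
      then have "x + t *\<^sub>R v \<noteq> 0" using D by (metis less_irrefl)
      then show "G i (x + t *\<^sub>R v) \<bullet> v > 0"
        using L.line_in_\<Omega>[OF xs(1,2), of t] t \<Omega>_ball D i act by (intro line_pos) auto
    qed
    then show "f x < f (x + s *\<^sub>R v)" by simp
  next
    fix p s t assume nz: "L.z p + P p \<noteq> 0" and st: "L.leaf p s \<in> L.\<Omega> r2" "L.leaf p t \<in> L.\<Omega> r2" "0 \<le> s" "s < t"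
    show "f (L.leaf p s) < f (L.leaf p t)"
    proof (rule increase_along_curve_germ[OF \<open>s < t\<close> _ L.leaf_has_vector_derivative])
      show "norm (L.leaf p q) < R" if "s \<le> q" "q \<le> t" for q
        using L.leaf_in_\<Omega>[OF st(1,2,3) that] \<Omega>_ball small(1) by blast
      fix i q assume i: "i \<in> I" and q: "s \<le> q" "q < t" and act: "h i (L.leaf p q) = f (L.leaf p q)"
      have "L.leaf p q \<noteq> 0"
      proof
        assume "L.leaf p q = 0"
        then have "L.z (L.leaf p q) = 0" "P (L.leaf p q) = 0" by (simp_all add: L.z_simps L.P_simps)
        then show False using nz by (simp add: L.z_leaf L.P_leaf)
      qed
      then show "G i (L.leaf p q) \<bullet> (L.leaf p q - P (L.leaf p q) + L.\<rho> (L.leaf p q) *\<^sub>R v - \<delta> *\<^sub>R P (L.leaf p q)) > 0"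
        using L.leaf_in_\<Omega>[OF st(1,2,3), of q] q st(3) \<Omega>_ball i act by (intro curve_pos L.D_leaf_nonneg) auto
    qed
  next
    fix s t assume t: "t *\<^sub>R v \<in> L.\<Omega> r2" and st: "0 \<le> s" "s < t"
    have Dv: "L.D (q *\<^sub>R v) = q" for q by (simp add: L.D_def L.z_simps L.P_simps)
    have in\<Omega>: "q *\<^sub>R v \<in> L.\<Omega> r2" if "0 \<le> q" "q \<le> t" for q
      using that t by (simp add: L.\<Omega>_def Dv L.z_simps L.P_simps)
    \<comment> \<open>On the axis the field of the leaves is \<open>q *\<^sub>R v\<close>, whose
      positive factor can be divided out. It vanishes at \<open>0\<close>, so curves starting there
      are treated afterwards by a limit.\<close>
    have pos: "f (s *\<^sub>R v) < f (t' *\<^sub>R v)" if s: "0 < s" "s < t'" "t' \<le> t" for s t'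
    proof (rule increase_along_curve_germ[where V = "\<lambda>_. v", OF \<open>s < t'\<close>])
      show "((\<lambda>t. t *\<^sub>R v) has_vector_derivative v) (at t)" for t
        by (auto intro!: derivative_eq_intros)
      show "norm (q *\<^sub>R v) < R" if "s \<le> q" "q \<le> t'" for q
        using that s by (intro small(1) \<Omega>_ball in\<Omega>) auto
      fix i q assume i: "i \<in> I" and q: "s \<le> q" "q < t'" and act: "h i (q *\<^sub>R v) = f (q *\<^sub>R v)"
      have "v \<noteq> 0" using v by auto
      then have "G i (q *\<^sub>R v) \<bullet> (q *\<^sub>R v - P (q *\<^sub>R v) + L.\<rho> (q *\<^sub>R v) *\<^sub>R v - \<delta> *\<^sub>R P (q *\<^sub>R v)) > 0"
        using q s i act by (intro curve_pos \<Omega>_ball in\<Omega>) (auto simp: Dv)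
      then have "q * (G i (q *\<^sub>R v) \<bullet> v) > 0" by (simp add: L.\<rho>_def L.z_simps L.P_simps)
      then show "G i (q *\<^sub>R v) \<bullet> v > 0" using q s by (simp add: zero_less_mult_iff)
    qed
    show "f (s *\<^sub>R v) < f (t *\<^sub>R v)"
    proof (cases "s = 0")
      case False
      then show ?thesis using pos[of s t] st by simp
    next
      case True
      have "isCont f 0" using f_continuous R by (simp add: continuous_on_eq_continuous_at)
      moreover have "(\<lambda>n. (t / 2 * (1 / real (Suc n))) *\<^sub>R v) \<longlonglongrightarrow> 0"
        using tendsto_scaleR[OF tendsto_mult[OF tendsto_const LIMSEQ_Suc[OF lim_inverse_n']] tendsto_const, of "t / 2" v]
        by simp
      ultimately have "(\<lambda>n. f ((t / 2 * (1 / real (Suc n))) *\<^sub>R v)) \<longlonglongrightarrow> f 0"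
        by (rule isCont_tendsto_compose)
      then have "f 0 \<le> f ((t / 2) *\<^sub>R v)"
      proof (rule LIMSEQ_le_const2)
        have "f ((t / 2 * (1 / real (Suc n))) *\<^sub>R v) \<le> f ((t / 2) *\<^sub>R v)" if "n \<ge> 1" for n
          using pos[of "t / 2 * (1 / real (Suc n))" "t / 2"] st that by (simp add: field_simps)
        then show "\<exists>N. \<forall>n\<ge>N. f ((t / 2 * (1 / real (Suc n))) *\<^sub>R v) \<le> f ((t / 2) *\<^sub>R v)" by blast
      qed
      also have "\<dots> < f (t *\<^sub>R v)" using pos[of "t / 2" t] st by simp
      finally show ?thesis using True by simp
    qed
  qed
  define r where "r = min R (r2 / A)"
  have r: "r > 0" "r \<le> R" using r2 A R by (auto simp: r_def)
  have sub: "ball 0 r \<subseteq> L.\<Omega> r2"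
  proof
    fix x :: 'e assume "x \<in> ball 0 r"
    then have "norm x < r2 / A" by (simp add: r_def)
    then have Ax: "A * norm x < r2" using A by (simp add: field_simps)
    moreover have "norm x \<le> A * norm x" using mult_right_mono[OF A norm_ge_zero[of x]] by simp
    ultimately show "x \<in> L.\<Omega> r2" using D_abs[of x] L.component_bounds[of x] by (simp add: L.\<Omega>_def)
  qed
  show ?thesis
  proof (rule that[OF r])
    show "continuous_on (ball 0 r) (\<lambda>x. f x *\<^sub>R v + L.\<pi> x)"
      using r by (intro continuous_intros L.\<pi>_continuous continuous_on_subset[OF f_continuous]) auto
    show "inj_on (\<lambda>x. f x *\<^sub>R v + L.\<pi> x) (ball 0 r)" using inj sub by (rule inj_on_subset)
  qed (simp add: inner_add_left)
qed

end

section \<open>Orthonormal coordinates\<close>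

theorem (in convex_min_germ) topological_normal_form:
  obtains r and \<Theta> :: "'e \<Rightarrow> 'e"
  where "r > 0" "r \<le> R" "continuous_on (ball 0 r) \<Theta>" "inj_on \<Theta> (ball 0 r)"
    "(\<exists>v. norm v = 1 \<and> (\<forall>x\<in>ball 0 r. \<Theta> x \<bullet> v = f x)) \<or>
     (\<exists>P. linear P \<and> (\<forall>x. P (P x) = P x) \<and> (\<forall>x y. (x - P x) \<bullet> P y = 0) \<and> \<Theta> 0 = 0 \<and>
       (\<forall>x\<in>ball 0 r. f x = (norm (\<Theta> x - P (\<Theta> x)))\<^sup>2 - (norm (P (\<Theta> x)))\<^sup>2))"
proof -
  obtain K c v where K: "K \<subseteq> I" "\<And>i. i \<in> K \<Longrightarrow> c i > (0::real)" "(\<Sum>i\<in>K. c i *\<^sub>R G i 0) = 0"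
    and v: "\<And>i. i \<in> K \<Longrightarrow> G i 0 \<bullet> v = 0" "\<And>i. i \<in> I - K \<Longrightarrow> G i 0 \<bullet> v > 0"
    using positive_dependence_dichotomy[OF fin, of "\<lambda>i. G i 0"] by blast
  define W where "W = span ((\<lambda>i. G i 0) ` K)"
  have W: "subspace W" by (simp add: W_def)
  obtain P where P: "linear P" "\<And>x. P x \<in> W" "\<And>x y. y \<in> W \<Longrightarrow> (x - P x) \<bullet> y = 0"
    and pyth: "\<And>x. (norm x)\<^sup>2 = (norm (x - P x))\<^sup>2 + (norm (P x))\<^sup>2"
    using linear_projection_exists[OF W] by blast
  have idem: "P (P x) = P x" for x
    using P(3)[OF subspace_diff[OF W P(2)[of x] P(2)[of "P x"]], of "P x"] by simp
  have orth: "(x - P x) \<bullet> P y = 0" for x y using P(2,3) by blast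
  have G_W: "G i 0 \<in> W" if "i \<in> K" for i using that by (simp add: W_def span_base)
  have G_orth: "G i 0 \<bullet> (x - P x) = 0" if "i \<in> K" for i x
    using P(3)[OF G_W[OF that], of x] by (simp add: inner_commute)
  \<comment> \<open>If \<open>K\<close> is empty the decay condition is vacuous, and any
    \<open>b\<close> serves.\<close>
  have "\<exists>b>0. \<forall>x. K \<noteq> {} \<longrightarrow> (\<exists>i\<in>K. G i 0 \<bullet> P x \<le> - b * norm (P x))"
  proof (cases "K = {}")
    case False
    have "finite K" using K(1) fin finite_subset by blast
    then obtain b where "b > 0" "\<And>w. w \<in> W \<Longrightarrow> \<exists>i\<in>K. G i 0 \<bullet> w \<le> - b * norm w"
      using min_inner_decay[of K c "\<lambda>i. G i 0"] False K unfolding W_def by blast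
    then show ?thesis using P(2) by blast
  qed (auto intro: exI[of _ 1])
  then obtain b where b: "b > 0" "\<And>x. K \<noteq> {} \<Longrightarrow> \<exists>i\<in>K. G i 0 \<bullet> P x \<le> - b * norm (P x)" by blast
  show ?thesis
  proof (cases "K = I")
    case True
    then have "\<exists>i\<in>I. G i 0 \<bullet> P x \<le> - b * norm (P x)" for x using b(2) I_nonempty by blast
    then obtain r \<Theta> where r: "r > 0" "r \<le> R" and \<Theta>: "continuous_on (ball 0 r) \<Theta>" "inj_on \<Theta> (ball 0 r)" "\<Theta> 0 = 0"
      "\<And>x. norm x < r \<Longrightarrow> f x = (norm (\<Theta> x - P (\<Theta> x)))\<^sup>2 - (norm (P (\<Theta> x)))\<^sup>2"
      using critical_normal_form[OF P(1) pyth idem _ b(1)] G_orth True by blast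
    show ?thesis
      by (rule that[OF r \<Theta>(1,2)]) (use P(1) idem orth \<Theta>(3,4) in auto)
  next
    case False
    then obtain j where "j \<in> I - K" using K(1) by blast
    then have "v \<noteq> 0" using v(2) by fastforce
    define v' where "v' = v /\<^sub>R norm v"
    have v': "norm v' = 1" using \<open>v \<noteq> 0\<close> by (simp add: v'_def)
    \<comment> \<open>\<open>v\<close> annihilates the gradients spanning \<open>W\<close>, hence is
      orthogonal to \<open>W\<close> and lies in the kernel of \<open>P\<close>.\<close>
    have W_v: "y \<bullet> v = 0" if "y \<in> W" for y
      using that unfolding W_def
      by (induction rule: span_induct) (auto simp: subspace_def inner_add_left v(1))
    have "P v \<bullet> P v = P v \<bullet> v - (v - P v) \<bullet> P v" by (simp add: inner_diff_left inner_diff_right inner_commute)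
    then have "P v = 0" using orth[of v v] W_v[OF P(2)] by simp
    then have "P v' = 0" by (simp add: v'_def linear_scale[OF P(1)])
    moreover have "G j 0 \<bullet> v' > 0" if "j \<in> I - K" for j
      using v(2)[OF that] \<open>v \<noteq> 0\<close> by (simp add: v'_def)
    ultimately obtain r \<Theta> where r: "r > 0" "r \<le> R" and \<Theta>: "continuous_on (ball 0 r) \<Theta>" "inj_on \<Theta> (ball 0 r)"
      "\<And>x. norm x < r \<Longrightarrow> \<Theta> x \<bullet> v' = f x"
      using regular_normal_form[OF P(1) idem orth pyth K(1) False G_orth b v'] by blast
    show ?thesis
      by (rule that[OF r \<Theta>(1,2)]) (use v' \<Theta>(3) in auto)
  qed
qed

section \<open>Orthonormal frames numbered by natural numbers\<close>

definition orthonormal_frame :: "(nat \<Rightarrow> 'e::euclidean_space) \<Rightarrow> bool" where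
  "orthonormal_frame b \<longleftrightarrow> (\<forall>i<DIM('e). \<forall>j<DIM('e). b i \<bullet> b j = (if i = j then 1 else 0))"

text \<open>Coordinates are set to zero from \<open>DIM('e)\<close> on, so that the values are
  points of \<open>Euclidean_space\<close>.\<close>

definition frame_coordinates :: "(nat \<Rightarrow> 'e::euclidean_space) \<Rightarrow> 'e \<Rightarrow> nat \<Rightarrow> real" where
  "frame_coordinates b x i = (if i < DIM('e) then x \<bullet> b i else 0)"

lemma orthonormal_frame_expansion:
  fixes b :: "nat \<Rightarrow> 'e::euclidean_space"
  assumes "orthonormal_frame b"
  shows "(\<Sum>i<DIM('e). (x \<bullet> b i) *\<^sub>R b i) = x"
proof -
  let ?n = "DIM('e)"
  define S where "S = b ` {..<?n}"
  have b: "b i \<bullet> b j = (if i = j then 1 else 0)" if "i < ?n" "j < ?n" for i j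
    using assms that by (auto simp: orthonormal_frame_def)
  have inj: "inj_on b {..<?n}"
  proof (rule inj_onI)
    fix i j assume "i \<in> {..<?n}" "j \<in> {..<?n}" "b i = b j"
    then show "i = j" using b[of i j] b[of j j] by (auto split: if_splits)
  qed
  have "pairwise orthogonal S" by (auto simp: S_def pairwise_def orthogonal_def b)
  moreover have "0 \<notin> S"
  proof
    assume "0 \<in> S"
    then obtain i where "i < ?n" "b i = 0" by (auto simp: S_def)
    then show False using b[of i i] by simp
  qed
  ultimately have "independent S" by (rule pairwise_orthogonal_independent)
  moreover have "card S = dim (UNIV :: 'e set)" using inj by (simp add: S_def card_image)
  ultimately have "UNIV \<subseteq> span S" using card_eq_dim[of S UNIV] by (simp add: S_def)
  define y where "y = x - (\<Sum>i<?n. (x \<bullet> b i) *\<^sub>R b i)"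
  have "b j \<bullet> y = 0" if "j < ?n" for j
  proof -
    have "(\<Sum>i<?n. (x \<bullet> b i) *\<^sub>R b i) \<bullet> b j = (\<Sum>i<?n. if i = j then x \<bullet> b i else 0)"
      unfolding inner_sum_left using that by (intro sum.cong) (auto simp: b)
    then show ?thesis using that by (simp add: y_def inner_diff_right inner_commute)
  qed
  then have "orthogonal y s" if "s \<in> S" for s using that by (auto simp: S_def orthogonal_def inner_commute)
  then have "orthogonal y y" using \<open>UNIV \<subseteq> span S\<close> orthogonal_to_span[of y S y] by auto
  then show ?thesis by (simp add: y_def orthogonal_def)
qed

lemma orthonormal_frame_norm:
  fixes b :: "nat \<Rightarrow> 'e::euclidean_space"
  assumes "orthonormal_frame b"
  shows "(norm x)\<^sup>2 = (\<Sum>i<DIM('e). (x \<bullet> b i)\<^sup>2)"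
proof -
  have "(norm x)\<^sup>2 = (\<Sum>i<DIM('e). (x \<bullet> b i) *\<^sub>R b i) \<bullet> x"
    unfolding orthonormal_frame_expansion[OF assms] by (rule power2_norm_eq_inner)
  also have "\<dots> = (\<Sum>i<DIM('e). (x \<bullet> b i)\<^sup>2)"
    unfolding inner_sum_left by (simp add: power2_eq_square inner_commute)
  finally show ?thesis .
qed

lemma homeomorphic_map_frame_coordinates:
  fixes b :: "nat \<Rightarrow> 'e::euclidean_space"
  assumes b: "orthonormal_frame b"
  shows "homeomorphic_map euclidean (Euclidean_space DIM('e)) (frame_coordinates b)"
proof -
  let ?n = "DIM('e)"
  define g where "g y = (\<Sum>i<?n. y i *\<^sub>R b i)" for y :: "nat \<Rightarrow> real"
  have gf: "g (frame_coordinates b x) = x" for x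
    using orthonormal_frame_expansion[OF b, of x] by (simp add: g_def frame_coordinates_def)
  have fg: "frame_coordinates b (g y) = y" if "y \<in> topspace (Euclidean_space ?n)" for y
  proof
    fix j
    show "frame_coordinates b (g y) j = y j"
    proof (cases "j < ?n")
      case True
      have "g y \<bullet> b j = (\<Sum>i<?n. if i = j then y i else 0)"
        unfolding g_def inner_sum_left using True b by (intro sum.cong) (auto simp: orthonormal_frame_def)
      then show ?thesis using True by (simp add: frame_coordinates_def)
    next
      case False
      then show ?thesis using that by (simp add: frame_coordinates_def topspace_Euclidean_space)
    qed
  qed
  have "continuous_map euclidean (Euclidean_space ?n) (\<lambda>x i. if i < ?n then x \<bullet> b i else 0)"
    unfolding continuous_map_componentwise_Euclidean_space by (auto intro!: continuous_intros)
  then have cf: "continuous_map euclidean (Euclidean_space ?n) (frame_coordinates b)"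
    by (simp add: frame_coordinates_def[abs_def])
  have cg: "continuous_map (Euclidean_space ?n) euclidean g"
    unfolding continuous_map_Euclidean_space_iff g_def
    by (intro continuous_intros continuous_on_subset[OF continuous_on_product_coordinates]) auto
  have "homeomorphic_maps euclidean (Euclidean_space ?n) (frame_coordinates b) g"
    unfolding homeomorphic_maps_def using cf cg fg gf by auto
  then show ?thesis by (auto simp: homeomorphic_map_maps)
qed

text \<open>The normal form at a critical point lists positive squares before negative ones, so the
  numbering has to start with a prescribed part of the basis.\<close>

lemma orthonormal_frame_enumeration:
  fixes A B :: "'e::euclidean_space set"
  assumes "finite A" "finite B" "A \<inter> B = {}" "pairwise orthogonal (A \<union> B)" "\<And>x. x \<in> A \<union> B \<Longrightarrow> norm x = 1"
    and card: "card A + card B = DIM('e)"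
  obtains b where "orthonormal_frame b" "\<And>i. i < card A \<Longrightarrow> b i \<in> A"
    "\<And>i. card A \<le> i \<Longrightarrow> i < DIM('e) \<Longrightarrow> b i \<in> B"
proof -
  obtain p where p: "bij_betw p {0..<card A} A" using ex_bij_betw_nat_finite[OF assms(1)] by blast
  obtain q where q: "bij_betw q {0..<card B} B" using ex_bij_betw_nat_finite[OF assms(2)] by blast
  define b where "b i = (if i < card A then p i else q (i - card A))" for i
  have bA: "b i \<in> A" if "i < card A" for i
    using that p by (auto simp: b_def bij_betw_def)
  have bB: "b i \<in> B" if "card A \<le> i" "i < DIM('e)" for i
    using that q card by (auto simp: b_def bij_betw_def)
  have inj: "i = j" if "i < DIM('e)" "j < DIM('e)" "b i = b j" for i j
  proof (cases "i < card A")
    case True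
    then have "j < card A" using bA[of i] bB[of j] that assms(3) by (metis disjoint_iff not_le)
    then show ?thesis using True that(3) p by (auto simp: b_def bij_betw_def inj_on_def)
  next
    case False
    then have j: "\<not> j < card A" using bA[of j] bB[of i] that assms(3) by (metis disjoint_iff not_le)
    then have "i - card A = j - card A" using False that q card by (auto simp: b_def bij_betw_def inj_on_def)
    then show ?thesis using False j by simp
  qed
  have mem: "b i \<in> A \<union> B" if "i < DIM('e)" for i using bA[of i] bB[of i] that by (cases "i < card A") auto
  have "b i \<bullet> b j = (if i = j then 1 else 0)" if "i < DIM('e)" "j < DIM('e)" for i j
  proof (cases "i = j")
    case True
    then show ?thesis using assms(5)[OF mem[OF that(1)]] by (simp add: norm_eq_1)
  next
    case False
    then have "orthogonal (b i) (b j)" using assms(4) mem[OF that(1)] mem[OF that(2)] inj[OF that] by (auto simp: pairwise_def)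
    then show ?thesis using False by (simp add: orthogonal_def)
  qed
  then have "orthonormal_frame b" by (simp add: orthonormal_frame_def)
  then show ?thesis using bA bB by (rule that)
qed

lemma orthonormal_frame_with_first:
  fixes v :: "'e::euclidean_space"
  assumes "norm v = 1"
  obtains b where "orthonormal_frame b" "b 0 = v"
proof -
  obtain S where S: "v \<in> S" "pairwise orthogonal S" "\<And>x. x \<in> S \<Longrightarrow> norm x = 1" "independent S" "card S = DIM('e)"
    using vector_in_orthonormal_basis[OF assms] by metis
  have fS: "finite S" using S(4) by (rule independent_imp_finite)
  have Sv: "insert v (S - {v}) = S" using S(1) by auto
  have "card {v} + card (S - {v}) = DIM('e)" using S(1,5) fS by (simp add: card_Diff_singleton)
  then show ?thesis
  proof (rule orthonormal_frame_enumeration[of "{v}" "S - {v}", rotated 5])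
    fix b :: "nat \<Rightarrow> 'e" assume "orthonormal_frame b" "\<And>i. i < card {v} \<Longrightarrow> b i \<in> {v}"
    then show ?thesis using that by auto
  qed (use S fS Sv in auto)
qed

text \<open>\<open>P\<close> is an orthogonal projection, so orthonormal bases of its kernel and
  range together form one of the whole space. The witness for \<open>k\<close> is the dimension of
  the kernel.\<close>

lemma orthonormal_frame_adapted:
  fixes P :: "'e::euclidean_space \<Rightarrow> 'e"
  assumes lin: "linear P" and idem: "\<And>x. P (P x) = P x" and orth: "\<And>x y. (x - P x) \<bullet> P y = 0"
  obtains b k where "orthonormal_frame b" "k \<le> DIM('e)" "\<And>i. i < k \<Longrightarrow> P (b i) = 0"
    "\<And>i. k \<le> i \<Longrightarrow> i < DIM('e) \<Longrightarrow> P (b i) = b i"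
proof -
  define U where "U = {x. P x = 0}"
  define W where "W = range P"
  have sU: "subspace U" 
    by (rule subspaceI) (simp_all add: U_def linear_0[OF lin] linear_add[OF lin] linear_scale[OF lin])
  have sW: "subspace W" unfolding W_def using linear_subspace_image[OF lin subspace_UNIV] .
  obtain A where A: "A \<subseteq> U" "pairwise orthogonal A" "\<And>x. x \<in> A \<Longrightarrow> norm x = 1" "independent A" "span A = U"
    using orthonormal_basis_subspace[OF sU] by metis
  obtain B where B: "B \<subseteq> W" "pairwise orthogonal B" "\<And>x. x \<in> B \<Longrightarrow> norm x = 1" "independent B" "span B = W"
    using orthonormal_basis_subspace[OF sW] by metis
  have fAB: "finite A" "finite B" using A B independent_imp_finite by auto
  have UW: "x \<bullet> y = 0" if "x \<in> U" "y \<in> W" for x y using that orth[of x] by (auto simp: U_def W_def)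
  have disj: "A \<inter> B = {}"
  proof -
    have False if "x \<in> A" "x \<in> B" for x
      using UW[of x x] that A(1,3) B(1) by force
    then show ?thesis by blast
  qed
  have orthAB: "pairwise orthogonal (A \<union> B)"
  proof -
    have "x \<bullet> y = 0" "y \<bullet> x = 0" if "x \<in> A" "y \<in> B" for x y
      using UW[of x y] that A(1) B(1) by (auto simp: inner_commute)
    then show ?thesis using A(2) B(2) by (auto simp: pairwise_def orthogonal_def)
  qed
  have nAB: "norm x = 1" if "x \<in> A \<union> B" for x using that A B by auto
  have "independent (A \<union> B)"
    using orthAB nAB by (intro pairwise_orthogonal_independent) force+
  moreover have "span (A \<union> B) = UNIV"
  proof -
    have "x \<in> span (A \<union> B)" for x
    proof -
      have "x - P x \<in> U" "P x \<in> W" by (simp_all add: U_def W_def linear_diff[OF lin] idem)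
      then have "(x - P x) + P x \<in> span (A \<union> B)"
        using A(5) B(5) span_mono[of A "A \<union> B"] span_mono[of B "A \<union> B"] by (intro span_add) auto
      then show ?thesis by simp
    qed
    then show ?thesis by blast
  qed
  ultimately have "card (A \<union> B) = DIM('e)" using dim_eq_card[of "A \<union> B" UNIV] by simp
  then have card: "card A + card B = DIM('e)" using fAB disj by (simp add: card_Un_disjoint)
  obtain b where b: "orthonormal_frame b" "\<And>i. i < card A \<Longrightarrow> b i \<in> A" "\<And>i. card A \<le> i \<Longrightarrow> i < DIM('e) \<Longrightarrow> b i \<in> B"
    using orthonormal_frame_enumeration[OF fAB disj orthAB nAB card] by blast
  show ?thesis
  proof (rule that[OF b(1), of "card A"])
    show "card A \<le> DIM('e)" using card by simp
    show "P (b i) = 0" if "i < card A" for i using b(2)[OF that] A(1) by (auto simp: U_def)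
    show "P (b i) = b i" if "card A \<le> i" "i < DIM('e)" for i using b(3)[OF that] B(1) idem by (auto simp: W_def)
  qed
qed

lemma adapted_frame_norms:
  fixes P :: "'e::euclidean_space \<Rightarrow> 'e"
  assumes lin: "linear P" and orth: "\<And>x y. (x - P x) \<bullet> P y = 0"
    and b: "orthonormal_frame b" "k \<le> DIM('e)" "\<And>i. i < k \<Longrightarrow> P (b i) = 0"
    "\<And>i. k \<le> i \<Longrightarrow> i < DIM('e) \<Longrightarrow> P (b i) = b i"
  shows "(norm (x - P x))\<^sup>2 = (\<Sum>i<k. (x \<bullet> b i)\<^sup>2)" "(norm (P x))\<^sup>2 = (\<Sum>i\<in>{k..<DIM('e)}. (x \<bullet> b i)\<^sup>2)"
proof -
  have low: "P x \<bullet> b i = 0" if "i < k" for i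
    using orth[of "b i" x] b(3)[OF that] by (simp add: inner_commute)
  have high: "(x - P x) \<bullet> b i = 0" if "k \<le> i" "i < DIM('e)" for i
    using orth[of x "b i"] b(4)[OF that] by simp
  have "(norm (x - P x))\<^sup>2 = (\<Sum>i<DIM('e). ((x - P x) \<bullet> b i)\<^sup>2)" by (rule orthonormal_frame_norm[OF b(1)])
  also have "\<dots> = (\<Sum>i<k. ((x - P x) \<bullet> b i)\<^sup>2)"
    using b(2) high by (intro sum.mono_neutral_right) auto
  also have "\<dots> = (\<Sum>i<k. (x \<bullet> b i)\<^sup>2)" using low by (intro sum.cong) (auto simp: inner_diff_left)
  finally show "(norm (x - P x))\<^sup>2 = (\<Sum>i<k. (x \<bullet> b i)\<^sup>2)" .
  have "(norm (P x))\<^sup>2 = (\<Sum>i<DIM('e). (P x \<bullet> b i)\<^sup>2)" by (rule orthonormal_frame_norm[OF b(1)])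
  also have "\<dots> = (\<Sum>i\<in>{k..<DIM('e)}. (P x \<bullet> b i)\<^sup>2)"
    using low by (intro sum.mono_neutral_right) auto
  also have "\<dots> = (\<Sum>i\<in>{k..<DIM('e)}. (x \<bullet> b i)\<^sup>2)" using high by (intro sum.cong) (auto simp: inner_diff_left)
  finally show "(norm (P x))\<^sup>2 = (\<Sum>i\<in>{k..<DIM('e)}. (x \<bullet> b i)\<^sup>2)" .
qed

section \<open>Passage to charts\<close>

text \<open>The substitution \<open>x \<mapsto> x0 + x - 1/2 *\<^sub>R \<Gamma> x x\<close> turns the second derivative corrected by \<open>\<Gamma>\<close>
  into an ordinary second derivative at \<open>x0\<close>, simultaneously for all functions, as in normal coordinates.\<close>

lemma covariant_min_normal_form:
  fixes h :: "'i \<Rightarrow> 'e::euclidean_space \<Rightarrow> real" and g H :: "'i \<Rightarrow> 'e \<Rightarrow> 'e" and \<Gamma> :: "'e \<Rightarrow> 'e \<Rightarrow> 'e"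
  assumes S: "open S" "x0 \<in> S" and fin: "finite I"
    and h: "\<And>i y. i \<in> I \<Longrightarrow> y \<in> S \<Longrightarrow> (h i has_derivative (\<lambda>v. g i y \<bullet> v)) (at y)"
    and g: "\<And>i. i \<in> I \<Longrightarrow> (g i has_derivative H i) (at x0)"
    and \<Gamma>: "bounded_bilinear \<Gamma>"
    and pos: "\<And>i v. i \<in> I \<Longrightarrow> v \<noteq> 0 \<Longrightarrow> H i v \<bullet> v - g i x0 \<bullet> \<Gamma> v v > 0"
    and base: "\<And>i. i \<in> I \<Longrightarrow> h i x0 = c"
    and le: "\<And>i y. i \<in> I \<Longrightarrow> y \<in> S \<Longrightarrow> f y \<le> h i y"
    and att: "\<And>y. y \<in> S \<Longrightarrow> \<exists>i\<in>I. f y = h i y"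
  obtains O' and \<Theta> :: "'e \<Rightarrow> 'e" where "open O'" "x0 \<in> O'" "O' \<subseteq> S" "continuous_on O' \<Theta>" "inj_on \<Theta> O'"
    "(\<exists>v. norm v = 1 \<and> (\<forall>y\<in>O'. \<Theta> y \<bullet> v = f y)) \<or>
     (\<exists>P. linear P \<and> (\<forall>x. P (P x) = P x) \<and> (\<forall>x y. (x - P x) \<bullet> P y = 0) \<and> \<Theta> x0 = 0 \<and>
       (\<forall>y\<in>O'. f y - c = (norm (\<Theta> y - P (\<Theta> y)))\<^sup>2 - (norm (P (\<Theta> y)))\<^sup>2))"
proof -
  interpret \<Gamma>: bounded_bilinear \<Gamma> by (rule \<Gamma>)
  obtain K where K: "K > 0" "\<And>x y. norm (\<Gamma> x y) \<le> norm x * norm y * K" using \<Gamma>.pos_bounded by blast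
  define \<psi> where "\<psi> x = x0 + x - (1/2) *\<^sub>R \<Gamma> x x" for x
  \<comment> \<open>The derivative of \<open>(1/2) *\<^sub>R \<Gamma> x x\<close> is the
    symmetrisation of \<open>\<Gamma>\<close>, which agrees with \<open>\<Gamma>\<close> on the
    diagonal, where positivity is tested.\<close>
  define \<Delta> where "\<Delta> x w = (1/2) *\<^sub>R (\<Gamma> x w + \<Gamma> w x)" for x w
  have \<psi>': "(\<psi> has_derivative (\<lambda>w. w - \<Delta> x w)) (at x)" for x
    unfolding \<psi>_def \<Delta>_def by (auto intro!: derivative_eq_intros \<Gamma>.FDERIV)
  have \<psi>0: "\<psi> 0 = x0" by (simp add: \<psi>_def \<Gamma>.zero_left)
  have \<psi>_cont: "continuous_on T \<psi>" for T
    using \<psi>' has_derivative_continuous by (blast intro: continuous_at_imp_continuous_on)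
  have \<Delta>_lin: "linear (\<Delta> x)" for x
    unfolding \<Delta>_def by (rule linearI) (simp_all add: \<Gamma>.add_left \<Gamma>.add_right \<Gamma>.scaleR_left \<Gamma>.scaleR_right algebra_simps)
  have \<Delta>0: "\<Delta> 0 w = 0" for w by (simp add: \<Delta>_def \<Gamma>.zero_left \<Gamma>.zero_right)
  have \<Delta>_deriv: "((\<lambda>x. \<Delta> x w) has_derivative (\<lambda>x. \<Delta> x w)) (at x)" for x w
  proof -
    have "bounded_linear (\<lambda>x. \<Delta> x w)"
      unfolding \<Delta>_def
      by (intro bounded_linear_compose[OF bounded_linear_scaleR_right] bounded_linear_add
          \<Gamma>.bounded_linear_left \<Gamma>.bounded_linear_right)
    then show ?thesis by (rule bounded_linear_imp_has_derivative)
  qed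
  have "open (\<psi> -` S)" using S(1) \<psi>_cont by (rule open_vimage)
  then obtain R0 where "R0 > 0" "ball 0 R0 \<subseteq> \<psi> -` S" using S(2) \<psi>0 by (metis openE vimageI2)
  then have R0: "R0 > 0" "\<And>x. norm x < R0 \<Longrightarrow> \<psi> x \<in> S" by auto
  \<comment> \<open>On the ball of radius \<open>1 / K\<close> the quadratic part of
    \<open>\<psi>\<close> strictly decreases distances of distinct points, so \<open>\<psi>\<close>
    is injective there.\<close>
  define R where "R = min R0 (1 / K)"
  have R: "R > 0" "R \<le> R0" "R * K \<le> 1" using R0 K by (auto simp: R_def min_def field_simps)
  have \<psi>_inj: "inj_on \<psi> (ball 0 R)"
  proof (rule inj_onI, rule ccontr)
    fix x y assume xy: "x \<in> ball 0 R" "y \<in> ball 0 R" "\<psi> x = \<psi> y" "x \<noteq> y"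
    have "x - y = (1/2) *\<^sub>R (\<Gamma> x x - \<Gamma> y y)" using xy(3) by (simp add: \<psi>_def algebra_simps)
    also have "\<Gamma> x x - \<Gamma> y y = \<Gamma> x (x - y) + \<Gamma> (x - y) y" by (simp add: \<Gamma>.diff_left \<Gamma>.diff_right)
    finally have "norm (x - y) = norm ((1/2) *\<^sub>R (\<Gamma> x (x - y) + \<Gamma> (x - y) y))" by (rule arg_cong)
    also have "\<dots> = (1/2) * norm (\<Gamma> x (x - y) + \<Gamma> (x - y) y)" by simp
    also have "\<dots> \<le> (1/2) * (norm x * norm (x - y) * K + norm (x - y) * norm y * K)"
      using norm_triangle_le[OF add_mono[OF K(2)[of x "x - y"] K(2)[of "x - y" y]]] by simp
    also have "\<dots> = norm (x - y) * (1/2 * (norm x + norm y) * K)" by (simp add: algebra_simps)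
    also have "\<dots> < norm (x - y) * 1"
    proof (rule mult_strict_left_mono)
      have "1/2 * (norm x + norm y) < R" using xy by simp
      then have "1/2 * (norm x + norm y) * K < R * K" using K(1) by (rule mult_strict_right_mono)
      then show "1/2 * (norm x + norm y) * K < 1" using R(3) by linarith
    qed (use xy in simp)
    finally show False by simp
  qed
  \<comment> \<open>\<open>G i x\<close> is the adjoint of the derivative of \<open>\<psi>\<close>
    applied to the gradient of \<open>h i\<close>, written in a basis. The term with
    \<open>\<Delta>\<close> in \<open>Q\<close> comes from differentiating that adjoint at
    \<open>0\<close>.\<close>
  define G where "G i x = (\<Sum>e\<in>Basis. (g i (\<psi> x) \<bullet> (e - \<Delta> x e)) *\<^sub>R e)" for i x
  define Q where "Q i w = (\<Sum>e\<in>Basis. (H i w \<bullet> e - g i x0 \<bullet> \<Delta> w e) *\<^sub>R e)" for i w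
  have basis_sum: "(\<Sum>e\<in>Basis. l e *\<^sub>R e) \<bullet> v = l v" if "linear l" for l :: "'e \<Rightarrow> real" and v
  proof -
    have "(\<Sum>e\<in>Basis. l e *\<^sub>R e) \<bullet> v = (\<Sum>e\<in>Basis. (v \<bullet> e) *\<^sub>R l e)"
      unfolding inner_sum_left by (simp add: inner_commute mult.commute)
    also have "\<dots> = l (\<Sum>e\<in>Basis. (v \<bullet> e) *\<^sub>R e)"
      using that by (simp add: linear_sum linear_scale)
    finally show ?thesis by (simp add: euclidean_representation)
  qed
  have G_inner: "G i x \<bullet> v = g i (\<psi> x) \<bullet> (v - \<Delta> x v)" for i x v
    unfolding G_def
    by (rule basis_sum) (auto intro!: linearI simp: linear_add[OF \<Delta>_lin] linear_scale[OF \<Delta>_lin] inner_add_right inner_diff_right algebra_simps)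
  have Q_inner: "Q i w \<bullet> v = H i w \<bullet> v - g i x0 \<bullet> \<Delta> w v" for i w v
    unfolding Q_def
    by (rule basis_sum) (auto intro!: linearI simp: linear_add[OF \<Delta>_lin] linear_scale[OF \<Delta>_lin] inner_add_right inner_diff_right algebra_simps)
  interpret germ: convex_min_germ I "\<lambda>i x. h i (\<psi> x) - c" G Q "\<lambda>x. f (\<psi> x) - c" R
  proof
    show "finite I" "R > 0" by fact+
    fix i x assume i: "i \<in> I"
    show "h i (\<psi> 0) - c = 0" using base[OF i] by (simp add: \<psi>0)
    show "Q i x \<bullet> x > 0" if "x \<noteq> 0"
    proof -
      have "\<Delta> x x = \<Gamma> x x" by (simp add: \<Delta>_def flip: scaleR_2)
      then show ?thesis using pos[OF i that] by (simp add: Q_inner)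
    qed
    show "((\<lambda>x. h i (\<psi> x) - c) has_derivative (\<lambda>v. G i x \<bullet> v)) (at x)" if "norm x < R"
      unfolding G_inner
      using has_derivative_compose[OF \<psi>' h[OF i R0(2)[of x]]] that R
      by (intro derivative_eq_intros) auto
    show "(G i has_derivative Q i) (at 0)"
    proof -
      have "((\<lambda>x. g i (\<psi> x)) has_derivative (\<lambda>w. H i (w - \<Delta> 0 w))) (at 0)"
        using has_derivative_compose[OF \<psi>'[of 0], of "g i" "H i"] g[OF i] by (simp add: \<psi>0)
      then have "((\<lambda>x. g i (\<psi> x)) has_derivative H i) (at 0)"
        by (simp add: \<Delta>_def \<Gamma>.zero_left \<Gamma>.zero_right)
      then have "((\<lambda>x. g i (\<psi> x) \<bullet> (e - \<Delta> x e)) has_derivative (\<lambda>w. H i w \<bullet> e - g i x0 \<bullet> \<Delta> w e)) (at 0)" for e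
        by (auto intro!: derivative_eq_intros \<Delta>_deriv simp: \<psi>0 linear_0[OF \<Delta>_lin] \<Delta>0)
      then show ?thesis unfolding G_def[abs_def] Q_def[abs_def]
        by (auto intro!: has_derivative_sum has_derivative_scaleR_left)
    qed
    show "f (\<psi> x) - c \<le> h i (\<psi> x) - c" if "norm x < R"
      using le[OF i R0(2)[of x]] that R by simp
  next
    fix x :: 'e assume "norm x < R"
    then show "\<exists>i\<in>I. f (\<psi> x) - c = h i (\<psi> x) - c" using att[OF R0(2)[of x]] R by auto
  qed
  obtain r and \<Theta> :: "'e \<Rightarrow> 'e" where r: "r > 0" "r \<le> R" and \<Theta>: "continuous_on (ball 0 r) \<Theta>" "inj_on \<Theta> (ball 0 r)"
    and alt: "(\<exists>v. norm v = 1 \<and> (\<forall>x\<in>ball 0 r. \<Theta> x \<bullet> v = f (\<psi> x) - c)) \<or>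
     (\<exists>P. linear P \<and> (\<forall>x. P (P x) = P x) \<and> (\<forall>x y. (x - P x) \<bullet> P y = 0) \<and> \<Theta> 0 = 0 \<and>
       (\<forall>x\<in>ball 0 r. f (\<psi> x) - c = (norm (\<Theta> x - P (\<Theta> x)))\<^sup>2 - (norm (P (\<Theta> x)))\<^sup>2))"
    by (rule germ.topological_normal_form)
  define O' where "O' = \<psi> ` ball 0 r"
  have inj_r: "inj_on \<psi> (ball 0 r)" using \<psi>_inj by (rule inj_on_subset) (use r in auto)
  have op: "open O'" unfolding O'_def by (rule invariance_of_domain[OF \<psi>_cont open_ball inj_r])
  obtain \<phi> where \<phi>: "homeomorphism (ball 0 r) O' \<psi> \<phi>"
    unfolding O'_def using invariance_of_domain_homeomorphism[OF open_ball \<psi>_cont order_refl inj_r] by blast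
  have \<phi>_in: "\<phi> y \<in> ball 0 r" and \<psi>\<phi>: "\<psi> (\<phi> y) = y" if "y \<in> O'" for y
    using \<phi> that by (auto simp: homeomorphism_def)
  have x0: "x0 \<in> O'" unfolding O'_def using r \<psi>0 by (intro image_eqI[of _ _ 0]) auto
  have \<phi>0: "\<phi> x0 = 0" using \<phi> r \<psi>0 by (metis homeomorphism_apply1 centre_in_ball)
  have "O' \<subseteq> S" unfolding O'_def using R0(2) r R by auto
  moreover have "continuous_on O' (\<lambda>y. \<Theta> (\<phi> y))"
    using \<phi> \<Theta>(1) by (intro continuous_on_compose2[OF \<Theta>(1)]) (auto simp: homeomorphism_def)
  moreover have "inj_on (\<lambda>y. \<Theta> (\<phi> y)) O'"
    by (rule inj_onI) (metis \<Theta>(2) \<phi>_in \<psi>\<phi> inj_onD)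
  \<comment> \<open>The germ was normalised to the value \<open>0\<close>; the translation by
    \<open>c *\<^sub>R v\<close> turns the coordinate \<open>f - c\<close> of the regular case back
    into \<open>f\<close>.\<close>
  moreover have "continuous_on O' (\<lambda>y. \<Theta> (\<phi> y) + c *\<^sub>R v)" "inj_on (\<lambda>y. \<Theta> (\<phi> y) + c *\<^sub>R v) O'" for v
    using calculation(2,3) by (auto intro!: continuous_intros simp: inj_on_def)
  ultimately have sub: "O' \<subseteq> S" and cont: "\<And>v. continuous_on O' (\<lambda>y. \<Theta> (\<phi> y) + c *\<^sub>R v)" "continuous_on O' (\<lambda>y. \<Theta> (\<phi> y))"
    and inj: "\<And>v. inj_on (\<lambda>y. \<Theta> (\<phi> y) + c *\<^sub>R v) O'" "inj_on (\<lambda>y. \<Theta> (\<phi> y)) O'" by auto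
  from alt show ?thesis
  proof
    assume "\<exists>v. norm v = 1 \<and> (\<forall>x\<in>ball 0 r. \<Theta> x \<bullet> v = f (\<psi> x) - c)"
    then obtain v where v: "norm v = 1" "\<And>x. x \<in> ball 0 r \<Longrightarrow> \<Theta> x \<bullet> v = f (\<psi> x) - c" by blast
    have "(\<Theta> (\<phi> y) + c *\<^sub>R v) \<bullet> v = f y" if "y \<in> O'" for y
      using v(2)[OF \<phi>_in[OF that]] v(1) \<psi>\<phi>[OF that] by (simp add: inner_add_left norm_eq_1)
    then show ?thesis using that[OF op x0 sub cont(1)[of v] inj(1)[of v]] v(1) by blast
  next
    assume "\<exists>P. linear P \<and> (\<forall>x. P (P x) = P x) \<and> (\<forall>x y. (x - P x) \<bullet> P y = 0) \<and> \<Theta> 0 = 0 \<and>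
       (\<forall>x\<in>ball 0 r. f (\<psi> x) - c = (norm (\<Theta> x - P (\<Theta> x)))\<^sup>2 - (norm (P (\<Theta> x)))\<^sup>2)"
    then obtain P where P: "linear P" "\<forall>x. P (P x) = P x" "\<forall>x y. (x - P x) \<bullet> P y = 0" "\<Theta> 0 = 0"
      and f: "\<And>x. x \<in> ball 0 r \<Longrightarrow> f (\<psi> x) - c = (norm (\<Theta> x - P (\<Theta> x)))\<^sup>2 - (norm (P (\<Theta> x)))\<^sup>2" by blast
    have "\<forall>y\<in>O'. f y - c = (norm (\<Theta> (\<phi> y) - P (\<Theta> (\<phi> y))))\<^sup>2 - (norm (P (\<Theta> (\<phi> y))))\<^sup>2"
      using f[OF \<phi>_in] \<psi>\<phi> by simp
    then show ?thesis using that[OF op x0 sub cont(2) inj(2)] P \<phi>0 by auto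
  qed
qed

text \<open>A continuous injection of an open set into a space of the same dimension is a
  homeomorphism onto an open image; this is the only place where the inverse of
  \<open>\<Theta>\<close> has to be considered.\<close>

lemma parametrisation_through_chart:
  fixes \<phi> :: "'a \<Rightarrow> real ^ 'n::finite" and \<Theta> :: "real ^ 'n \<Rightarrow> real ^ 'n"
  assumes U: "openin M U" and \<phi>: "homeomorphic_map (subtopology M U) (top_of_set (\<phi> ` U)) \<phi>"
    and O': "open O'" "O' \<subseteq> \<phi> ` U" and \<Theta>: "continuous_on O' \<Theta>" "inj_on \<Theta> O'" and b: "orthonormal_frame b"
  shows "parametrisation CARD('n) M {q \<in> U. \<phi> q \<in> O'} (frame_coordinates b \<circ> \<Theta> \<circ> \<phi>)"
proof -
  let ?V = "{q \<in> U. \<phi> q \<in> O'}"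
  have top: "topspace (subtopology M U) = U" using openin_subset[OF U] by auto
  have "openin (subtopology M U) {q \<in> topspace (subtopology M U). \<phi> q \<in> O'}"
    using O' by (intro openin_continuous_map_preimage[OF homeomorphic_imp_continuous_map[OF \<phi>]])
      (auto simp: openin_open)
  then have V: "openin M ?V" unfolding top using U by (simp add: openin_open_subtopology)
  have hom_\<phi>: "homeomorphic_map (subtopology M ?V) (top_of_set O') \<phi>"
  proof -
    have "homeomorphic_map (subtopology (subtopology M U) ?V) (subtopology (top_of_set (\<phi> ` U)) O') \<phi>"
      using O' openin_subset[OF U] by (intro homeomorphic_map_subtopologies[OF \<phi>]) auto
    moreover have "U \<inter> ?V = ?V" "\<phi> ` U \<inter> O' = O'" using O' by auto
    ultimately show ?thesis by (simp add: subtopology_subtopology)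
  qed
  obtain \<Theta>' where "homeomorphism O' (\<Theta> ` O') \<Theta> \<Theta>'"
    using invariance_of_domain_homeomorphism[OF O'(1) \<Theta>(1) order_refl \<Theta>(2)] by blast
  then have hom_\<Theta>: "homeomorphic_map (top_of_set O') (top_of_set (\<Theta> ` O')) \<Theta>"
    unfolding homeomorphic_map_maps homeomorphic_maps_def homeomorphism_def by (intro exI[of _ \<Theta>']) auto
  have op: "open (\<Theta> ` O')" by (rule invariance_of_domain[OF \<Theta>(1) O'(1) \<Theta>(2)])
  note hb = homeomorphic_map_frame_coordinates[OF b, simplified]
  let ?W = "frame_coordinates b ` (\<Theta> ` O')"
  have sub: "?W \<subseteq> topspace (Euclidean_space CARD('n))"
    using homeomorphic_imp_surjective_map[OF hb] by auto
  have W: "openin (Euclidean_space CARD('n)) ?W"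
    using homeomorphic_map_openness[OF hb, of "\<Theta> ` O'"] op by simp
  have "homeomorphic_map (top_of_set (\<Theta> ` O')) (subtopology (Euclidean_space CARD('n)) ?W) (frame_coordinates b)"
    using sub by (intro homeomorphic_map_subtopologies[OF hb]) auto
  from homeomorphic_map_compose[OF hom_\<phi> homeomorphic_map_compose[OF hom_\<Theta> this]]
  show ?thesis unfolding parametrisation_def using V W by (auto simp: comp_assoc)
qed

text \<open>Continuity follows from the normal forms: near each point \<open>f\<close> is a
  coordinate or a quadratic polynomial in coordinates, and local continuity is pasted
  together.\<close>

lemma topological_Morse_functionI:
  assumes man: "topological_manifold n M"
    and pt: "\<And>x. x \<in> topspace M \<Longrightarrow> regular_point n M f x \<or> critical_point n M f x"
  shows "topological_Morse_function n M f"
proof -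
  have coord: "continuous_map (subtopology M U) euclideanreal (\<lambda>y. \<phi> y i)" if "parametrisation n M U \<phi>" for U \<phi> i
  proof -
    obtain V where "homeomorphic_map (subtopology M U) (subtopology (Euclidean_space n) V) \<phi>"
      using \<open>parametrisation n M U \<phi>\<close> by (auto simp: parametrisation_def)
    then have "continuous_map (subtopology M U) (subtopology (Euclidean_space n) V) \<phi>"
      by (rule homeomorphic_imp_continuous_map)
    then have "continuous_map (subtopology M U) (powertop_real UNIV) \<phi>"
      by (simp add: Euclidean_space_def continuous_map_in_subtopology)
    then show ?thesis by (simp add: continuous_map_componentwise_UNIV)
  qed
  have loc: "\<exists>U. openin M U \<and> x \<in> U \<and> continuous_map (subtopology M U) euclideanreal f" if "x \<in> topspace M" for x
    using pt[OF that]
  proof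
    assume "regular_point n M f x"
    then obtain U \<phi> i where U: "x \<in> U" "parametrisation n M U \<phi>" "\<forall>y\<in>U. \<phi> y i = f y"
      by (auto simp: regular_point_def)
    have "continuous_map (subtopology M U) euclideanreal f"
      by (rule continuous_map_eq[OF coord[OF U(2), of i]]) (use U(3) in auto)
    then show ?thesis using U by (auto simp: parametrisation_def)
  next
    assume "critical_point n M f x"
    then obtain j U \<phi> where U: "x \<in> U" "parametrisation n M U \<phi>"
      and f: "\<forall>y\<in>U. f y - f x = (\<Sum>i<n - j. (\<phi> y i)\<^sup>2) - (\<Sum>i\<in>{n - j..<n}. (\<phi> y i)\<^sup>2)"
      by (auto simp: critical_point_def)
    have "continuous_map (subtopology M U) euclideanreal
        (\<lambda>y. f x + ((\<Sum>i<n - j. (\<phi> y i)\<^sup>2) - (\<Sum>i\<in>{n - j..<n}. (\<phi> y i)\<^sup>2)))"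
      by (intro continuous_intros coord U(2)) auto
    then have "continuous_map (subtopology M U) euclideanreal f"
      by (rule continuous_map_eq) (use f in \<open>auto simp: algebra_simps\<close>)
    then show ?thesis using U by (auto simp: parametrisation_def)
  qed
  define \<U> where "\<U> = {U. openin M U \<and> continuous_map (subtopology M U) euclideanreal f}"
  have "continuous_map M euclideanreal f"
  proof (rule pasting_lemma[of \<U> M "\<lambda>U. U" euclideanreal "\<lambda>_. f"])
    fix x assume "x \<in> topspace M"
    from loc[OF this] show "\<exists>U. U \<in> \<U> \<and> x \<in> U \<and> f x = f x" unfolding \<U>_def by blast
  qed (simp_all add: \<U>_def)
  with man show ?thesis unfolding topological_Morse_function_def by (intro conjI ballI pt)
qed

section \<open>Gradients and Hessians in a chart\<close>

lemma has_derivative_chart_gradient: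
  fixes h :: "real ^ 'n::finite \<Rightarrow> real"
  assumes S: "open S" "y \<in> S" and diff: "h differentiable_on S"
  shows "(h has_derivative (\<lambda>v. (\<chi> k. partial_deriv S k h y) \<bullet> v)) (at y)"
proof -
  let ?D = "frechet_derivative h (at y within S)"
  have "h differentiable (at y within S)" using diff S(2) by (simp add: differentiable_on_def)
  then have "(h has_derivative ?D) (at y within S)" unfolding frechet_derivative_works .
  then have D: "(h has_derivative ?D) (at y)" unfolding at_within_open[OF S(2,1)] .
  then have lin: "linear ?D" by (rule has_derivative_linear)
  have "?D v = (\<chi> k. partial_deriv S k h y) \<bullet> v" for v
  proof -
    have "?D v = ?D (\<Sum>k\<in>UNIV. (v $ k) *\<^sub>R axis k 1)"
      using basis_expansion[of v] by (simp add: scalar_mult_eq_scaleR)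
    also have "\<dots> = (\<Sum>k\<in>UNIV. v $ k * ?D (axis k 1))" by (simp add: linear_sum[OF lin] linear_scale[OF lin])
    finally show ?thesis by (simp add: inner_vec_def partial_deriv_def mult.commute)
  qed
  then have "?D = (\<lambda>v. (\<chi> k. partial_deriv S k h y) \<bullet> v)" by (rule ext)
  with D show ?thesis by simp
qed

text \<open>The Christoffel part of the Hessian is the gradient paired with a vector quadratic in
  \<open>v\<close> whose coefficients do not involve \<open>f\<close>. In this form one bilinear map
  serves all functions of the family.\<close>

lemma convex_function_chart_second_order:
  fixes c :: "('a, 'n::finite) chart" and g :: "('a, 'n) metric"
  defines "S \<equiv> chart_image c"
  assumes conv: "convex_function CARD('n) A g f" and c: "c \<in> A" and S: "open S" "x0 \<in> S"
  defines "h \<equiv> f \<circ> chart_inv c"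
  defines "grad \<equiv> \<lambda>y. \<chi> k. partial_deriv S k h y"
  defines "H \<equiv> \<lambda>v. \<chi> k. (\<chi> i. partial_deriv S i (partial_deriv S k h) x0) \<bullet> v"
  shows "\<And>y. y \<in> S \<Longrightarrow> (h has_derivative (\<lambda>v. grad y \<bullet> v)) (at y)"
    and "(grad has_derivative H) (at x0)"
    and "\<And>v. v \<noteq> 0 \<Longrightarrow> H v \<bullet> v - grad x0 \<bullet> (\<chi> k. \<Sum>i\<in>UNIV. \<Sum>j\<in>UNIV. christoffel g c x0 k i j * v $ i * v $ j) > 0"
proof -
  have sm: "smooth_on S h" and pd: "positive_definite CARD('n) (hessian g c f x0)"
    using conv c S by (auto simp: convex_function_def S_def h_def)
  have "Ck_on (Suc (Suc 0)) S h" using sm by (auto simp: smooth_on_def)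
  then have diff: "h differentiable_on S" "\<And>k. partial_deriv S k h differentiable_on S"
    by (simp_all add: partial_deriv_def[abs_def])
  show "(h has_derivative (\<lambda>v. grad y \<bullet> v)) (at y)" if "y \<in> S" for y
    unfolding grad_def using S(1) that diff(1) by (rule has_derivative_chart_gradient)
  show "(grad has_derivative H) (at x0)"
    unfolding has_derivative_componentwise_within[of grad] unfolding grad_def H_def
    by (auto simp: Basis_vec_def inner_axis intro!: has_derivative_chart_gradient S diff)
  fix v :: "real ^ 'n" assume "v \<noteq> 0"
  have "v \<bullet> (hessian g c f x0 *v v) > 0"
    using pd \<open>v \<noteq> 0\<close> by (simp add: positive_definite_def model_space_def)
  also have "v \<bullet> (hessian g c f x0 *v v) = (\<Sum>i\<in>UNIV. \<Sum>j\<in>UNIV. v $ i * v $ j *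
      (partial_deriv S i (partial_deriv S j h) x0 - (\<Sum>k\<in>UNIV. christoffel g c x0 k i j * partial_deriv S k h x0)))"
    by (simp add: inner_vec_def matrix_vector_mult_def hessian_def S_def h_def Let_def sum_distrib_left mult_ac)
  also have "\<dots> = (\<Sum>i\<in>UNIV. \<Sum>j\<in>UNIV. v $ i * v $ j * partial_deriv S i (partial_deriv S j h) x0)
      - (\<Sum>i\<in>UNIV. \<Sum>j\<in>UNIV. \<Sum>k\<in>UNIV. v $ i * v $ j * (christoffel g c x0 k i j * partial_deriv S k h x0))"
    by (simp add: right_diff_distrib sum_subtractf sum_distrib_left)
  also have "(\<Sum>i\<in>UNIV. \<Sum>j\<in>UNIV. v $ i * v $ j * partial_deriv S i (partial_deriv S j h) x0) = H v \<bullet> v"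
    unfolding H_def by (subst sum.swap) (simp add: inner_vec_def sum_distrib_left sum_distrib_right mult_ac)
  also have "(\<Sum>i\<in>UNIV. \<Sum>j\<in>UNIV. \<Sum>k\<in>UNIV. v $ i * v $ j * (christoffel g c x0 k i j * partial_deriv S k h x0))
     = (\<Sum>i\<in>UNIV. \<Sum>k\<in>UNIV. \<Sum>j\<in>UNIV. v $ i * v $ j * (christoffel g c x0 k i j * partial_deriv S k h x0))"
    by (intro sum.cong refl sum.swap)
  also have "\<dots> = (\<Sum>k\<in>UNIV. \<Sum>i\<in>UNIV. \<Sum>j\<in>UNIV. v $ i * v $ j * (christoffel g c x0 k i j * partial_deriv S k h x0))"
    by (rule sum.swap)
  also have "\<dots> = grad x0 \<bullet> (\<chi> k. \<Sum>i\<in>UNIV. \<Sum>j\<in>UNIV. christoffel g c x0 k i j * v $ i * v $ j)"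
    by (simp add: inner_vec_def grad_def sum_distrib_left mult_ac)
  finally show "H v \<bullet> v - grad x0 \<bullet> (\<chi> k. \<Sum>i\<in>UNIV. \<Sum>j\<in>UNIV. christoffel g c x0 k i j * v $ i * v $ j) > 0" .
qed

lemma bounded_bilinear_coefficients:
  fixes a :: "'n::finite \<Rightarrow> 'n \<Rightarrow> 'n \<Rightarrow> real"
  shows "bounded_bilinear (\<lambda>(v::real^'n) (w::real^'n). \<chi> k. \<Sum>i\<in>UNIV. \<Sum>j\<in>UNIV. a k i j * v $ i * w $ j)"
  unfolding bilinear_conv_bounded_bilinear[symmetric] bilinear_def
  by (auto intro!: linearI simp: vec_eq_iff sum.distrib[symmetric] sum_distrib_left algebra_simps)

text \<open>Only the functions active at \<open>p\<close> enter the normal form, since they share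
  the value \<open>f p\<close>; finiteness of \<open>Fx\<close> provides a neighbourhood in which
  the remaining ones never attain the minimum.\<close>

lemma locally_min_regular_or_critical:
  fixes A :: "('a, 'n::finite) chart set"
  assumes charts: "\<And>c. c \<in> A \<Longrightarrow> is_chart CARD('n) M c" "(\<Union>c\<in>A. fst c) = topspace M"
    and N: "openin M N" "p \<in> N" and fin: "finite Fx"
    and conv: "\<And>h. h \<in> Fx \<Longrightarrow> convex_function CARD('n) A g h"
    and min: "\<And>y. y \<in> N \<Longrightarrow> is_minimum {h y |h. h \<in> Fx} (f y)"
  shows "regular_point CARD('n) M f p \<or> critical_point CARD('n) M f p"
proof -
  have "p \<in> topspace M" using N openin_subset by blast
  then obtain c where c: "c \<in> A" "p \<in> fst c" using charts(2) by blast
  obtain U \<phi> where c_eq: "c = (U, \<phi>)" by (cases c)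
  have pU: "p \<in> U" using c c_eq by simp
  have chart: "openin M U" "homeomorphic_map (subtopology M U) (top_of_set (\<phi> ` U)) \<phi>" "open (\<phi> ` U)"
    using charts(1)[OF c(1)] by (simp_all add: c_eq is_chart_def model_space_def)
  have UM: "U \<subseteq> topspace M" using chart(1) by (rule openin_subset)
  have inj: "inj_on \<phi> U" using homeomorphic_imp_injective_map[OF chart(2)] UM by (simp add: Int_absorb1)
  have image: "chart_image c = \<phi> ` U" by (simp add: chart_image_def c_eq)
  have inv: "chart_inv c (\<phi> q) = q" if "q \<in> U" for q using inj that by (simp add: chart_inv_def c_eq)
  define x0 where "x0 = \<phi> p"
  define hh where "hh h = h \<circ> chart_inv c" for h :: "'a \<Rightarrow> real"
  have x0: "x0 \<in> chart_image c" using pU by (simp add: x0_def image)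
  have op: "open (chart_image c)" using chart(3) image by simp
  have hh_\<phi>: "hh h (\<phi> q) = h q" if "q \<in> U" for h q using inv[OF that] by (simp add: hh_def)
  have hh_cont: "continuous_on (chart_image c) (hh h)" if "h \<in> Fx" for h
  proof -
    have "Ck_on 0 (chart_image c) (hh h)"
      using conv[OF that] c(1) unfolding convex_function_def smooth_on_def hh_def by blast
    then show ?thesis by simp
  qed
  define I where "I = {h \<in> Fx. h p = f p}"
  have finI: "finite I" and IFx: "I \<subseteq> Fx" using fin by (auto simp: I_def)
  have ge: "f y \<le> h y" if "y \<in> N" "h \<in> Fx" for y h using min[OF that(1)] that(2) by (auto simp: is_minimum_def)
  have att: "\<exists>h\<in>Fx. f y = h y" if "y \<in> N" for y using min[OF that] by (auto simp: is_minimum_def)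
  obtain h0 where h0: "h0 \<in> I" using att[OF N(2)] by (auto simp: I_def)
  define S1 where "S1 = \<phi> ` (U \<inter> N)"
  have S1: "open S1"
  proof -
    have "openin (subtopology M U) (U \<inter> N)" using N(1) by (metis Int_commute openin_subtopology_Int)
    then have "openin (top_of_set (\<phi> ` U)) (\<phi> ` (U \<inter> N))"
      using homeomorphic_imp_open_map[OF chart(2)] by (simp add: open_map_def)
    then show ?thesis using chart(3) by (simp add: S1_def openin_open_eq)
  qed
  have S1_sub: "S1 \<subseteq> chart_image c" by (auto simp: S1_def image)
  \<comment> \<open>A single active function \<open>h0\<close> is enough to exclude the inactive
    ones: where they lie strictly above it, they lie strictly above \<open>f\<close>.\<close>
  define S where "S = {y \<in> S1. \<forall>h\<in>Fx - I. hh h0 y < hh h y}"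
  have S_eq: "S = S1 \<inter> (\<Inter>h\<in>Fx - I. {y \<in> S1. hh h y - hh h0 y \<in> {0<..}})" by (auto simp: S_def)
  have "open {y \<in> S1. hh h y - hh h0 y \<in> {0<..}}" if "h \<in> Fx - I" for h
  proof -
    have "continuous_on S1 (\<lambda>y. hh h y - hh h0 y)"
      using that h0 IFx by (intro continuous_intros continuous_on_subset[OF hh_cont S1_sub]) auto
    then have "open (S1 \<inter> (\<lambda>y. hh h y - hh h0 y) -` {0<..})"
      using S1 open_greaterThan by (rule continuous_open_preimage)
    moreover have "S1 \<inter> (\<lambda>y. hh h y - hh h0 y) -` {0<..} = {y \<in> S1. hh h y - hh h0 y \<in> {0<..}}" by auto
    ultimately show ?thesis by (simp only:)
  qed
  then have S: "open S" unfolding S_eq using fin by (intro open_Int S1 open_INT) auto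
  have x0S: "x0 \<in> S"
  proof -
    have "hh h0 x0 < hh h x0" if "h \<in> Fx - I" for h
      using ge[OF N(2), of h] that h0 by (auto simp: x0_def hh_\<phi>[OF pU] I_def)
    then show ?thesis using pU N(2) by (simp add: S_def S1_def x0_def)
  qed
  have S_sub: "S \<subseteq> chart_image c" using S1_sub by (auto simp: S_def)
  have S_inv: "chart_inv c y \<in> N" if "y \<in> S" for y using that inv by (auto simp: S_def S1_def)
  note so = convex_function_chart_second_order[OF conv c(1) op, folded hh_def]
  obtain O' and \<Theta> :: "real ^ 'n \<Rightarrow> real ^ 'n" where O': "open O'" "x0 \<in> O'" "O' \<subseteq> S" and \<Theta>: "continuous_on O' \<Theta>" "inj_on \<Theta> O'"
    and alt: "(\<exists>v. norm v = 1 \<and> (\<forall>y\<in>O'. \<Theta> y \<bullet> v = f (chart_inv c y))) \<or>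
     (\<exists>P. linear P \<and> (\<forall>x. P (P x) = P x) \<and> (\<forall>x y. (x - P x) \<bullet> P y = 0) \<and> \<Theta> x0 = 0 \<and>
       (\<forall>y\<in>O'. f (chart_inv c y) - f p = (norm (\<Theta> y - P (\<Theta> y)))\<^sup>2 - (norm (P (\<Theta> y)))\<^sup>2))"
  proof (rule covariant_min_normal_form[OF S x0S finI _ _ bounded_bilinear_coefficients, where h = hh and f = "\<lambda>y. f (chart_inv c y)" and c = "f p"])
    fix h y assume h: "h \<in> I" and y: "y \<in> S"
    show "(hh h has_derivative (\<lambda>v. (\<chi> k. partial_deriv (chart_image c) k (hh h) y) \<bullet> v)) (at y)"
      using so(1)[OF _ x0] h y IFx S_sub by blast
    show "f (chart_inv c y) \<le> hh h y" using ge[OF S_inv[OF y]] h IFx by (auto simp: hh_def)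
  next
    fix h assume h: "h \<in> I"
    show "((\<lambda>y. \<chi> k. partial_deriv (chart_image c) k (hh h) y) has_derivative
        (\<lambda>v. \<chi> k. (\<chi> i. partial_deriv (chart_image c) i (partial_deriv (chart_image c) k (hh h)) x0) \<bullet> v)) (at x0)"
      using so(2)[OF _ x0] h IFx by blast
    show "hh h x0 = f p" using h by (simp add: x0_def hh_\<phi>[OF pU] I_def)
    fix v :: "real ^ 'n" assume "v \<noteq> 0"
    then show "(\<chi> k. (\<chi> i. partial_deriv (chart_image c) i (partial_deriv (chart_image c) k (hh h)) x0) \<bullet> v) \<bullet> v
      - (\<chi> k. partial_deriv (chart_image c) k (hh h) x0) \<bullet> (\<chi> k. \<Sum>i\<in>UNIV. \<Sum>j\<in>UNIV. christoffel g c x0 k i j * v $ i * v $ j) > 0"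
      using so(3)[OF _ x0] h IFx by blast
  next
    fix y assume y: "y \<in> S"
    obtain h where h: "h \<in> Fx" "f (chart_inv c y) = h (chart_inv c y)" using att[OF S_inv[OF y]] by blast
    have "h \<in> I"
    proof (rule ccontr)
      assume "h \<notin> I"
      then have "hh h0 y < hh h y" using h y by (simp add: S_def)
      moreover have "f (chart_inv c y) \<le> hh h0 y" using ge[OF S_inv[OF y]] h0 IFx by (auto simp: hh_def)
      ultimately show False using h(2) by (simp add: hh_def)
    qed
    then show "\<exists>h\<in>I. f (chart_inv c y) = hh h y" using h(2) by (auto simp: hh_def)
  qed
  have O'_sub: "O' \<subseteq> \<phi> ` U" using O'(3) S_sub image by simp
  define V where "V = {q \<in> U. \<phi> q \<in> O'}"
  have par: "parametrisation CARD('n) M V (frame_coordinates b \<circ> \<Theta> \<circ> \<phi>)" if "orthonormal_frame b" for b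
    unfolding V_def by (rule parametrisation_through_chart[OF chart(1,2) O'(1) O'_sub \<Theta> that])
  have pV: "p \<in> V" using pU O'(2) by (simp add: V_def x0_def)
  from alt show ?thesis
  proof
    assume "\<exists>v. norm v = 1 \<and> (\<forall>y\<in>O'. \<Theta> y \<bullet> v = f (chart_inv c y))"
    then obtain v where v: "norm v = 1" "\<And>y. y \<in> O' \<Longrightarrow> \<Theta> y \<bullet> v = f (chart_inv c y)" by blast
    obtain b where b: "orthonormal_frame b" "b 0 = v" by (rule orthonormal_frame_with_first[OF v(1)])
    have "(frame_coordinates b \<circ> \<Theta> \<circ> \<phi>) q 0 = f q" if "q \<in> V" for q
      using that v(2)[of "\<phi> q"] b(2) inv[of q] by (simp add: frame_coordinates_def V_def)
    then have "regular_point CARD('n) M f p"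
      unfolding regular_point_def using pV par[OF b(1)]
      by (intro exI[of _ V] exI[of _ "frame_coordinates b \<circ> \<Theta> \<circ> \<phi>"] conjI exI[of _ 0]) auto
    then show ?thesis ..
  next
    assume "\<exists>P. linear P \<and> (\<forall>x. P (P x) = P x) \<and> (\<forall>x y. (x - P x) \<bullet> P y = 0) \<and> \<Theta> x0 = 0 \<and>
       (\<forall>y\<in>O'. f (chart_inv c y) - f p = (norm (\<Theta> y - P (\<Theta> y)))\<^sup>2 - (norm (P (\<Theta> y)))\<^sup>2)"
    then obtain P where P: "linear P" "\<And>x. P (P x) = P x" "\<And>x y. (x - P x) \<bullet> P y = 0" "\<Theta> x0 = 0"
      and f: "\<And>y. y \<in> O' \<Longrightarrow> f (chart_inv c y) - f p = (norm (\<Theta> y - P (\<Theta> y)))\<^sup>2 - (norm (P (\<Theta> y)))\<^sup>2" by blast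
    obtain b k where b: "orthonormal_frame b" "k \<le> DIM(real ^ 'n)" "\<And>i. i < k \<Longrightarrow> P (b i) = 0"
      "\<And>i. k \<le> i \<Longrightarrow> i < DIM(real ^ 'n) \<Longrightarrow> P (b i) = b i"
      using orthonormal_frame_adapted[OF P(1-3)] by blast
    note norms = adapted_frame_norms[OF P(1,3) b]
    have k: "k \<le> CARD('n)" using b(2) by simp
    let ?\<xi> = "frame_coordinates b \<circ> \<Theta> \<circ> \<phi>"
    \<comment> \<open>The \<open>k\<close> frame vectors in the kernel of \<open>P\<close> carry the
      positive squares, so the index is \<open>CARD('n) - k\<close>, the dimension of the range of
      \<open>P\<close>.\<close>
    have "f q - f p = (\<Sum>i<CARD('n) - (CARD('n) - k). (?\<xi> q i)\<^sup>2) - (\<Sum>i\<in>{CARD('n) - (CARD('n) - k)..<CARD('n)}. (?\<xi> q i)\<^sup>2)"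
      if "q \<in> V" for q
    proof -
      have "f q - f p = (\<Sum>i<k. (\<Theta> (\<phi> q) \<bullet> b i)\<^sup>2) - (\<Sum>i\<in>{k..<CARD('n)}. (\<Theta> (\<phi> q) \<bullet> b i)\<^sup>2)"
        using that f[of "\<phi> q"] inv[of q] norms[of "\<Theta> (\<phi> q)"] by (simp add: V_def)
      also have "\<dots> = (\<Sum>i<k. (?\<xi> q i)\<^sup>2) - (\<Sum>i\<in>{k..<CARD('n)}. (?\<xi> q i)\<^sup>2)"
        using k by (intro arg_cong2[where f = "(-)"] sum.cong) (auto simp: frame_coordinates_def)
      finally show ?thesis using k by simp
    qed
    moreover have "?\<xi> p = (\<lambda>_. 0)" using P(4) by (auto simp: frame_coordinates_def x0_def)
    ultimately have "critical_point CARD('n) M f p"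
      unfolding critical_point_def using pV par[OF b(1)]
      by (intro exI[of _ "CARD('n) - k"] conjI exI[of _ V] exI[of _ ?\<xi>]) auto
    then show ?thesis ..
  qed
qed

theorem theorem1:
  fixes n :: nat
    and M :: "'a topology"
    and A :: "('a, 'n::finite) chart set"
    and g :: "('a, 'n) metric"
    and F :: "nat \<Rightarrow> 'a \<Rightarrow> real"
    and f :: "'a \<Rightarrow> real"
  assumes "riemannian_manifold n M A g"
    and "\<And>i. convex_function n A g (F i)"
    and "\<And>x. x \<in> topspace M \<Longrightarrow> is_minimum {h x |h. h \<in> range F} (f x)"
    and "\<And>x. x \<in> topspace M \<Longrightarrow>
           \<exists>N Fx. openin M N \<and> x \<in> N \<and> finite Fx \<and> Fx \<subseteq> range F \<and>
             (\<forall>y\<in>N. is_minimum {h y |h. h \<in> Fx} (f y))"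
  shows "topological_Morse_function n M f"
proof (rule topological_Morse_functionI)
  have sm: "smooth_manifold n M A" using assms(1) by (simp add: riemannian_manifold_def)
  then show man: "topological_manifold n M" by (simp add: smooth_manifold_def)
  fix x assume x: "x \<in> topspace M"
  show "regular_point n M f x \<or> critical_point n M f x"
  proof (cases "n = 0")
    \<comment> \<open>Here \<open>real ^ 'n\<close> has positive dimension and the analytic argument
      does not apply. Parametrisations take values in a one-point space, so \<open>x\<close> is
      isolated and critical of index \<open>0\<close> with empty sums.\<close>
    case True
    obtain U \<phi> where U: "x \<in> U" "parametrisation n M U \<phi>" using man x by (auto simp: topological_manifold_def)
    then obtain V where V: "openin M U" "homeomorphic_map (subtopology M U) (subtopology (Euclidean_space n) V) \<phi>"
      by (auto simp: parametrisation_def)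
    have "U \<subseteq> topspace M" using V(1) by (rule openin_subset)
    then have top: "topspace (subtopology M U) = U" by auto
    have zero: "\<phi> y = (\<lambda>_. 0)" if "y \<in> U" for y
    proof -
      have "\<phi> y \<in> topspace (subtopology (Euclidean_space n) V)"
        using homeomorphic_imp_surjective_map[OF V(2)] that unfolding top by blast
      then show ?thesis by (simp add: topspace_Euclidean_space True fun_eq_iff)
    qed
    have "y = x" if "y \<in> U" for y
      using homeomorphic_imp_injective_map[OF V(2), unfolded top] zero[OF that] zero[OF U(1)] that U(1)
      by (simp add: inj_on_def)
    then have f_eq: "f y - f x = (\<Sum>i<n - 0. (\<phi> y i)\<^sup>2) - (\<Sum>i\<in>{n - 0..<n}. (\<phi> y i)\<^sup>2)" if "y \<in> U" for y
      using that True by simp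
    have "critical_point n M f x"
      unfolding critical_point_def
    proof (rule exI[of _ 0], intro conjI)
      show "\<exists>U \<phi>. x \<in> U \<and> parametrisation n M U \<phi> \<and> \<phi> x = (\<lambda>_. 0) \<and>
        (\<forall>y\<in>U. f y - f x = (\<Sum>i<n - 0. (\<phi> y i)\<^sup>2) - (\<Sum>i\<in>{n - 0..<n}. (\<phi> y i)\<^sup>2))"
        using U zero[OF U(1)] f_eq by blast
    qed simp
    then show ?thesis ..
  next
    case False
    then have n: "n = CARD('n)" using sm by (simp add: smooth_manifold_def)
    obtain N Fx where N: "openin M N" "x \<in> N" "finite Fx" "Fx \<subseteq> range F"
      "\<And>y. y \<in> N \<Longrightarrow> is_minimum {h y |h. h \<in> Fx} (f y)" using assms(4)[OF x] by blast
    have "convex_function n A g h" if "h \<in> Fx" for h using that N(4) assms(2) by blast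
    then show ?thesis
      using locally_min_regular_or_critical[of A M N x Fx g f] sm N unfolding n smooth_manifold_def by blast
  qed
qed

end
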